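(* Let $G$ be a strongly balanced connected graph with $v(G)=k\ge2$ vertices and $e(G)$ edges, and let $N_G$ be the number of copies of $G$ in the binomial random-connection model $G_H(\mathcal{X}_n)$ with connection probabilities $p_nH(X_i,X_j)$. Suppose that $$\mathrm{Var}\Big[\sum_{\ell=1}^k f_{(\ell)}(X_1)\Big]>0 .$$ Let $(a_n)_{n\ge1}$ be a sequence of real numbers tending to infinity and such that $$\begin{cases} a_n\ll n^{1/(2+4v(G))} & \text{when } n^{-(v(G)-1)/e(G)}\ll p_n,\\ a_n\ll\big(n^{v(G)}p_n^{e(G)}\big)^{1/(2+4v(G))} & \text{when } p_n\ll n^{-(v(G)-1)/e(G)}.\end{cases}$$ Then, in each of these two cases, the sequence $\big(a_n^{-1}\overline{N}_G\big)_{n\ge1}$, where $$\overline{N}_G:=\frac{N_G-\kappa_1(N_G)}{\sqrt{\kappa_2(N_G)}},$$ satisfies a moderate deviation principle with speed $a_n^2$ and rate function $x^2/2$.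
   Context: Binomial random-connection model. $X_1,\dots,X_n$ are i.i.d. random points of $\mathbb{R}^d$ with common continuous (atomless) distribution $\mu$, $\mathcal{X}_n=\{X_1,\dots,X_n\}$, $H:\mathbb{R}^d\times\mathbb{R}^d\to[0,1]$ is a symmetric measurable function, and $p_n\in(0,1)$ for each $n$; $\mu$ and $H$ do not depend on $n$. Given $\mathcal{X}_n$, each pair $X_i,X_j$ ($i\ne j$) is connected by an edge (written $X_i\sim X_j$) independently with probability $p_nH(X_i,X_j)$. The resulting random graph is $G_H(\mathcal{X}_n)$. Subgraph count. $G=(V_G,E_G)$ is a simple graph with $v(G)=|V_G|=k$, vertex set identified with $[k]=\{1,\dots,k\}$, $e(G)=|E_G|$, and $a(G)$ is the number of automorphisms of $G$. With $[n]^k_{\neq}:=\{\beta\in[n]^k:\beta(i)\ne\beta(j)\text{ for }i\ne j\}$, $$N_G:=\frac{1}{a(G)}\sum_{\beta\in[n]^k_{\neq}}\ \prod_{\{u,v\}\in E_G}\mathbf{1}_{\{X_{\beta(u)}\sim X_{\beta(v)}\}}$$ (which depends on $n$). For $1\le\ell\le k$, $$f_{(\ell)}(x):=\frac{p_n^{e(G)}}{a(G)}\int_{(\mathbb{R}^d)^{k-1}}\prod_{\{u,v\}\in E_G}H(x_u,x_v)\,\mu^{\otimes(k-1)}(\mathrm{d}x_1,\dots,\mathrm{d}x_{\ell-1},\mathrm{d}x_{\ell+1},\dots,\mathrm{d}x_k),\qquad x_\ell:=x.$$ Since $p_n\in(0,1)$, the variance condition does not depend on $n$. $G$ is strongly balanced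 if $\dfrac{e(G')}{v(G')-1}\le\dfrac{e(G)}{v(G)-1}$ for every subgraph $G'\subset G$ with $v(G')\ge2$. $f(n)\ll g(n)$ means $f(n)\ge0$, $g(n)>0$ and $\lim_{n\to\infty}f(n)/g(n)=0$ (for $n$ large). $\kappa_1,\kappa_2$ denote mean and variance. A sequence $(Z_n)$ of real random variables satisfies a moderate deviation principle with speed $s_n\to\infty$ and rate function $I$ if for every Borel set $B\subset\mathbb{R}$, $$-\inf_{x\in B^\circ}I(x)\le\liminf_{n\to\infty}\frac{1}{s_n}\log\mathbb{P}(Z_n\in B)\le\limsup_{n\to\infty}\frac{1}{s_n}\log\mathbb{P}(Z_n\in B)\le-\inf_{x\in\overline{B}}I(x),$$ where $B^\circ$ and $\overline B$ are the interior and closure of $B$. Only large $n$ (for which $\overline{N}_G$ is defined) matters. *)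

theory Defs
  imports "HOL-Probability.Probability"
begin

section \<open>Finite simple graphs\<close>

text \<open>An edge is a two-element vertex set. Vertices are natural numbers, so that a function of
  the two endpoints of an edge \<open>e\<close> can be written with \<open>Min e\<close> and \<open>Max e\<close>; it is only ever used
  for symmetric functions.\<close>

definition all_edges :: "nat set \<Rightarrow> nat set set" where
  "all_edges V = {e. e \<subseteq> V \<and> card e = 2}"

definition simple_graph :: "nat set \<Rightarrow> nat set set \<Rightarrow> bool" where
  "simple_graph V E \<longleftrightarrow> finite V \<and> E \<subseteq> all_edges V"

definition connected_graph :: "nat set \<Rightarrow> nat set set \<Rightarrow> bool" where
  "connected_graph V E \<longleftrightarrow> V \<noteq> {} \<and> (\<forall>u\<in>V. \<forall>v\<in>V. (u, v) \<in> {(x, y). {x, y} \<in> E}\<^sup>*)"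

definition graph_automorphisms :: "nat set \<Rightarrow> nat set set \<Rightarrow> (nat \<Rightarrow> nat) set" where
  "graph_automorphisms V E =
     {\<pi> \<in> V \<rightarrow>\<^sub>E V. bij_betw \<pi> V V \<and> (\<forall>u\<in>V. \<forall>v\<in>V. {u, v} \<in> E \<longleftrightarrow> {\<pi> u, \<pi> v} \<in> E)}"

definition strongly_balanced :: "nat set \<Rightarrow> nat set set \<Rightarrow> bool" where
  "strongly_balanced V E \<longleftrightarrow>
     (\<forall>V' E'. V' \<subseteq> V \<and> E' \<subseteq> E \<and> simple_graph V' E' \<and> 2 \<le> card V' \<longrightarrow>
        real (card E') / (real (card V') - 1) \<le> real (card E) / (real (card V) - 1))"

section \<open>The binomial random-connection model\<close>

text \<open>\<open>X 1, \<dots>, X n\<close> are the random points and \<open>\<Gamma>\<close> is the random edge set on the index set \<open>{1..n}\<close>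
  (\<open>{i, j} \<in> \<Gamma> \<omega>\<close> means that \<open>X i \<omega>\<close> and \<open>X j \<omega>\<close> are connected).\<close>

definition points_sigma ::
    "'a measure \<Rightarrow> nat \<Rightarrow> (nat \<Rightarrow> 'a \<Rightarrow> 'v::euclidean_space) \<Rightarrow> 'a measure" where
  "points_sigma M n X =
     vimage_algebra (space M) (\<lambda>\<omega>. \<lambda>i\<in>{1..n}. X i \<omega>) (\<Pi>\<^sub>M i\<in>{1..n}. borel)"

text \<open>The last condition says that, conditionally on the points, the edge events are independent,
  and \<open>{i, j}\<close> is an edge with probability \<open>p * H (X i) (X j)\<close> (take \<open>A\<close> to be a singleton).\<close>

definition binomial_random_connection_model ::
    "'a measure \<Rightarrow> nat \<Rightarrow> 'v::euclidean_space measure \<Rightarrow> ('v \<Rightarrow> 'v \<Rightarrow> real) \<Rightarrow> real \<Rightarrow>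
     (nat \<Rightarrow> 'a \<Rightarrow> 'v) \<Rightarrow> ('a \<Rightarrow> nat set set) \<Rightarrow> bool" where
  "binomial_random_connection_model M n \<mu> H p X \<Gamma> \<longleftrightarrow>
     prob_space M \<and>
     (\<forall>i\<in>{1..n}. X i \<in> measurable M borel \<and> distr M borel (X i) = \<mu>) \<and>
     prob_space.indep_vars M (\<lambda>_. borel) X {1..n} \<and>
     (\<forall>\<omega>\<in>space M. \<Gamma> \<omega> \<subseteq> all_edges {1..n}) \<and>
     (\<forall>e\<in>all_edges {1..n}. {\<omega> \<in> space M. e \<in> \<Gamma> \<omega>} \<in> sets M) \<and>
     (\<forall>A\<subseteq>all_edges {1..n}. AE \<omega> in M.
        real_cond_exp M (points_sigma M n X) (indicator {\<omega> \<in> space M. A \<subseteq> \<Gamma> \<omega>}) \<omega>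
          = (\<Prod>e\<in>A. p * H (X (Min e) \<omega>) (X (Max e) \<omega>)))"

definition subgraph_count ::
    "nat set \<Rightarrow> nat set set \<Rightarrow> nat \<Rightarrow> nat set set \<Rightarrow> real" where
  "subgraph_count V E n \<Gamma> =
     1 / real (card (graph_automorphisms V E)) *
       (\<Sum>\<beta> \<in> {\<beta> \<in> V \<rightarrow>\<^sub>E {1..n}. inj_on \<beta> V}. \<Prod>e\<in>E. of_bool (\<beta> ` e \<in> \<Gamma>))"

definition subgraph_marginal ::
    "'v::euclidean_space measure \<Rightarrow> ('v \<Rightarrow> 'v \<Rightarrow> real) \<Rightarrow> real \<Rightarrow> nat set \<Rightarrow> nat set set \<Rightarrow>
     nat \<Rightarrow> 'v \<Rightarrow> real" where
  "subgraph_marginal \<mu> H p V E l x =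
     p ^ card E / real (card (graph_automorphisms V E)) *
       (\<integral>y. (\<Prod>e\<in>E. H ((y(l := x)) (Min e)) ((y(l := x)) (Max e))) \<partial>(\<Pi>\<^sub>M i\<in>V - {l}. \<mu>))"

definition normalized :: "'a measure \<Rightarrow> ('a \<Rightarrow> real) \<Rightarrow> 'a \<Rightarrow> real" where
  "normalized M Z \<omega> =
     (Z \<omega> - prob_space.expectation M Z) / sqrt (prob_space.variance M Z)"

section \<open>Asymptotics and moderate deviations\<close>

definition much_less :: "(nat \<Rightarrow> real) \<Rightarrow> (nat \<Rightarrow> real) \<Rightarrow> bool" (infix \<open>\<lless>\<close> 50) where
  "f \<lless> g \<longleftrightarrow>
     eventually (\<lambda>n. 0 \<le> f n \<and> 0 < g n) sequentially \<and> (\<lambda>n. f n / g n) \<longlonglongrightarrow> 0"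

text \<open>\<^const>\<open>ln\<close> on the reals satisfies \<open>ln 0 = 0\<close>; a logarithm of probabilities needs
  \<open>- \<infinity>\<close> there.\<close>

definition ln_ereal :: "real \<Rightarrow> ereal" where
  "ln_ereal x = (if x \<le> 0 then - \<infinity> else ereal (ln x))"

definition moderate_deviation_principle ::
    "(nat \<Rightarrow> 'a measure) \<Rightarrow> (nat \<Rightarrow> 'a \<Rightarrow> real) \<Rightarrow> (nat \<Rightarrow> real) \<Rightarrow> (real \<Rightarrow> ereal) \<Rightarrow> bool" where
  "moderate_deviation_principle M Z s I \<longleftrightarrow>
     filterlim s at_top sequentially \<and>
     (\<forall>B\<in>sets borel.
        let r = (\<lambda>n. ereal (1 / s n) *
                       ln_ereal (measure (M n) {\<omega> \<in> space (M n). Z n \<omega> \<in> B}))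
        in - (INF x\<in>interior B. I x) \<le> liminf r \<and> liminf r \<le> limsup r \<and>
           limsup r \<le> - (INF x\<in>closure B. I x))"

end

(*
  The number T of labelled copies of G is a sum of indicators of copies, and two families of copies
  with disjoint vertex sets are independent. Hence joint cumulants of indicators vanish unless the
  copies overlap in a connected way. Growing a connected family copy by copy and using that a
  strongly balanced graph has no subgraph with expected count below
  Phi = min (n, n^k p^e), one gets, with Q = n^k p^e,

    |kappa_m(T)| <= C^m m^m m^(k m) Q^m / Phi^(m - 1).

  The variance is at least c Q^2 / Phi: in the dense regime by projecting T onto sums of functions of
  single points, in the sparse regime because the diagonal terms dominate. So the cumulants of the
  normalized count Z satisfy |kappa_j| / j! <= (C / sqrt Phi)^(j - 2) j^(k (j - 2)).

  Such bounds do not control the exponential moments at scale a, but they do control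
  E T_r(t a Z), where T_r is the exponential series truncated at an order r proportional to a^2:
  it equals exp(t^2 a^2 / 2 + o(a^2)) provided a^(2 k + 1) << sqrt Phi. The functions T_r are good
  enough substitutes for the exponential function in the Chernoff bound and in the tilting argument,
  which yields the moderate deviation principle.
*)
theory Submission
  imports Defs
begin

section \<open>Truncated exponential series\<close>

text \<open>The exponent 2 k + 1 comes from the truncation order. For 3 \<le> j \<le> r the j-th
  term of the cumulant series at e t a is at most (e t a)^2 q^(j - 2) with q = \<theta> e t a r^k,
  where \<theta> has order 1 / sqrt Phi. The factor r^k is the price of j^(k (j - 2)); with r of
  order a^2, q is of order \<theta> a^(2 k + 1), and it must vanish for the quadratic cumulant to
  dominate. This is where the power 1 / (2 + 4 k) of the hypothesis originates. On the other side r
  must be a large multiple of a^2: the discarded part has relative size at most r exp (3 (e t a)^2 -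
  r).

  Truncation destroys two properties that tilting relies on. Multiplicativity is replaced by T_r(x)
  T_r(y) \<le> T_(2 r)(x + y) for nonnegative x and y, and positivity is recovered by taking r even.
  Moreover T_r(c Z) is a polynomial that becomes large again for very negative Z, so the lower bound
  has to estimate the left tail separately, with a cutoff of its own.\<close>

definition trunc_exp :: "nat \<Rightarrow> real \<Rightarrow> real" where
  "trunc_exp r x = (\<Sum>j\<le>r. x ^ j / fact j)"

lemma trunc_exp_0 [simp]: "trunc_exp r 0 = 1"
proof -
  have "trunc_exp r 0 = (\<Sum>j\<in>{0}. 0 ^ j / fact j)"
    unfolding trunc_exp_def by (rule sum.mono_neutral_right) auto
  then show ?thesis by simp
qed

lemma trunc_exp_measurable [measurable]: "trunc_exp r \<in> borel_measurable borel"
  unfolding trunc_exp_def [abs_def] by measurable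

lemma abs_trunc_exp_le: "\<bar>trunc_exp r x\<bar> \<le> trunc_exp r \<bar>x\<bar>"
  unfolding trunc_exp_def
  by (rule order_trans [OF sum_abs]) (simp add: power_abs)

lemma trunc_exp_mono: "0 \<le> x \<Longrightarrow> x \<le> y \<Longrightarrow> trunc_exp r x \<le> trunc_exp r y"
  unfolding trunc_exp_def by (intro sum_mono divide_right_mono power_mono) auto

lemma trunc_exp_ge_1: "0 \<le> x \<Longrightarrow> 1 \<le> trunc_exp r x"
  using trunc_exp_mono [of 0 x r] by simp

lemma trunc_exp_le_exp:
  assumes "0 \<le> x" shows "trunc_exp r x \<le> exp x"
proof -
  have "trunc_exp r x \<le> (\<Sum>j. x ^ j / fact j)"
    unfolding trunc_exp_def
    by (rule sum_le_suminf)
       (use assms summable_exp [of x] in \<open>auto simp: field_simps\<close>)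
  then show ?thesis
    by (simp add: exp_def divide_inverse mult.commute)
qed

text \<open>Every discarded index N exceeds r, so its term is at most exp (- r) (e |x|)^N / N! in
  absolute value, and these bounds sum to at most exp (- r) exp (e |x|).\<close>

lemma trunc_exp_error: "\<bar>exp x - trunc_exp r x\<bar> \<le> exp (exp 1 * \<bar>x\<bar> - real r)"
proof -
  have sm: "summable (\<lambda>n. y ^ n / fact n)" for y :: real
    using summable_exp [of y] by (simp add: divide_inverse mult.commute)
  have expdef: "exp y = (\<Sum>n. y ^ n / fact n)" for y :: real
    by (simp add: exp_def divide_inverse mult.commute)
  let ?c = "\<lambda>n. (exp 1 * \<bar>x\<bar>) ^ n / fact n"
  have "exp x - trunc_exp r x = (\<Sum>n. x ^ (n + Suc r) / fact (n + Suc r))"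
    using suminf_split_initial_segment [OF sm, of x "Suc r"]
    by (simp add: expdef trunc_exp_def lessThan_Suc_atMost)
  also have "\<bar>\<dots>\<bar> \<le> (\<Sum>n. exp (- real r) * ?c (n + Suc r))"
  proof -
    have S: "summable (\<lambda>n. exp (- real r) * ?c (n + Suc r))"
      by (intro summable_mult summable_ignore_initial_segment sm)
    have "norm (\<Sum>n. x ^ (n + Suc r) / fact (n + Suc r)) \<le> (\<Sum>n. exp (- real r) * ?c (n + Suc r))"
    proof (rule norm_suminf_le [OF _ S])
      fix n
      have n_abs: "norm (x ^ N / fact N) = \<bar>x\<bar> ^ N / fact N" for N
        by (simp add: power_abs)
      have "exp (- real r) * exp 1 ^ (n + Suc r) = exp (real n + 1)"
        by (simp flip: exp_of_nat_mult exp_add)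
      then have "exp (- real r) * ?c (n + Suc r) = exp (real n + 1) * \<bar>x\<bar> ^ (n + Suc r) / fact (n + Suc r)"
        by (metis (no_types, lifting) mult.assoc power_mult_distrib times_divide_eq_right)
      moreover have "1 * \<bar>x\<bar> ^ (n + Suc r) \<le> exp (real n + 1) * \<bar>x\<bar> ^ (n + Suc r)"
        by (intro mult_right_mono) auto
      ultimately show "norm (x ^ (n + Suc r) / fact (n + Suc r)) \<le> exp (- real r) * ?c (n + Suc r)"
        using n_abs [of "n + Suc r"] by (simp only: divide_right_mono fact_ge_zero mult_1)
    qed
    then show ?thesis by simp
  qed
  also have "\<dots> = exp (- real r) * (\<Sum>n. ?c (n + Suc r))"
    by (intro suminf_mult summable_ignore_initial_segment sm)
  also have "(\<Sum>n. ?c (n + Suc r)) \<le> (\<Sum>n. ?c n)"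
    unfolding suminf_split_initial_segment [OF sm, of "exp 1 * \<bar>x\<bar>" "Suc r"]
    by (simp add: sum_nonneg del: sum.lessThan_Suc)
  also have "exp (- real r) * (\<Sum>n. ?c n) = exp (exp 1 * \<bar>x\<bar> - real r)"
    by (simp only: expdef [symmetric] exp_add [symmetric]) simp
  finally show ?thesis by simp
qed

lemma trunc_exp_ge_half_exp:
  assumes "0 \<le> x" "exp 1 * x + 1 \<le> real r"
  shows "exp x / 2 \<le> trunc_exp r x"
proof -
  have "exp (exp 1 * \<bar>x\<bar> - real r) \<le> exp (-1)"
    using assms by simp
  also have "\<dots> \<le> 1 / 2"
    using exp_ge_add_one_self [of 1] by (simp add: exp_minus field_simps)
  finally have "exp x - trunc_exp r x \<le> 1 / 2"
    using trunc_exp_error [of x r] by linarith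
  moreover have "1 \<le> exp x" using assms by simp
  ultimately show ?thesis by linarith
qed

lemma trunc_exp_nonpos_le:
  assumes "x \<le> 0" "exp 1 * \<bar>x\<bar> \<le> real r"
  shows "\<bar>trunc_exp r x\<bar> \<le> 2"
proof -
  have "exp (exp 1 * \<bar>x\<bar> - real r) \<le> 1" "exp x \<le> 1" "0 < exp x"
    using assms by simp_all
  then show ?thesis
    using trunc_exp_error [of x r] by linarith
qed

text \<open>For negative x and even r the Lagrange remainder has the odd order r + 1 and is
  negative, so the polynomial lies above exp x.\<close>

lemma trunc_exp_pos_even:
  assumes "even r" shows "0 < trunc_exp r x"
proof (cases "0 \<le> x")
  case True
  then show ?thesis using trunc_exp_ge_1 [of x r] by linarith
next
  case False
  obtain t where "exp x = (\<Sum>m<Suc r. x ^ m / fact m) + exp t / fact (Suc r) * x ^ Suc r"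
    using Maclaurin_exp_le by blast
  moreover have "x ^ Suc r < 0"
    using False assms by (simp add: zero_less_power_eq mult_neg_pos)
  then have "exp t / fact (Suc r) * x ^ Suc r < 0"
    by (intro mult_pos_neg) (auto simp del: power_Suc fact_Suc)
  ultimately have "exp x < trunc_exp r x"
    unfolding trunc_exp_def lessThan_Suc_atMost by linarith
  then show ?thesis by (metis exp_gt_zero less_trans)
qed

text \<open>The square of index pairs bounded by r lies in the triangle i + j \<le> 2 r, and all
  terms are nonnegative. Over the triangle the binomial theorem gives the series of x + y. This
  stands in for exp x exp y = exp (x + y).\<close>

lemma trunc_exp_mult_le:
  assumes "0 \<le> x" "0 \<le> y"
  shows "trunc_exp r x * trunc_exp r y \<le> trunc_exp (2 * r) (x + y)"
proof -
  let ?f = "\<lambda>i j. x ^ i / fact i * (y ^ j / fact j)"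
  have "trunc_exp r x * trunc_exp r y = (\<Sum>(i, j)\<in>{..r} \<times> {..r}. ?f i j)"
    unfolding trunc_exp_def by (simp add: sum_product sum.cartesian_product)
  also have "\<dots> \<le> (\<Sum>(i, j)\<in>{(i, j). i + j \<le> 2 * r}. ?f i j)"
  proof (rule sum_mono2)
    show "finite {(i, j). i + j \<le> 2 * r}"
      by (rule finite_subset [of _ "{..2*r} \<times> {..2*r}"]) auto
  qed (use assms in auto)
  also have "\<dots> = (\<Sum>m\<le>2*r. \<Sum>i\<le>m. ?f i (m - i))"
    by (rule sum.triangle_reindex_eq)
  also have "\<dots> = trunc_exp (2 * r) (x + y)"
    unfolding trunc_exp_def
  proof (rule sum.cong [OF refl])
    fix m
    have "(x + y) ^ m / fact m = (\<Sum>i\<le>m. of_nat (m choose i) * x ^ i * y ^ (m - i) / fact m)"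
      by (simp add: binomial_ring sum_divide_distrib)
    also have "\<dots> = (\<Sum>i\<le>m. ?f i (m - i))"
      by (intro sum.cong refl) (simp add: binomial_fact field_simps)
    finally show "(\<Sum>i\<le>m. ?f i (m - i)) = (x + y) ^ m / fact m" ..
  qed
  finally show ?thesis .
qed

section \<open>The truncated moment generating function\<close>

text \<open>The power series with coefficients \<open>b\<close> is the exponential of the one with coefficients \<open>c\<close>,
  up to order \<open>r\<close>. The truncation error is controlled by evaluating the majorant series at
  \<open>e t\<close> instead of \<open>t\<close>.\<close>

lemma truncated_exponential_formula:
  fixes b c :: "nat \<Rightarrow> real"
  assumes b0: "b 0 = 1"
    and rec: "\<And>j. j < r \<Longrightarrow> real (Suc j) * b (Suc j) = (\<Sum>i\<le>j. real (Suc i) * c (Suc i) * b (j - i))"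
    and t: "0 \<le> t"
  shows "\<bar>(\<Sum>j\<le>r. b j * t ^ j) * exp (- (\<Sum>i<r. c (Suc i) * t ^ Suc i)) - 1\<bar>
    \<le> real r * exp (3 * (\<Sum>i<r. \<bar>c (Suc i)\<bar> * (exp 1 * t) ^ Suc i) - real r)"
proof -
  define P where "P x = (\<Sum>j\<le>r. b j * x ^ j)" for x
  define Q where "Q x = (\<Sum>j\<le>r. \<bar>b j\<bar> * x ^ j)" for x
  define K where "K x = (\<Sum>i<r. c (Suc i) * x ^ Suc i)" for x
  define L where "L x = (\<Sum>i<r. \<bar>c (Suc i)\<bar> * x ^ Suc i)" for x
  define P' where "P' x = (\<Sum>j<r. real (Suc j) * b (Suc j) * x ^ j)" for x
  define Q' where "Q' x = (\<Sum>j<r. real (Suc j) * \<bar>b (Suc j)\<bar> * x ^ j)" for x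
  define K' where "K' x = (\<Sum>i<r. real (Suc i) * c (Suc i) * x ^ i)" for x
  define L' where "L' x = (\<Sum>i<r. real (Suc i) * \<bar>c (Suc i)\<bar> * x ^ i)" for x
  have poly_deriv: "((\<lambda>x. \<Sum>j\<le>r. g j * x ^ j) has_real_derivative
      (\<Sum>j<r. real (Suc j) * g (Suc j) * x ^ j)) (at x)" for g :: "nat \<Rightarrow> real" and x
  proof -
    have "((\<lambda>x. \<Sum>j\<le>r. g j * x ^ j) has_real_derivative
        (\<Sum>j\<le>r. g j * (real j * x ^ (j - 1)))) (at x)"
      by (auto intro!: derivative_eq_intros sum.cong)
    also have "(\<Sum>j\<le>r. g j * (real j * x ^ (j - 1))) = (\<Sum>j<r. real (Suc j) * g (Suc j) * x ^ j)"
      by (subst sum.atMost_shift) (simp add: mult_ac)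
    finally show ?thesis .
  qed
  have poly_deriv2: "((\<lambda>x. \<Sum>j<r. g (Suc j) * x ^ Suc j) has_real_derivative
      (\<Sum>j<r. real (Suc j) * g (Suc j) * x ^ j)) (at x)" for g :: "nat \<Rightarrow> real" and x
    by (auto intro!: derivative_eq_intros sum.cong simp del: power_Suc of_nat_Suc)
  have dP: "(P has_real_derivative P' x) (at x)" for x
    unfolding P_def [abs_def] P'_def by (rule poly_deriv)
  have dQ: "(Q has_real_derivative Q' x) (at x)" for x
    unfolding Q_def [abs_def] Q'_def using poly_deriv [of "\<lambda>j. \<bar>b j\<bar>"] by simp
  have dK: "(K has_real_derivative K' x) (at x)" for x
    unfolding K_def [abs_def] K'_def by (rule poly_deriv2)
  have dL: "(L has_real_derivative L' x) (at x)" for x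
    unfolding L_def [abs_def] L'_def using poly_deriv2 [of "\<lambda>j. \<bar>c j\<bar>"] by simp
  have fin: "finite {(i, j). i < r \<and> j \<le> r \<and> R i j}" for R :: "nat \<Rightarrow> nat \<Rightarrow> bool"
    by (rule finite_subset [of _ "{..r} \<times> {..r}"]) auto
  have low: "(\<Sum>d<r. \<Sum>i\<le>d. g i (d - i)) = (\<Sum>(i, j)\<in>{(i, j). i < r \<and> j \<le> r \<and> i + j < r}. g i j)"
    for g :: "nat \<Rightarrow> nat \<Rightarrow> real"
  proof -
    have "(\<Sum>d<r. \<Sum>i\<le>d. g i (d - i)) = (\<Sum>(i, j)\<in>{(i, j). i + j < r}. g i j)"
      by (rule sum.triangle_reindex [symmetric])
    also have "{(i, j). i + j < r} = {(i, j). i < r \<and> j \<le> r \<and> i + j < r}" by auto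
    finally show ?thesis .
  qed
  have full: "(\<Sum>i<r. g i) * (\<Sum>j\<le>r. h j) = (\<Sum>(i, j)\<in>{(i, j). i < r \<and> j \<le> r}. g i * h j)"
    for g h :: "nat \<Rightarrow> real"
  proof -
    have "{(i, j). i < r \<and> j \<le> r} = {..<r} \<times> {..r}" by auto
    then show ?thesis by (simp add: sum_product sum.cartesian_product)
  qed
  \<comment> \<open>\<open>L\<close> and \<open>Q\<close> majorize \<open>K\<close> and
    \<open>P\<close>. The recursion bounds the coefficients of \<open>Q'\<close> by those of
    \<open>L' * Q\<close> below degree r; completing the triangle of index pairs to the full
    rectangle only adds nonnegative terms.\<close>
  have Q'_le: "Q' x \<le> L' x * Q x" if "0 \<le> x" for x
  proof -
    let ?g = "\<lambda>i j. (real (Suc i) * \<bar>c (Suc i)\<bar> * x ^ i) * (\<bar>b j\<bar> * x ^ j)"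
    have "Q' x \<le> (\<Sum>d<r. \<Sum>i\<le>d. ?g i (d - i))"
      unfolding Q'_def
    proof (rule sum_mono)
      fix d assume "d \<in> {..<r}"
      then have "real (Suc d) * \<bar>b (Suc d)\<bar> = \<bar>\<Sum>i\<le>d. real (Suc i) * c (Suc i) * b (d - i)\<bar>"
        by (subst rec [symmetric]) (auto simp: abs_mult simp del: of_nat_Suc)
      also have "\<dots> \<le> (\<Sum>i\<le>d. real (Suc i) * \<bar>c (Suc i)\<bar> * \<bar>b (d - i)\<bar>)"
        by (rule order_trans [OF sum_abs]) (simp add: abs_mult del: of_nat_Suc)
      finally have "real (Suc d) * \<bar>b (Suc d)\<bar> * x ^ d
          \<le> (\<Sum>i\<le>d. real (Suc i) * \<bar>c (Suc i)\<bar> * \<bar>b (d - i)\<bar>) * x ^ d"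
        using that by (intro mult_right_mono) auto
      also have "\<dots> = (\<Sum>i\<le>d. ?g i (d - i))"
        unfolding sum_distrib_right
      proof (rule sum.cong [OF refl])
        fix i assume "i \<in> {..d}"
        then have *: "x ^ d = x ^ i * x ^ (d - i)" by (simp flip: power_add)
        show "real (Suc i) * \<bar>c (Suc i)\<bar> * \<bar>b (d - i)\<bar> * x ^ d = ?g i (d - i)"
          unfolding * by (simp add: mult_ac)
      qed
      finally show "real (Suc d) * \<bar>b (Suc d)\<bar> * x ^ d \<le> (\<Sum>i\<le>d. ?g i (d - i))" .
    qed
    also have "\<dots> \<le> (\<Sum>(i, j)\<in>{(i, j). i < r \<and> j \<le> r}. ?g i j)"
      unfolding low [of ?g]
      by (rule sum_mono2) (use that fin [of "\<lambda>_ _. True"] in auto)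
    also have "\<dots> = L' x * Q x"
      unfolding L'_def Q_def full ..
    finally show ?thesis .
  qed
  \<comment> \<open>Gronwall's argument: Q' \<le> L' Q makes Q exp (- L) nonincreasing, and it
    starts at 1.\<close>
  have Q_le: "Q x \<le> exp (L x)" if "0 \<le> x" for x
  proof -
    have "Q x * exp (- L x) \<le> Q 0 * exp (- L 0)"
    proof (rule DERIV_nonpos_imp_nonincreasing [OF that])
      fix y assume y: "0 \<le> y" "y \<le> x"
      have "((\<lambda>x. Q x * exp (- L x)) has_real_derivative (Q' y - L' y * Q y) * exp (- L y)) (at y)"
        by (rule derivative_eq_intros dQ dL refl | simp add: algebra_simps)+
      moreover have "(Q' y - L' y * Q y) * exp (- L y) \<le> 0"
        using Q'_le [of y] y by (simp add: mult_nonpos_nonneg)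
      ultimately show "\<exists>z. ((\<lambda>x. Q x * exp (- L x)) has_real_derivative z) (at y) \<and> z \<le> 0"
        by blast
    qed
    also have "Q 0 = 1"
      unfolding Q_def using b0 by (subst sum.atMost_shift) simp
    also have "L 0 = 0"
      unfolding L_def by simp
    finally show ?thesis by (simp add: exp_minus field_simps)
  qed
  \<comment> \<open>By the recursion \<open>P'\<close> cancels all terms of \<open>K' * P\<close> of
    degree below r. On the remaining terms i + j \<ge> r, so the factor exp (- r) e^(i + j) is at
    least 1 and moves the evaluation point from x to e x.\<close>
  have R: "\<bar>P' x - K' x * P x\<bar> \<le> exp (- real r) * (L' (exp 1 * x) * Q (exp 1 * x))" if "0 \<le> x" for x
  proof -
    let ?g = "\<lambda>i j. (real (Suc i) * c (Suc i) * x ^ i) * (b j * x ^ j)"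
    let ?h = "\<lambda>i j. (real (Suc i) * \<bar>c (Suc i)\<bar> * (exp 1 * x) ^ i) * (\<bar>b j\<bar> * (exp 1 * x) ^ j)"
    have "P' x = (\<Sum>d<r. \<Sum>i\<le>d. ?g i (d - i))"
      unfolding P'_def
    proof (rule sum.cong [OF refl])
      fix d assume "d \<in> {..<r}"
      then have "real (Suc d) * b (Suc d) * x ^ d = (\<Sum>i\<le>d. real (Suc i) * c (Suc i) * b (d - i)) * x ^ d"
        by (subst rec [symmetric]) auto
      also have "\<dots> = (\<Sum>i\<le>d. ?g i (d - i))"
        unfolding sum_distrib_right
      proof (rule sum.cong [OF refl])
        fix i assume "i \<in> {..d}"
        then have *: "x ^ d = x ^ i * x ^ (d - i)" by (simp flip: power_add)
        show "real (Suc i) * c (Suc i) * b (d - i) * x ^ d = ?g i (d - i)"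
          unfolding * by (simp add: mult_ac)
      qed
      finally show "real (Suc d) * b (Suc d) * x ^ d = (\<Sum>i\<le>d. ?g i (d - i))" .
    qed
    then have P'_eq: "P' x = (\<Sum>(i, j)\<in>{(i, j). i < r \<and> j \<le> r \<and> i + j < r}. ?g i j)"
      by (simp only: low [of ?g])
    have "K' x * P x = (\<Sum>(i, j)\<in>{(i, j). i < r \<and> j \<le> r}. ?g i j)"
      unfolding K'_def P_def full ..
    also have "{(i, j). i < r \<and> j \<le> r} = {(i, j). i < r \<and> j \<le> r \<and> i + j < r} \<union> {(i, j). i < r \<and> j \<le> r \<and> \<not> i + j < r}"
      by auto
    also have "(\<Sum>(i, j)\<in>\<dots>. ?g i j) = P' x + (\<Sum>(i, j)\<in>{(i, j). i < r \<and> j \<le> r \<and> \<not> i + j < r}. ?g i j)"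
      unfolding P'_eq by (rule sum.union_disjoint) (use fin in auto)
    finally have "\<bar>P' x - K' x * P x\<bar> = \<bar>\<Sum>(i, j)\<in>{(i, j). i < r \<and> j \<le> r \<and> \<not> i + j < r}. ?g i j\<bar>"
      by simp
    also have "\<dots> \<le> (\<Sum>(i, j)\<in>{(i, j). i < r \<and> j \<le> r \<and> \<not> i + j < r}. exp (- real r) * ?h i j)"
    proof (rule order_trans [OF sum_abs], rule sum_mono, clarify)
      fix i j assume ij: "i < r" "j \<le> r" "\<not> i + j < r"
      have e: "1 \<le> exp (- real r) * (exp 1) ^ (i + j)"
        using ij by (simp flip: exp_of_nat_mult exp_add)
      have "\<bar>?g i j\<bar> = 1 * ((real (Suc i) * \<bar>c (Suc i)\<bar> * x ^ i) * (\<bar>b j\<bar> * x ^ j))"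
        using that by (simp add: abs_mult)
      also have "\<dots> \<le> (exp (- real r) * (exp 1) ^ (i + j)) * ((real (Suc i) * \<bar>c (Suc i)\<bar> * x ^ i) * (\<bar>b j\<bar> * x ^ j))"
        using that e by (intro mult_right_mono) auto
      also have "\<dots> = exp (- real r) * ?h i j"
        by (simp add: power_mult_distrib power_add mult_ac)
      finally show "\<bar>?g i j\<bar> \<le> exp (- real r) * ?h i j" .
    qed
    also have "\<dots> \<le> (\<Sum>(i, j)\<in>{(i, j). i < r \<and> j \<le> r}. exp (- real r) * ?h i j)"
      by (rule sum_mono2) (use that fin [of "\<lambda>_ _. True"] in auto)
    also have "\<dots> = exp (- real r) * (\<Sum>(i, j)\<in>{(i, j). i < r \<and> j \<le> r}. ?h i j)"
      by (simp add: sum_distrib_left case_prod_unfold)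
    also have "\<dots> = exp (- real r) * (L' (exp 1 * x) * Q (exp 1 * x))"
      unfolding L'_def Q_def full ..
    finally show ?thesis .
  qed
  have L_mono: "L x \<le> L y" if "0 \<le> x" "x \<le> y" for x y
    unfolding L_def using that by (intro sum_mono mult_left_mono power_mono) auto
  have L'_mono: "L' x \<le> L' y" if "0 \<le> x" "x \<le> y" for x y
    unfolding L'_def using that by (intro sum_mono mult_left_mono power_mono) auto
  have xL': "x * L' x \<le> real r * L x" if "0 \<le> x" for x
  proof -
    have "x * L' x = (\<Sum>i<r. real (Suc i) * (\<bar>c (Suc i)\<bar> * x ^ Suc i))"
      unfolding L'_def by (simp add: sum_distrib_left mult_ac)
    also have "\<dots> \<le> (\<Sum>i<r. real r * (\<bar>c (Suc i)\<bar> * x ^ Suc i))"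
      using that by (intro sum_mono mult_right_mono) auto
    finally show ?thesis unfolding L_def by (simp add: sum_distrib_left)
  qed
  have L_nonneg: "0 \<le> L x" if "0 \<le> x" for x
    unfolding L_def using that by (intro sum_nonneg) auto
  have L'_nonneg: "0 \<le> L' x" if "0 \<le> x" for x
    unfolding L'_def using that by (intro sum_nonneg) auto
  have absK: "- K x \<le> L x" if "0 \<le> x" for x
    unfolding K_def L_def sum_negf [symmetric]
  proof (rule sum_mono)
    fix i
    have "- c (Suc i) * x ^ Suc i \<le> \<bar>c (Suc i)\<bar> * x ^ Suc i"
      using that by (intro mult_right_mono) auto
    then show "- (c (Suc i) * x ^ Suc i) \<le> \<bar>c (Suc i)\<bar> * x ^ Suc i" by simp
  qed
  have start: "P 0 * exp (- K 0) = 1"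
  proof -
    have "P 0 = 1" unfolding P_def using b0 by (subst sum.atMost_shift) simp
    moreover have "K 0 = 0" unfolding K_def by simp
    ultimately show ?thesis by simp
  qed
  have "\<bar>P t * exp (- K t) - 1\<bar> \<le> real r * exp (3 * L (exp 1 * t) - real r)"
  proof (cases "t = 0")
    case True
    then show ?thesis using start by simp
  next
    case False
    with t have tpos: "0 < t" by simp
    have d: "((\<lambda>x. P x * exp (- K x)) has_real_derivative (P' y - K' y * P y) * exp (- K y)) (at y)" for y
      by (rule derivative_eq_intros dP dK refl | simp add: algebra_simps)+
    \<comment> \<open>The derivative of P exp (- K) is (P' - K' P) exp (- K), which \<open>R\<close>
      makes small. The factors Q, exp (- K) and t L' are each bounded by exp (L (e t)), the last one
      with an additional r; hence the 3 in the exponent and the factor r.\<close>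
    obtain z where z: "0 < z" "z < t"
      "P t * exp (- K t) - P 0 * exp (- K 0) = (t - 0) * ((P' z - K' z * P z) * exp (- K z))"
      using MVT2 [OF tpos d] by blast
    have et: "exp 1 * z \<le> exp 1 * t" "z \<le> exp 1 * t" "0 \<le> exp 1 * z" "t \<le> exp 1 * t"
    proof -
      show "exp 1 * z \<le> exp 1 * t" "0 \<le> exp 1 * z" using z by auto
      show "t \<le> exp 1 * t" using tpos by simp
      then show "z \<le> exp 1 * t" using z by linarith
    qed
    let ?L = "L (exp 1 * t)"
    have e1: "exp (- K z) \<le> exp ?L"
      using absK [of z] L_mono [of z "exp 1 * t"] z et by simp
    have e2: "Q (exp 1 * z) \<le> exp ?L"
      using Q_le [of "exp 1 * z"] L_mono [of "exp 1 * z" "exp 1 * t"] et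
      by (meson exp_le_cancel_iff order_trans)
    have "t * L' (exp 1 * t) \<le> (exp 1 * t) * L' (exp 1 * t)"
      by (rule mult_right_mono [OF et(4)]) (rule L'_nonneg, use tpos in simp)
    also have "\<dots> \<le> real r * ?L" using xL' [of "exp 1 * t"] tpos by simp
    also have "\<dots> \<le> real r * exp ?L"
    proof (rule mult_left_mono)
      show "?L \<le> exp ?L" using exp_ge_add_one_self [of ?L] by linarith
    qed simp
    finally have e3: "t * L' (exp 1 * z) \<le> real r * exp ?L"
      using mult_left_mono [OF L'_mono [OF et(3) et(1)], of t] tpos by linarith
    have Qn: "0 \<le> Q (exp 1 * z)" unfolding Q_def using et by (intro sum_nonneg) auto
    have "\<bar>P t * exp (- K t) - 1\<bar> = t * \<bar>P' z - K' z * P z\<bar> * exp (- K z)"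
      using z(3) start tpos by (simp add: abs_mult)
    also have "\<dots> \<le> t * (exp (- real r) * (L' (exp 1 * z) * Q (exp 1 * z))) * exp ?L"
      using R [of z] z tpos e1 by (intro mult_mono mult_left_mono) (auto intro!: mult_nonneg_nonneg L'_nonneg Qn)
    also have "\<dots> = (t * L' (exp 1 * z)) * Q (exp 1 * z) * (exp (- real r) * exp ?L)"
      by (simp add: mult_ac)
    also have "\<dots> \<le> (real r * exp ?L) * exp ?L * (exp (- real r) * exp ?L)"
      using tpos by (intro mult_right_mono mult_mono e2 e3 Qn) auto
    also have "\<dots> = real r * exp (3 * ?L - real r)"
    proof -
      have "exp (3 * ?L - real r) = exp ?L * exp ?L * (exp (- real r) * exp ?L)"
        by (simp flip: exp_add)
      then show ?thesis by simp
    qed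
    finally show ?thesis .
  qed
  then show ?thesis unfolding P_def K_def L_def .
qed

section \<open>Cumulants of a moment sequence\<close>

text \<open>If B is the exponential generating function of the moments and K its logarithm, then B'
  = K' B. Comparing coefficients and solving for the top term, whose factor is b 0 = 1, gives this
  recursion.\<close>

fun cumulants :: "(nat \<Rightarrow> real) \<Rightarrow> nat \<Rightarrow> real" where
  "cumulants b 0 = 0"
| "cumulants b (Suc m) =
     b (Suc m) - (\<Sum>i<m. real (m choose i) * cumulants b (Suc i) * b (m - i))"

declare cumulants.simps(2) [simp del]

lemma moment_cumulant_recursion:
  assumes "b 0 = 1"
  shows "b (Suc m) = (\<Sum>i\<le>m. real (m choose i) * cumulants b (Suc i) * b (m - i))"
  using assms by (simp add: cumulants.simps(2) [of b m] lessThan_Suc_atMost [symmetric])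

lemma cumulants_unique:
  assumes b0: "b 0 = 1"
    and rec: "\<And>m. b (Suc m) = (\<Sum>i\<le>m. real (m choose i) * \<kappa> (Suc i) * b (m - i))"
  shows "cumulants b (Suc m) = \<kappa> (Suc m)"
proof (induction m rule: less_induct)
  case (less m)
  have "b (Suc m) = \<kappa> (Suc m) + (\<Sum>i<m. real (m choose i) * \<kappa> (Suc i) * b (m - i))"
    using b0 by (simp add: rec [of m] lessThan_Suc_atMost [symmetric])
  also have "(\<Sum>i<m. real (m choose i) * \<kappa> (Suc i) * b (m - i)) =
      (\<Sum>i<m. real (m choose i) * cumulants b (Suc i) * b (m - i))"
    using less by (intro sum.cong) auto
  finally show ?case by (simp add: cumulants.simps(2) [of b m])
qed

lemma cumulants_1: "cumulants b (Suc 0) = b 1"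
  by (simp add: cumulants.simps(2) [of b 0])

lemma cumulants_2: "cumulants b 2 = b 2 - (b 1)\<^sup>2"
  using cumulants.simps(2) [of b 1] by (simp add: cumulants_1 numeral_2_eq_2 power2_eq_square)

lemma cumulants_scale: "cumulants (\<lambda>j. s ^ j * b j) m = s ^ m * cumulants b m"
proof (induction m rule: less_induct)
  case (less m)
  show ?case
  proof (cases m)
    case (Suc l)
    have "(\<Sum>i<l. real (l choose i) * cumulants (\<lambda>j. s ^ j * b j) (Suc i) * (s ^ (l - i) * b (l - i))) =
        (\<Sum>i<l. s ^ Suc l * (real (l choose i) * cumulants b (Suc i) * b (l - i)))"
    proof (rule sum.cong [OF refl])
      fix i assume i: "i \<in> {..<l}"
      then have *: "s ^ Suc l = s ^ Suc i * s ^ (l - i)" by (simp flip: power_add)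
      show "real (l choose i) * cumulants (\<lambda>j. s ^ j * b j) (Suc i) * (s ^ (l - i) * b (l - i)) =
          s ^ Suc l * (real (l choose i) * cumulants b (Suc i) * b (l - i))"
        using i Suc by (subst less.IH) (simp_all add: * mult_ac del: power_Suc)
    qed
    then show ?thesis
      unfolding Suc cumulants.simps(2) [of _ l] by (simp add: sum_distrib_left algebra_simps)
  qed simp
qed

definition moments :: "'a measure \<Rightarrow> ('a \<Rightarrow> real) \<Rightarrow> nat \<Rightarrow> real" where
  "moments M Z j = (\<integral>\<omega>. Z \<omega> ^ j \<partial>M)"

lemma (in prob_space) moments_0 [simp]: "moments M Z 0 = 1"
  by (simp add: moments_def prob_space)

lemma moments_scale: "moments M (\<lambda>\<omega>. s * Z \<omega>) = (\<lambda>j. s ^ j * moments M Z j)"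
  by (simp add: moments_def power_mult_distrib fun_eq_iff)

lemma integrable_trunc_exp:
  assumes "\<And>j. integrable M (\<lambda>\<omega>. Z \<omega> ^ j)"
  shows "integrable M (\<lambda>\<omega>. trunc_exp r (t * Z \<omega>))"
  unfolding trunc_exp_def power_mult_distrib
  by (intro Bochner_Integration.integrable_sum integrable_divide integrable_mult_right assms)

lemma integral_trunc_exp:
  assumes "\<And>j. integrable M (\<lambda>\<omega>. Z \<omega> ^ j)"
  shows "(\<integral>\<omega>. trunc_exp r (t * Z \<omega>) \<partial>M) = (\<Sum>j\<le>r. moments M Z j / fact j * t ^ j)"
proof -
  have "(\<integral>\<omega>. trunc_exp r (t * Z \<omega>) \<partial>M) = (\<integral>\<omega>. (\<Sum>j\<le>r. t ^ j / fact j * Z \<omega> ^ j) \<partial>M)"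
    by (simp add: trunc_exp_def power_mult_distrib)
  also have "\<dots> = (\<Sum>j\<le>r. t ^ j / fact j * moments M Z j)"
    unfolding moments_def using assms
    by (subst Bochner_Integration.integral_sum) (auto intro!: integrable_divide integrable_mult_right)
  finally show ?thesis by (simp add: mult.commute)
qed

text \<open>The truncated exponential formula for b_j = E Z^j / j! and c_j = kappa_j / j!; K is the
  cumulant series cut at order r. The quadratic term gives t^2 / 2. Since j \<le> r, the higher
  terms are dominated by a geometric series with ratio q.\<close>

lemma trunc_mgf_bound:
  fixes Z :: "'a \<Rightarrow> real"
  assumes "prob_space M"
    and int: "\<And>j. integrable M (\<lambda>\<omega>. Z \<omega> ^ j)"
    and k1: "cumulants (moments M Z) 1 = 0" and k2: "cumulants (moments M Z) 2 = 1"
    and bnd: "\<And>j. j \<ge> 3 \<Longrightarrow> \<bar>cumulants (moments M Z) j\<bar> / fact j \<le> \<theta> ^ (j - 2) * real j ^ (k * (j - 2))"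
    and \<theta>: "0 \<le> \<theta>" and t: "0 \<le> t" and r: "2 \<le> r"
    and q: "q = \<theta> * (exp 1 * t) * real r ^ k" "q \<le> 1 / 4"
  shows "\<exists>K. \<bar>(\<integral>\<omega>. trunc_exp r (t * Z \<omega>) \<partial>M) * exp (- K) - 1\<bar> \<le> real r * exp (3 * (exp 1 * t)\<^sup>2 - real r)
    \<and> \<bar>K - t\<^sup>2 / 2\<bar> \<le> 2 * (exp 1 * t)\<^sup>2 * q"
proof -
  interpret prob_space M by fact
  define c where "c j = cumulants (moments M Z) j / fact j" for j
  define b where "b j = moments M Z j / fact j" for j
  define K where "K = (\<Sum>i<r. c (Suc i) * t ^ Suc i)"
  define L where "L x = (\<Sum>i<r. \<bar>c (Suc i)\<bar> * x ^ Suc i)" for x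
  let ?x = "exp 1 * t"
  have x: "0 \<le> ?x" using t by simp
  have q0: "0 \<le> q" unfolding q using \<theta> t by simp
  have b0: "b 0 = 1" by (simp add: b_def)
  have rec: "real (Suc j) * b (Suc j) = (\<Sum>i\<le>j. real (Suc i) * c (Suc i) * b (j - i))" for j
  proof -
    have "real (Suc j) * b (Suc j) = moments M Z (Suc j) / fact j"
      by (simp add: b_def del: of_nat_Suc)
    also have "\<dots> = (\<Sum>i\<le>j. real (j choose i) * cumulants (moments M Z) (Suc i) * moments M Z (j - i) / fact j)"
      by (subst moment_cumulant_recursion) (auto simp: sum_divide_distrib)
    also have "\<dots> = (\<Sum>i\<le>j. real (Suc i) * c (Suc i) * b (j - i))"
      by (intro sum.cong refl) (simp add: c_def b_def binomial_fact field_simps del: of_nat_Suc)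
    finally show ?thesis .
  qed
  \<comment> \<open>The first two cumulants, 0 and 1, are split off exactly; only those from the
    third on are estimated.\<close>
  have "r = Suc (Suc (r - 2))" using r by simp
  then obtain s where s: "r = Suc (Suc s)" by blast
  have split: "(\<Sum>i<r. f i) = f 0 + f 1 + (\<Sum>i<s. f (Suc (Suc i)))" for f :: "nat \<Rightarrow> real"
    unfolding s by (simp only: sum.lessThan_Suc_shift One_nat_def add.assoc)
  have c1: "c (Suc 0) = 0" and c2: "c (Suc 1) = 1 / 2"
    using k1 k2 by (simp_all add: c_def numeral_2_eq_2)
  define rest where "rest = (\<Sum>i<s. \<bar>c (Suc (Suc (Suc i)))\<bar> * ?x ^ Suc (Suc (Suc i)))"
  have rest: "rest \<le> 2 * ?x\<^sup>2 * q"
  proof -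
    have "rest \<le> (\<Sum>i<s. ?x\<^sup>2 * q ^ Suc i)"
      unfolding rest_def
    proof (rule sum_mono)
      fix i assume "i \<in> {..<s}"
      then have ir: "Suc (Suc (Suc i)) \<le> r" using s by simp
      let ?j = "Suc (Suc (Suc i))"
      have "\<bar>c ?j\<bar> \<le> \<theta> ^ Suc i * real ?j ^ (k * Suc i)"
        using bnd [of ?j] by (simp add: c_def abs_divide del: power_Suc of_nat_Suc fact_Suc mult_Suc_right)
      also have "\<dots> \<le> \<theta> ^ Suc i * real r ^ (k * Suc i)"
        using ir \<theta> by (intro mult_left_mono power_mono) auto
      finally have "\<bar>c ?j\<bar> * ?x ^ ?j \<le> \<theta> ^ Suc i * real r ^ (k * Suc i) * ?x ^ ?j"
        using x by (intro mult_right_mono) auto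
      also have "\<dots> = ?x\<^sup>2 * q ^ Suc i"
      proof -
        have *: "y ^ ?j = y\<^sup>2 * y ^ Suc i" for y :: real by (simp add: power2_eq_square)
        show ?thesis by (simp only: q * power_mult_distrib power_mult mult_ac)
      qed
      finally show "\<bar>c ?j\<bar> * ?x ^ ?j \<le> ?x\<^sup>2 * q ^ Suc i" .
    qed
    also have "\<dots> = ?x\<^sup>2 * q * (\<Sum>i<s. q ^ i)"
      unfolding sum_distrib_left by (rule sum.cong) simp_all
    also have "(\<Sum>i<s. q ^ i) \<le> 2"
    proof -
      have nq: "norm q < 1" using q0 q(2) by simp
      have "(\<Sum>i<s. q ^ i) \<le> (\<Sum>i. q ^ i)"
        by (rule sum_le_suminf [OF summable_geometric [OF nq]]) (use q0 in simp_all)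
      also have "\<dots> = 1 / (1 - q)" by (rule suminf_geometric [OF nq])
      also have "\<dots> \<le> 2" using q(2) by (simp add: field_simps)
      finally show ?thesis .
    qed
    finally have "rest \<le> ?x\<^sup>2 * q * 2"
      using q0 by (simp add: mult_left_mono)
    then show ?thesis by (simp only: mult_ac)
  qed
  \<comment> \<open>q \<le> 1 / 4 makes the higher terms at most half of (e t)^2, so the whole
    majorant is at most (e t)^2.\<close>
  have L_le: "L ?x \<le> ?x\<^sup>2"
  proof -
    have "L ?x = ?x\<^sup>2 / 2 + rest"
      unfolding L_def split rest_def c1 c2 by (simp add: power2_eq_square)
    also have "\<dots> \<le> ?x\<^sup>2 / 2 + 2 * ?x\<^sup>2 * (1 / 4)"
      using rest q(2) mult_left_mono [OF q(2), of "2 * ?x\<^sup>2"] by simp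
    finally show ?thesis by simp
  qed
  have Kdiff: "\<bar>K - t\<^sup>2 / 2\<bar> \<le> 2 * ?x\<^sup>2 * q"
  proof -
    have "K - t\<^sup>2 / 2 = (\<Sum>i<s. c (Suc (Suc (Suc i))) * t ^ Suc (Suc (Suc i)))"
      unfolding K_def split c1 c2 by (simp add: power2_eq_square)
    also have "\<bar>\<dots>\<bar> \<le> rest"
      unfolding rest_def
    proof (rule order_trans [OF sum_abs], rule sum_mono)
      fix i
      have "t ^ Suc (Suc (Suc i)) \<le> ?x ^ Suc (Suc (Suc i))"
        using t mult_right_mono [of 1 "exp 1" t] by (intro power_mono) simp_all
      then have "\<bar>c (Suc (Suc (Suc i)))\<bar> * t ^ Suc (Suc (Suc i)) \<le> \<bar>c (Suc (Suc (Suc i)))\<bar> * ?x ^ Suc (Suc (Suc i))"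
        by (rule mult_left_mono) simp
      then show "\<bar>c (Suc (Suc (Suc i))) * t ^ Suc (Suc (Suc i))\<bar> \<le> \<bar>c (Suc (Suc (Suc i)))\<bar> * ?x ^ Suc (Suc (Suc i))"
        by (simp only: abs_mult abs_of_nonneg [OF zero_le_power [OF t]])
    qed
    finally show ?thesis using rest by (rule order_trans)
  qed
  have "\<bar>(\<Sum>j\<le>r. b j * t ^ j) * exp (- K) - 1\<bar> \<le> real r * exp (3 * L ?x - real r)"
    unfolding K_def L_def by (rule truncated_exponential_formula [where b = b and c = c and r = r and t = t, OF b0 rec t])
  also have "\<dots> \<le> real r * exp (3 * ?x\<^sup>2 - real r)"
    using L_le by (intro mult_left_mono) auto
  also have "(\<Sum>j\<le>r. b j * t ^ j) = (\<integral>\<omega>. trunc_exp r (t * Z \<omega>) \<partial>M)"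
    unfolding b_def by (rule integral_trunc_exp [OF int, symmetric])
  finally show ?thesis using Kdiff by blast
qed

text \<open>Orders below a large multiple of \<open>a\<^sup>2\<close> cut off too much of the exponential series; at orders
  beyond \<open>O(a\<^sup>2)\<close> the cumulant bounds no longer control the moments.\<close>

definition gaussian_trunc_mgf ::
    "(nat \<Rightarrow> 'a measure) \<Rightarrow> (nat \<Rightarrow> 'a \<Rightarrow> real) \<Rightarrow> (nat \<Rightarrow> real) \<Rightarrow> real \<Rightarrow> bool" where
  "gaussian_trunc_mgf M Z a t \<longleftrightarrow>
     (\<exists>L0>0. \<forall>L1 r. eventually (\<lambda>n. L0 * (a n)\<^sup>2 \<le> real (r n) \<and> real (r n) \<le> L1 * (a n)\<^sup>2) sequentially \<longrightarrow>
       (\<lambda>n. ln (\<integral>\<omega>. trunc_exp (r n) (t * a n * Z n \<omega>) \<partial>M n) / (a n)\<^sup>2) \<longlonglongrightarrow> t\<^sup>2 / 2)"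

lemma gaussian_trunc_mgf_nonneg:
  fixes Z :: "nat \<Rightarrow> 'a \<Rightarrow> real"
  assumes ps: "eventually (\<lambda>n. prob_space (M n)) sequentially"
    and int: "eventually (\<lambda>n. \<forall>j. integrable (M n) (\<lambda>\<omega>. Z n \<omega> ^ j)) sequentially"
    and k1: "eventually (\<lambda>n. cumulants (moments (M n) (Z n)) 1 = 0) sequentially"
    and k2: "eventually (\<lambda>n. cumulants (moments (M n) (Z n)) 2 = 1) sequentially"
    and bnd: "eventually (\<lambda>n. \<forall>j\<ge>3. \<bar>cumulants (moments (M n) (Z n)) j\<bar> / fact j
                \<le> \<theta> n ^ (j - 2) * real j ^ (k * (j - 2))) sequentially"
    and \<theta>: "eventually (\<lambda>n. 0 \<le> \<theta> n) sequentially"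
    and a: "filterlim a at_top sequentially"
    and small: "(\<lambda>n. \<theta> n * a n ^ (2 * k + 1)) \<longlonglongrightarrow> 0"
    and t: "0 \<le> t"
  shows "gaussian_trunc_mgf M Z a t"
proof -
  \<comment> \<open>With r \<ge> L0 a^2 one has 3 (e t a)^2 \<le> r / 2, so the truncation error r
    exp (3 (e t a)^2 - r) is at most r exp (- r / 2) and vanishes.\<close>
  define L0 where "L0 = 6 * (exp 1 * t)\<^sup>2 + 1"
  have L0: "0 < L0" unfolding L0_def by (simp add: add_nonneg_pos)
  show ?thesis
    unfolding gaussian_trunc_mgf_def
  proof (intro exI [of _ L0] conjI L0 allI impI)
    fix L1 and r :: "nat \<Rightarrow> nat"
    assume r: "eventually (\<lambda>n. L0 * (a n)\<^sup>2 \<le> real (r n) \<and> real (r n) \<le> L1 * (a n)\<^sup>2) sequentially"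
    define E where "E n = (\<integral>\<omega>. trunc_exp (r n) (t * a n * Z n \<omega>) \<partial>M n)" for n
    define q where "q n = \<theta> n * (exp 1 * (t * a n)) * real (r n) ^ k" for n
    have a2: "eventually (\<lambda>n. 2 \<le> a n) sequentially"
      using a by (simp add: filterlim_at_top)
    have a_sq: "filterlim (\<lambda>n. (a n)\<^sup>2) at_top sequentially"
      by (rule filterlim_pow_at_top [OF _ a]) simp
    have r_top: "filterlim (\<lambda>n. real (r n)) at_top sequentially"
    proof (rule filterlim_at_top_mono)
      show "filterlim (\<lambda>n. L0 * (a n)\<^sup>2) at_top sequentially"
        using L0 a_sq by (intro filterlim_tendsto_pos_mult_at_top [OF tendsto_const])
      show "eventually (\<lambda>n. L0 * (a n)\<^sup>2 \<le> real (r n)) sequentially"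
        using r by eventually_elim simp
    qed
    have r2: "eventually (\<lambda>n. 2 \<le> r n) sequentially"
      using r_top unfolding filterlim_at_top by (elim allE [of _ 2]) (auto elim: eventually_mono)
    \<comment> \<open>The upper bound r \<le> L1 a^2 enters only here: it bounds q by a constant
      times \<theta> a^(2 k + 1).\<close>
    have q_lim: "q \<longlonglongrightarrow> 0"
    proof (rule tendsto_sandwich)
      show "eventually (\<lambda>n. 0 \<le> q n) sequentially"
        using \<theta> a2 by eventually_elim (simp add: q_def t)
      show "eventually (\<lambda>n. q n \<le> (exp 1 * t * L1 ^ k) * (\<theta> n * a n ^ (2 * k + 1))) sequentially"
        using \<theta> a2 r
      proof eventually_elim
        case (elim n)
        have "real (r n) ^ k \<le> (L1 * (a n)\<^sup>2) ^ k"
          using elim by (intro power_mono) auto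
        then have "q n \<le> \<theta> n * (exp 1 * (t * a n)) * (L1 * (a n)\<^sup>2) ^ k"
          unfolding q_def using elim t by (intro mult_left_mono) auto
        then show ?case
          unfolding power_mult_distrib power_add power_mult by (simp add: mult_ac)
      qed
      show "(\<lambda>n. (exp 1 * t * L1 ^ k) * (\<theta> n * a n ^ (2 * k + 1))) \<longlonglongrightarrow> 0"
        using tendsto_mult_right_zero [OF small] by simp
    qed simp
    have q4: "eventually (\<lambda>n. q n \<le> 1 / 4) sequentially"
      using order_tendstoD(2) [OF q_lim, of "1 / 4"] by (auto elim: eventually_mono)
    define good where "good n K \<longleftrightarrow>
        \<bar>E n * exp (- K) - 1\<bar> \<le> real (r n) * exp (3 * (exp 1 * (t * a n))\<^sup>2 - real (r n)) \<and>
        \<bar>K - (t * a n)\<^sup>2 / 2\<bar> \<le> 2 * (exp 1 * (t * a n))\<^sup>2 * q n" for n K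
    \<comment> \<open>\<open>trunc_mgf_bound\<close> supplies a K for each n separately; the choice
      assembles them into a sequence.\<close>
    define K where "K n = (SOME K. good n K)" for n
    have K: "eventually (\<lambda>n. good n (K n)) sequentially"
      using ps int k1 k2 bnd \<theta> a2 r2 q4
    proof eventually_elim
      case (elim n)
      have "\<exists>K. good n K"
        unfolding E_def good_def
        by (rule trunc_mgf_bound [where \<theta> = "\<theta> n" and k = k])
          (use elim t in \<open>auto simp: q_def\<close>)
      then show ?case unfolding K_def by (rule someI_ex)
    qed
    have err: "(\<lambda>n. real (r n) * exp (- (real (r n) / 2))) \<longlonglongrightarrow> 0"
    proof -
      have "filterlim (\<lambda>n. (1 / 2) * real (r n)) at_top sequentially"
        by (intro filterlim_tendsto_pos_mult_at_top [OF tendsto_const] r_top) simp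
      from filterlim_compose [OF tendsto_power_div_exp_0 [of 1] this]
      have "(\<lambda>n. 2 * ((1 / 2 * real (r n)) ^ 1 / exp (1 / 2 * real (r n)))) \<longlonglongrightarrow> 0"
        by (intro tendsto_mult_right_zero)
      then show ?thesis by (simp add: exp_minus field_simps)
    qed
    \<comment> \<open>The error is relative: E exp (- K) tends to 1, so ln E differs from K by o(1),
      while K differs from (t a)^2 / 2 by O(a^2 q) = o(a^2).\<close>
    have prod_lim: "(\<lambda>n. E n * exp (- K n)) \<longlonglongrightarrow> 1"
    proof (rule Lim_transform [OF tendsto_const])
      show "(\<lambda>n. E n * exp (- K n) - 1) \<longlonglongrightarrow> 0"
      proof (rule Lim_null_comparison [OF _ err])
        show "eventually (\<lambda>n. norm (E n * exp (- K n) - 1) \<le> real (r n) * exp (- (real (r n) / 2))) sequentially"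
          using K r
        proof eventually_elim
          case (elim n)
          have "6 * (exp 1 * (t * a n))\<^sup>2 \<le> L0 * (a n)\<^sup>2"
            unfolding L0_def by (simp add: power_mult_distrib algebra_simps)
          also have "\<dots> \<le> real (r n)" using elim by simp
          finally have "3 * (exp 1 * (t * a n))\<^sup>2 - real (r n) \<le> - (real (r n) / 2)" by simp
          then have "real (r n) * exp (3 * (exp 1 * (t * a n))\<^sup>2 - real (r n)) \<le> real (r n) * exp (- (real (r n) / 2))"
            by (intro mult_left_mono) auto
          then show ?case using elim by (simp add: good_def)
        qed
      qed
    qed
    have "(\<lambda>n. ln (E n * exp (- K n))) \<longlonglongrightarrow> ln 1"
      by (intro tendsto_ln prod_lim) simp
    moreover have "eventually (\<lambda>n. ln (E n * exp (- K n)) = ln (E n) - K n) sequentially"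
      using order_tendstoD(1) [OF prod_lim, of 0] 
      by (auto elim!: eventually_mono simp: zero_less_mult_iff ln_mult)
    ultimately have "(\<lambda>n. ln (E n) - K n) \<longlonglongrightarrow> 0"
      by (auto elim: Lim_transform_eventually)
    moreover have "(\<lambda>n. inverse ((a n)\<^sup>2)) \<longlonglongrightarrow> 0"
      using a_sq by (rule tendsto_inverse_0_at_top)
    ultimately have l1: "(\<lambda>n. (ln (E n) - K n) * inverse ((a n)\<^sup>2)) \<longlonglongrightarrow> 0"
      using tendsto_mult_zero by blast
    have l2: "(\<lambda>n. K n / (a n)\<^sup>2 - t\<^sup>2 / 2) \<longlonglongrightarrow> 0"
    proof (rule Lim_null_comparison)
      show "(\<lambda>n. 2 * (exp 1 * t)\<^sup>2 * q n) \<longlonglongrightarrow> 0"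
        using tendsto_mult_right_zero [OF q_lim] by blast
      show "eventually (\<lambda>n. norm (K n / (a n)\<^sup>2 - t\<^sup>2 / 2) \<le> 2 * (exp 1 * t)\<^sup>2 * q n) sequentially"
        using K a2
      proof eventually_elim
        case (elim n)
        have "norm (K n / (a n)\<^sup>2 - t\<^sup>2 / 2) = \<bar>K n - (t * a n)\<^sup>2 / 2\<bar> / (a n)\<^sup>2"
        proof -
          have "K n / (a n)\<^sup>2 - t\<^sup>2 / 2 = (K n - (t * a n)\<^sup>2 / 2) / (a n)\<^sup>2"
            using elim by (simp add: field_simps)
          then show ?thesis by (simp add: abs_divide)
        qed
        also have "\<dots> \<le> 2 * (exp 1 * (t * a n))\<^sup>2 * q n / (a n)\<^sup>2"
          using elim by (intro divide_right_mono) (auto simp: good_def)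
        also have "\<dots> = 2 * (exp 1 * t)\<^sup>2 * q n"
          using elim by (simp add: field_simps)
        finally show ?case .
      qed
    qed
    have l3: "(\<lambda>n. (ln (E n) - K n) * inverse ((a n)\<^sup>2) + (K n / (a n)\<^sup>2 - t\<^sup>2 / 2) + t\<^sup>2 / 2) \<longlonglongrightarrow> 0 + 0 + t\<^sup>2 / 2"
      by (intro tendsto_add l1 l2 tendsto_const)
    have "(\<lambda>n. ln (E n) / (a n)\<^sup>2) \<longlonglongrightarrow> t\<^sup>2 / 2"
    proof -
      have "(ln (E n) - K n) * inverse ((a n)\<^sup>2) + (K n / (a n)\<^sup>2 - t\<^sup>2 / 2) + t\<^sup>2 / 2 = ln (E n) / (a n)\<^sup>2" for n
        unfolding divide_inverse left_diff_distrib by simp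
      then show ?thesis using l3 by simp
    qed
    then show "(\<lambda>n. ln (\<integral>\<omega>. trunc_exp (r n) (t * a n * Z n \<omega>) \<partial>M n) / (a n)\<^sup>2) \<longlonglongrightarrow> t\<^sup>2 / 2"
      unfolding E_def .
  qed
qed

lemma gaussian_trunc_mgf_uminus:
  "gaussian_trunc_mgf M (\<lambda>n \<omega>. - Z n \<omega>) a t \<longleftrightarrow> gaussian_trunc_mgf M Z a (- t)"
  unfolding gaussian_trunc_mgf_def by simp

text \<open>Negative t reduces to positive t for - Z: the j-th cumulant is multiplied by (-1)^j,
  which leaves the values 0 and 1 and all absolute values unchanged.\<close>

theorem gaussian_trunc_mgf_of_cumulants:
  fixes Z :: "nat \<Rightarrow> 'a \<Rightarrow> real"
  assumes ps: "eventually (\<lambda>n. prob_space (M n)) sequentially"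
    and int: "eventually (\<lambda>n. \<forall>j. integrable (M n) (\<lambda>\<omega>. Z n \<omega> ^ j)) sequentially"
    and k1: "eventually (\<lambda>n. cumulants (moments (M n) (Z n)) 1 = 0) sequentially"
    and k2: "eventually (\<lambda>n. cumulants (moments (M n) (Z n)) 2 = 1) sequentially"
    and bnd: "eventually (\<lambda>n. \<forall>j\<ge>3. \<bar>cumulants (moments (M n) (Z n)) j\<bar> / fact j
                \<le> \<theta> n ^ (j - 2) * real j ^ (k * (j - 2))) sequentially"
    and \<theta>: "eventually (\<lambda>n. 0 \<le> \<theta> n) sequentially"
    and a: "filterlim a at_top sequentially"
    and small: "(\<lambda>n. \<theta> n * a n ^ (2 * k + 1)) \<longlonglongrightarrow> 0"
  shows "gaussian_trunc_mgf M Z a t"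
proof (cases "0 \<le> t")
  case True
  show ?thesis
    by (rule gaussian_trunc_mgf_nonneg [OF ps int k1 k2 bnd \<theta> a small True])
next
  case False
  have m: "moments (M n) (\<lambda>\<omega>. - Z n \<omega>) = (\<lambda>j. (- 1) ^ j * moments (M n) (Z n) j)" for n
    using moments_scale [of "M n" "- 1" "Z n"] by simp
  have "gaussian_trunc_mgf M (\<lambda>n \<omega>. - Z n \<omega>) a (- t)"
  proof (rule gaussian_trunc_mgf_nonneg [OF ps _ _ _ _ \<theta> a small])
    show "eventually (\<lambda>n. \<forall>j. integrable (M n) (\<lambda>\<omega>. (- Z n \<omega>) ^ j)) sequentially"
      using int
    proof eventually_elim
      case (elim n)
      have "integrable (M n) (\<lambda>\<omega>. (- 1) ^ j * Z n \<omega> ^ j)" for j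
        using elim by (intro integrable_mult_right) auto
      then show ?case by (simp flip: power_mult_distrib)
    qed
  qed (use k1 k2 bnd False in \<open>simp_all add: m cumulants_scale abs_mult power_abs\<close>)
  then show ?thesis by (simp add: gaussian_trunc_mgf_uminus)
qed

section \<open>From truncated moment generating functions to moderate deviations\<close>

context prob_space
begin

text \<open>The counterpart of exp (c Z) exp (d y) \<le> exp ((c + d) Z) on {Z \<ge> y}. The
  expectation on the right may run over the whole space because \<open>trunc_exp\<close> of the even
  order 2 r is positive everywhere.\<close>

lemma trunc_exp_upper_tail:
  fixes Z :: "'a \<Rightarrow> real"
  assumes int: "\<And>j. integrable M (\<lambda>\<omega>. Z \<omega> ^ j)"
    and c: "0 \<le> c" and d: "0 \<le> d" and y: "0 \<le> y"
  shows "(\<integral>\<omega>. \<bar>trunc_exp r (c * Z \<omega>)\<bar> * indicator {y..} (Z \<omega>) \<partial>M) * trunc_exp r (d * y)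
    \<le> (\<integral>\<omega>. trunc_exp (2 * r) ((c + d) * Z \<omega>) \<partial>M)"
proof -
  have meas: "Z \<in> borel_measurable M" using int [of 1] by (simp add: borel_measurable_integrable)
  have ind: "(\<lambda>\<omega>. indicator {y..} (Z \<omega>) :: real) \<in> borel_measurable M"
    using meas by measurable
  have i1: "integrable M (\<lambda>\<omega>. \<bar>trunc_exp r (c * Z \<omega>)\<bar> * indicator {y..} (Z \<omega>))"
    by (rule Bochner_Integration.integrable_bound [OF integrable_trunc_exp [OF int, of r c]])
      (use meas ind in \<open>auto simp: indicator_def\<close>)
  have "(\<integral>\<omega>. \<bar>trunc_exp r (c * Z \<omega>)\<bar> * indicator {y..} (Z \<omega>) \<partial>M) * trunc_exp r (d * y)
      = (\<integral>\<omega>. (\<bar>trunc_exp r (c * Z \<omega>)\<bar> * indicator {y..} (Z \<omega>)) * trunc_exp r (d * y) \<partial>M)"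
    using i1 by simp
  also have "\<dots> \<le> (\<integral>\<omega>. trunc_exp (2 * r) ((c + d) * Z \<omega>) \<partial>M)"
  proof (rule integral_mono)
    show "integrable M (\<lambda>\<omega>. (\<bar>trunc_exp r (c * Z \<omega>)\<bar> * indicator {y..} (Z \<omega>)) * trunc_exp r (d * y))"
      using i1 by simp
    show "integrable M (\<lambda>\<omega>. trunc_exp (2 * r) ((c + d) * Z \<omega>))"
      by (rule integrable_trunc_exp [OF int])
    fix \<omega>
    show "(\<bar>trunc_exp r (c * Z \<omega>)\<bar> * indicator {y..} (Z \<omega>)) * trunc_exp r (d * y) \<le> trunc_exp (2 * r) ((c + d) * Z \<omega>)"
    proof (cases "y \<le> Z \<omega>")
      case True
      with y have Z: "0 \<le> Z \<omega>" by simp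
      have "\<bar>trunc_exp r (c * Z \<omega>)\<bar> * trunc_exp r (d * y) \<le> trunc_exp r (c * Z \<omega>) * trunc_exp r (d * Z \<omega>)"
      proof (rule mult_mono)
        show "\<bar>trunc_exp r (c * Z \<omega>)\<bar> \<le> trunc_exp r (c * Z \<omega>)"
          using abs_trunc_exp_le [of r "c * Z \<omega>"] c Z by simp
        show "trunc_exp r (d * y) \<le> trunc_exp r (d * Z \<omega>)"
          using True y d by (intro trunc_exp_mono mult_left_mono) auto
        show "0 \<le> trunc_exp r (c * Z \<omega>)" "0 \<le> trunc_exp r (d * y)"
          using trunc_exp_ge_1 [of "c * Z \<omega>" r] trunc_exp_ge_1 [of "d * y" r] c d Z y by simp_all
      qed
      also have "\<dots> \<le> trunc_exp (2 * r) (c * Z \<omega> + d * Z \<omega>)"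
        using c d Z by (intro trunc_exp_mult_le) auto
      finally show ?thesis using True by (simp add: distrib_right)
    next
      case False
      have "0 < trunc_exp (2 * r) ((c + d) * Z \<omega>)" by (rule trunc_exp_pos_even) simp
      then show ?thesis using False by simp
    qed
  qed
  finally show ?thesis .
qed

text \<open>The counterpart of exp (c Z) \<le> exp (d y) exp ((c - d) Z) for Z \<le> y. The
  inequality \<open>trunc_exp_mult_le\<close> points the other way, so the estimate passes through
  exp; coming back costs the factor 2 and requires r to be large compared with c y.\<close>

lemma trunc_exp_lower_tail:
  fixes Z :: "'a \<Rightarrow> real"
  assumes int: "\<And>j. integrable M (\<lambda>\<omega>. Z \<omega> ^ j)"
    and d: "0 \<le> d" "d \<le> c" and y: "0 \<le> y" and r: "even r" "exp 1 * (c * y) + 1 \<le> real r"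
  shows "(\<integral>\<omega>. \<bar>trunc_exp r (c * Z \<omega>)\<bar> * indicator {0..y} (Z \<omega>) \<partial>M)
    \<le> 2 * exp (d * y) * (\<integral>\<omega>. trunc_exp r ((c - d) * Z \<omega>) \<partial>M)"
proof -
  have meas: "Z \<in> borel_measurable M" using int [of 1] by (simp add: borel_measurable_integrable)
  have ind: "(\<lambda>\<omega>. indicator {0..y} (Z \<omega>) :: real) \<in> borel_measurable M"
    using meas by measurable
  have i1: "integrable M (\<lambda>\<omega>. \<bar>trunc_exp r (c * Z \<omega>)\<bar> * indicator {0..y} (Z \<omega>))"
    by (rule Bochner_Integration.integrable_bound [OF integrable_trunc_exp [OF int, of r c]])
      (use meas ind in \<open>auto simp: indicator_def\<close>)
  have "(\<integral>\<omega>. \<bar>trunc_exp r (c * Z \<omega>)\<bar> * indicator {0..y} (Z \<omega>) \<partial>M)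
     \<le> (\<integral>\<omega>. 2 * exp (d * y) * trunc_exp r ((c - d) * Z \<omega>) \<partial>M)"
  proof (rule integral_mono [OF i1])
    show "integrable M (\<lambda>\<omega>. 2 * exp (d * y) * trunc_exp r ((c - d) * Z \<omega>))"
      by (intro integrable_mult_right integrable_trunc_exp int)
    fix \<omega>
    show "\<bar>trunc_exp r (c * Z \<omega>)\<bar> * indicator {0..y} (Z \<omega>) \<le> 2 * exp (d * y) * trunc_exp r ((c - d) * Z \<omega>)"
    proof (cases "Z \<omega> \<in> {0..y}")
      case True
      then have Z: "0 \<le> Z \<omega>" "Z \<omega> \<le> y" by auto
      have "\<bar>trunc_exp r (c * Z \<omega>)\<bar> \<le> trunc_exp r (c * Z \<omega>)"
        using abs_trunc_exp_le [of r "c * Z \<omega>"] d Z by simp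
      also have "\<dots> \<le> exp (c * Z \<omega>)"
        using d Z by (intro trunc_exp_le_exp) auto
      also have "\<dots> = exp (d * Z \<omega>) * exp ((c - d) * Z \<omega>)"
        by (simp flip: exp_add add: algebra_simps)
      also have "\<dots> \<le> exp (d * y) * (2 * trunc_exp r ((c - d) * Z \<omega>))"
      proof (rule mult_mono)
        show "exp (d * Z \<omega>) \<le> exp (d * y)" using Z d by (simp add: mult_left_mono)
        have "(c - d) * Z \<omega> \<le> c * y" using Z d y by (intro mult_mono) auto
        then have "exp 1 * ((c - d) * Z \<omega>) \<le> exp 1 * (c * y)" by (rule mult_left_mono) simp
        then have "exp ((c - d) * Z \<omega>) / 2 \<le> trunc_exp r ((c - d) * Z \<omega>)"
          using Z d r(2) by (intro trunc_exp_ge_half_exp) (simp, linarith)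
        then show "exp ((c - d) * Z \<omega>) \<le> 2 * trunc_exp r ((c - d) * Z \<omega>)" by simp
      qed auto
      finally show ?thesis using True by simp
    next
      case False
      have "0 < trunc_exp r ((c - d) * Z \<omega>)" by (rule trunc_exp_pos_even) fact
      then show ?thesis using False by simp
    qed
  qed
  then show ?thesis by simp
qed

text \<open>The Chernoff bound: \<open>trunc_exp_upper_tail\<close> with c = 0, where the first
  truncated exponential is 1.\<close>

lemma prob_upper_tail_le:
  fixes Z :: "'a \<Rightarrow> real"
  assumes int: "\<And>j. integrable M (\<lambda>\<omega>. Z \<omega> ^ j)"
    and d: "0 \<le> d" and y: "0 \<le> y" and r: "exp 1 * (d * y) + 1 \<le> real r"
  shows "prob {\<omega> \<in> space M. y \<le> Z \<omega>} \<le> 2 * exp (- (d * y)) * (\<integral>\<omega>. trunc_exp (2 * r) (d * Z \<omega>) \<partial>M)"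
proof -
  have meas: "Z \<in> borel_measurable M" using int [of 1] by (simp add: borel_measurable_integrable)
  have "prob {\<omega> \<in> space M. y \<le> Z \<omega>} = (\<integral>\<omega>. indicator {\<omega> \<in> space M. y \<le> Z \<omega>} \<omega> \<partial>M)"
    using meas by simp
  also have "\<dots> = (\<integral>\<omega>. \<bar>trunc_exp r (0 * Z \<omega>)\<bar> * indicator {y..} (Z \<omega>) \<partial>M)"
    by (intro Bochner_Integration.integral_cong) (auto simp: indicator_def)
  finally have *: "prob {\<omega> \<in> space M. y \<le> Z \<omega>} * trunc_exp r (d * y) \<le> (\<integral>\<omega>. trunc_exp (2 * r) (d * Z \<omega>) \<partial>M)"
    using trunc_exp_upper_tail [OF int order_refl d y, of r] by simp
  have "exp (d * y) / 2 \<le> trunc_exp r (d * y)"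
    using d y r by (intro trunc_exp_ge_half_exp) auto
  then have "prob {\<omega> \<in> space M. y \<le> Z \<omega>} * (exp (d * y) / 2) \<le> prob {\<omega> \<in> space M. y \<le> Z \<omega>} * trunc_exp r (d * y)"
    by (intro mult_left_mono) auto
  with * have "prob {\<omega> \<in> space M. y \<le> Z \<omega>} * (exp (d * y) / 2) \<le> (\<integral>\<omega>. trunc_exp (2 * r) (d * Z \<omega>) \<partial>M)"
    by linarith
  then show ?thesis by (simp add: exp_minus field_simps)
qed

text \<open>Under the measure with density proportional to \<open>trunc_exp r (c Z)\<close> most mass lies in
  \<open>{y1<..<y2}\<close>; the four error terms are the masses of the remaining parts of the line.\<close>

lemma prob_interval_ge:
  fixes Z :: "'a \<Rightarrow> real"
  assumes int: "\<And>j. integrable M (\<lambda>\<omega>. Z \<omega> ^ j)"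
    and d: "0 \<le> d" "d \<le> c" and y: "0 \<le> y1" "y1 < y2" and l: "0 \<le> l"
    and r: "even r" "exp 1 * (c * y1) + 1 \<le> real r" "exp 1 * (d * y2) + 1 \<le> real r"
      "exp 1 * (c * l) + 1 \<le> real r" "exp 1 * (d * l) + 1 \<le> real r"
  shows "(\<integral>\<omega>. trunc_exp r (c * Z \<omega>) \<partial>M) \<le>
      exp (c * y2) * prob {\<omega> \<in> space M. y1 < Z \<omega> \<and> Z \<omega> < y2}
      + 2 * exp (- (d * y2)) * (\<integral>\<omega>. trunc_exp (2 * r) ((c + d) * Z \<omega>) \<partial>M)
      + 2 * exp (d * y1) * (\<integral>\<omega>. trunc_exp r ((c - d) * Z \<omega>) \<partial>M)
      + 2
      + 2 * exp (- (d * l)) * (\<integral>\<omega>. trunc_exp (2 * r) (- (c + d) * Z \<omega>) \<partial>M)"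
proof -
  have meas: "Z \<in> borel_measurable M" using int [of 1] by (simp add: borel_measurable_integrable)
  have intm: "integrable M (\<lambda>\<omega>. (- Z \<omega>) ^ j)" for j
  proof -
    have "integrable M (\<lambda>\<omega>. (- 1) ^ j * Z \<omega> ^ j)"
      using int by (intro integrable_mult_right) auto
    then show ?thesis by (simp flip: power_mult_distrib)
  qed
  define A where "A = {\<omega> \<in> space M. y1 < Z \<omega> \<and> Z \<omega> < y2}"
  have A: "A \<in> sets M" unfolding A_def using meas by measurable
  let ?f = "\<lambda>S \<omega>. \<bar>trunc_exp r (c * Z \<omega>)\<bar> * indicator S (Z \<omega>) :: real"
  let ?g = "\<lambda>\<omega>. \<bar>trunc_exp r (c * - Z \<omega>)\<bar> * indicator {l..} (- Z \<omega>) :: real"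
  have i: "integrable M (?f S)" if "S \<in> sets borel" for S
    by (rule Bochner_Integration.integrable_bound [OF integrable_trunc_exp [OF int, of r c]])
      (use meas that in \<open>auto simp: indicator_def\<close>)
  have i': "integrable M ?g"
    by (rule Bochner_Integration.integrable_bound [OF integrable_trunc_exp [OF intm, of r c]])
      (use meas in \<open>auto simp: indicator_def\<close>)
  have iA: "integrable M (\<lambda>\<omega>. exp (c * y2) * indicator A \<omega>)"
    using A by (intro integrable_mult_right) (auto intro!: integrable_real_indicator simp: less_top [symmetric])
  let ?rhs = "\<lambda>\<omega>. exp (c * y2) * indicator A \<omega> + ?f {y2..} \<omega> + ?f {0..y1} \<omega> + 2 + ?g \<omega>"
  have irhs: "integrable M ?rhs"
    by (intro Bochner_Integration.integrable_add iA i i') auto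
  have "(\<integral>\<omega>. trunc_exp r (c * Z \<omega>) \<partial>M) \<le> (\<integral>\<omega>. ?rhs \<omega> \<partial>M)"
  proof (rule integral_mono [OF integrable_trunc_exp [OF int] irhs])
    fix \<omega> assume \<omega>: "\<omega> \<in> space M"
    have nn: "0 \<le> exp (c * y2) * indicator A \<omega>" "0 \<le> ?f {y2..} \<omega>" "0 \<le> ?f {0..y1} \<omega>" "0 \<le> ?g \<omega>"
      by (auto simp: indicator_def)
    \<comment> \<open>On the first three pieces Z is nonnegative. On {- l < Z < 0} the truncated
      exponential is within 1 of exp and thus bounded by 2. Further left it may be large and is
      compared with its value at |Z|, which leads to a right tail of - Z.\<close>
    consider "y1 < Z \<omega>" "Z \<omega> < y2" | "y2 \<le> Z \<omega>" | "0 \<le> Z \<omega>" "Z \<omega> \<le> y1" | "- l < Z \<omega>" "Z \<omega> < 0" | "Z \<omega> \<le> - l"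
      by linarith
    then show "trunc_exp r (c * Z \<omega>) \<le> ?rhs \<omega>"
    proof cases
      case 1
      then have "trunc_exp r (c * Z \<omega>) \<le> exp (c * Z \<omega>)"
        using d y by (intro trunc_exp_le_exp) auto
      also have "\<dots> \<le> exp (c * y2)" using 1 d by (simp add: mult_left_mono)
      also have "\<dots> = exp (c * y2) * indicator A \<omega>" using 1 \<omega> by (simp add: A_def)
      finally show ?thesis using nn by linarith
    next
      case 2
      then have "trunc_exp r (c * Z \<omega>) \<le> ?f {y2..} \<omega>" by simp
      then show ?thesis using nn by linarith
    next
      case 3
      then have "trunc_exp r (c * Z \<omega>) \<le> ?f {0..y1} \<omega>" by simp
      then show ?thesis using nn by linarith
    next
      case 4
      have "c * \<bar>Z \<omega>\<bar> \<le> c * l" using 4 d by (intro mult_left_mono) auto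
      then have "exp 1 * (c * \<bar>Z \<omega>\<bar>) \<le> exp 1 * (c * l)" by (rule mult_left_mono) simp
      then have "\<bar>trunc_exp r (c * Z \<omega>)\<bar> \<le> 2"
        using 4 d r by (intro trunc_exp_nonpos_le) (auto simp: abs_mult mult_nonneg_nonpos)
      then show ?thesis using nn by linarith
    next
      case 5
      have "trunc_exp r (c * Z \<omega>) \<le> \<bar>trunc_exp r (c * Z \<omega>)\<bar>" by simp
      also have "\<dots> \<le> trunc_exp r \<bar>c * Z \<omega>\<bar>" by (rule abs_trunc_exp_le)
      also have "\<bar>c * Z \<omega>\<bar> = c * - Z \<omega>" using 5 l d by (simp add: abs_mult)
      also have "trunc_exp r (c * - Z \<omega>) \<le> ?g \<omega>" using 5 by simp
      finally show ?thesis using nn by linarith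
    qed
  qed
  also have "\<dots> = exp (c * y2) * prob A + (\<integral>\<omega>. ?f {y2..} \<omega> \<partial>M) + (\<integral>\<omega>. ?f {0..y1} \<omega> \<partial>M) + 2 + (\<integral>\<omega>. ?g \<omega> \<partial>M)"
  proof -
    have "(\<integral>\<omega>. exp (c * y2) * indicator A \<omega> \<partial>M) = exp (c * y2) * prob A"
      using A sets.sets_into_space [OF A] by (simp add: Int_absorb2)
    then show ?thesis
      using iA i i' by (simp add: prob_space)
  qed
  finally have main: "(\<integral>\<omega>. trunc_exp r (c * Z \<omega>) \<partial>M) \<le>
      exp (c * y2) * prob A + (\<integral>\<omega>. ?f {y2..} \<omega> \<partial>M) + (\<integral>\<omega>. ?f {0..y1} \<omega> \<partial>M) + 2 + (\<integral>\<omega>. ?g \<omega> \<partial>M)" .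
  \<comment> \<open>Where \<open>trunc_exp\<close> is at least half of exp, dividing by it costs
    only the factor 2.\<close>
  have divide_out: "x \<le> 2 * exp (- u) * z" if "x * trunc_exp r u \<le> z" "exp u / 2 \<le> trunc_exp r u" "0 \<le> x" for x u z
  proof -
    have "x * (exp u / 2) \<le> x * trunc_exp r u" using that by (intro mult_left_mono) auto
    with that have "x * (exp u / 2) \<le> z" by linarith
    then show ?thesis by (simp add: exp_minus field_simps)
  qed
  have "(\<integral>\<omega>. ?f {y2..} \<omega> \<partial>M) \<le> 2 * exp (- (d * y2)) * (\<integral>\<omega>. trunc_exp (2 * r) ((c + d) * Z \<omega>) \<partial>M)"
    using d y r by (intro divide_out trunc_exp_upper_tail trunc_exp_ge_half_exp int integral_nonneg) auto
  moreover have "(\<integral>\<omega>. ?f {0..y1} \<omega> \<partial>M) \<le> 2 * exp (d * y1) * (\<integral>\<omega>. trunc_exp r ((c - d) * Z \<omega>) \<partial>M)"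
    using d y r by (intro trunc_exp_lower_tail int) auto
  moreover have "(\<integral>\<omega>. ?g \<omega> \<partial>M) \<le> 2 * exp (- (d * l)) * (\<integral>\<omega>. trunc_exp (2 * r) ((c + d) * - Z \<omega>) \<partial>M)"
    using d l r by (intro divide_out trunc_exp_upper_tail trunc_exp_ge_half_exp intm integral_nonneg) auto
  moreover have "(c + d) * - Z \<omega> = - (c + d) * Z \<omega>" for \<omega>
    by (simp add: algebra_simps)
  ultimately show ?thesis using main unfolding A_def by simp
qed

end

section \<open>Exponential estimates at speed a^2\<close>

lemma nat_ceiling_bounds:
  fixes L a :: real
  assumes "0 \<le> L" "1 \<le> a"
  shows "L * a\<^sup>2 \<le> real (nat \<lceil>L * a\<^sup>2\<rceil>)" "real (nat \<lceil>L * a\<^sup>2\<rceil>) \<le> (L + 1) * a\<^sup>2"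
proof -
  have "1 \<le> a\<^sup>2" using assms by simp
  moreover have "0 \<le> L * a\<^sup>2" using assms by simp
  ultimately show "L * a\<^sup>2 \<le> real (nat \<lceil>L * a\<^sup>2\<rceil>)" "real (nat \<lceil>L * a\<^sup>2\<rceil>) \<le> (L + 1) * a\<^sup>2"
    unfolding distrib_right by linarith+
qed

lemma speed_ge_1:
  fixes a :: "nat \<Rightarrow> real"
  assumes "filterlim a at_top sequentially"
  shows "eventually (\<lambda>n. 1 \<le> a n) sequentially"
  using assms by (simp add: filterlim_at_top)

lemma speed_sq_large:
  fixes a :: "nat \<Rightarrow> real"
  assumes a: "filterlim a at_top sequentially" and c: "0 < c"
  shows "eventually (\<lambda>n. b \<le> c * (a n)\<^sup>2) sequentially"
proof -
  have "filterlim (\<lambda>n. (a n)\<^sup>2) at_top sequentially"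
    by (rule filterlim_pow_at_top [OF _ a]) simp
  then have "filterlim (\<lambda>n. c * (a n)\<^sup>2) at_top sequentially"
    by (rule filterlim_tendsto_pos_mult_at_top [OF tendsto_const c])
  then show ?thesis by (simp add: filterlim_at_top)
qed

context
  fixes M :: "nat \<Rightarrow> 'a measure" and Z :: "nat \<Rightarrow> 'a \<Rightarrow> real" and a :: "nat \<Rightarrow> real"
  assumes ps: "eventually (\<lambda>n. prob_space (M n)) sequentially"
    and int: "eventually (\<lambda>n. \<forall>j. integrable (M n) (\<lambda>\<omega>. Z n \<omega> ^ j)) sequentially"
    and a: "filterlim a at_top sequentially"
begin

text \<open>Even orders keep the expectation positive, so that the bounds on its logarithm can be
  exponentiated.\<close>

lemma gaussian_trunc_mgf_sandwich:
  assumes mgf: "gaussian_trunc_mgf M Z a t" and \<eta>: "0 < \<eta>"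
  shows "\<exists>L0>0. \<forall>L1 r.
      eventually (\<lambda>n. L0 * (a n)\<^sup>2 \<le> real (r n) \<and> real (r n) \<le> L1 * (a n)\<^sup>2 \<and> even (r n)) sequentially \<longrightarrow>
      eventually (\<lambda>n. exp ((t\<^sup>2 / 2 - \<eta>) * (a n)\<^sup>2) \<le> (\<integral>\<omega>. trunc_exp (r n) (t * a n * Z n \<omega>) \<partial>M n) \<and>
        (\<integral>\<omega>. trunc_exp (r n) (t * a n * Z n \<omega>) \<partial>M n) \<le> exp ((t\<^sup>2 / 2 + \<eta>) * (a n)\<^sup>2)) sequentially"
proof -
  from mgf obtain L0 where L0: "L0 > 0" and lim: "\<And>L1 r. eventually (\<lambda>n. L0 * (a n)\<^sup>2 \<le> real (r n) \<and> real (r n) \<le> L1 * (a n)\<^sup>2) sequentially \<Longrightarrow>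
       (\<lambda>n. ln (\<integral>\<omega>. trunc_exp (r n) (t * a n * Z n \<omega>) \<partial>M n) / (a n)\<^sup>2) \<longlonglongrightarrow> t\<^sup>2 / 2"
    unfolding gaussian_trunc_mgf_def by blast
  show ?thesis
  proof (intro exI [of _ L0] conjI L0 allI impI)
    fix L1 and r :: "nat \<Rightarrow> nat"
    assume r: "eventually (\<lambda>n. L0 * (a n)\<^sup>2 \<le> real (r n) \<and> real (r n) \<le> L1 * (a n)\<^sup>2 \<and> even (r n)) sequentially"
    then have r': "eventually (\<lambda>n. L0 * (a n)\<^sup>2 \<le> real (r n) \<and> real (r n) \<le> L1 * (a n)\<^sup>2) sequentially"
      by eventually_elim simp
    have l1: "t\<^sup>2 / 2 - \<eta> < t\<^sup>2 / 2" and l2: "t\<^sup>2 / 2 < t\<^sup>2 / 2 + \<eta>" using \<eta> by simp_all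
    show "eventually (\<lambda>n. exp ((t\<^sup>2 / 2 - \<eta>) * (a n)\<^sup>2) \<le> (\<integral>\<omega>. trunc_exp (r n) (t * a n * Z n \<omega>) \<partial>M n) \<and>
        (\<integral>\<omega>. trunc_exp (r n) (t * a n * Z n \<omega>) \<partial>M n) \<le> exp ((t\<^sup>2 / 2 + \<eta>) * (a n)\<^sup>2)) sequentially"
      using order_tendstoD(1) [OF lim [OF r'] l1] order_tendstoD(2) [OF lim [OF r'] l2] ps int r speed_ge_1 [OF a]
    proof eventually_elim
      case (elim n)
      interpret prob_space "M n" using elim by simp
      define E where "E = (\<integral>\<omega>. trunc_exp (r n) (t * a n * Z n \<omega>) \<partial>M n)"
      have E: "0 < E"
        unfolding E_def
        by (rule expectation_greater [OF integrable_trunc_exp]) (use elim in \<open>auto intro!: trunc_exp_pos_even\<close>)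
      have a2: "0 < (a n)\<^sup>2" using elim by simp
      have "(t\<^sup>2 / 2 - \<eta>) * (a n)\<^sup>2 \<le> ln E" "ln E \<le> (t\<^sup>2 / 2 + \<eta>) * (a n)\<^sup>2"
        using elim a2 unfolding E_def by (simp_all only: pos_less_divide_eq pos_divide_less_eq less_imp_le)
      then have "exp ((t\<^sup>2 / 2 - \<eta>) * (a n)\<^sup>2) \<le> exp (ln E)" "exp (ln E) \<le> exp ((t\<^sup>2 / 2 + \<eta>) * (a n)\<^sup>2)"
        by simp_all
      then show ?case using E unfolding E_def by simp
    qed
  qed
qed

text \<open>Chernoff with tilt t = x, the maximizer of t x - t^2 / 2.\<close>

lemma moderate_upper_tail:
  assumes mgf: "\<And>t. gaussian_trunc_mgf M Z a t" and x: "0 < x" and \<eta>: "0 < \<eta>"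
  shows "eventually (\<lambda>n. measure (M n) {\<omega> \<in> space (M n). x * a n \<le> Z n \<omega>}
           \<le> 2 * exp ((- x\<^sup>2 / 2 + \<eta>) * (a n)\<^sup>2)) sequentially"
proof -
  obtain L0 where L0: "L0 > 0" and
    bnd: "\<And>L1 r. eventually (\<lambda>n. L0 * (a n)\<^sup>2 \<le> real (r n) \<and> real (r n) \<le> L1 * (a n)\<^sup>2 \<and> even (r n)) sequentially \<Longrightarrow>
      eventually (\<lambda>n. exp ((x\<^sup>2 / 2 - \<eta>) * (a n)\<^sup>2) \<le> (\<integral>\<omega>. trunc_exp (r n) (x * a n * Z n \<omega>) \<partial>M n) \<and>
        (\<integral>\<omega>. trunc_exp (r n) (x * a n * Z n \<omega>) \<partial>M n) \<le> exp ((x\<^sup>2 / 2 + \<eta>) * (a n)\<^sup>2)) sequentially"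
    using gaussian_trunc_mgf_sandwich [OF mgf \<eta>, of x] by blast
  \<comment> \<open>L serves two demands on r: the threshold L0 of the truncated generating function
    and e (x a)^2 + 1 \<le> r in the Chernoff bound.\<close>
  define L where "L = L0 + exp 1 * x\<^sup>2 + 1"
  have L: "0 \<le> L" "L0 \<le> L" "exp 1 * x\<^sup>2 + 1 \<le> L" using L0 by (simp_all add: L_def add_nonneg_nonneg)
  define r where "r n = nat \<lceil>L * (a n)\<^sup>2\<rceil>" for n
  have "eventually (\<lambda>n. L0 * (a n)\<^sup>2 \<le> real (2 * r n) \<and> real (2 * r n) \<le> (2 * (L + 1)) * (a n)\<^sup>2 \<and> even (2 * r n)) sequentially"
    using speed_ge_1 [OF a]
  proof eventually_elim
    case (elim n)
    have "L0 * (a n)\<^sup>2 \<le> L * (a n)\<^sup>2" using L by (intro mult_right_mono) auto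
    then show ?case using nat_ceiling_bounds [OF L(1) elim] unfolding r_def by (simp add: algebra_simps)
  qed
  from bnd [OF this] show ?thesis
    using ps int speed_ge_1 [OF a]
  proof eventually_elim
    case (elim n)
    interpret prob_space "M n" using elim by simp
    have "exp 1 * (x * a n * (x * a n)) + 1 \<le> (exp 1 * x\<^sup>2 + 1) * (a n)\<^sup>2"
      using elim by (simp add: power2_eq_square algebra_simps mult_ge1_I)
    also have "\<dots> \<le> L * (a n)\<^sup>2" using L by (intro mult_right_mono) auto
    also have "\<dots> \<le> real (r n)" using nat_ceiling_bounds [OF L(1)] elim unfolding r_def by simp
    finally have "prob {\<omega> \<in> space (M n). x * a n \<le> Z n \<omega>}
        \<le> 2 * exp (- (x * a n * (x * a n))) * (\<integral>\<omega>. trunc_exp (2 * r n) (x * a n * Z n \<omega>) \<partial>M n)"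
      using elim x by (intro prob_upper_tail_le) auto
    also have "\<dots> \<le> 2 * exp (- (x * a n * (x * a n))) * exp ((x\<^sup>2 / 2 + \<eta>) * (a n)\<^sup>2)"
      using elim by (intro mult_left_mono) auto
    also have "\<dots> = 2 * exp ((- x\<^sup>2 / 2 + \<eta>) * (a n)\<^sup>2)"
      by (simp flip: exp_add add: power2_eq_square algebra_simps)
    finally show ?case .
  qed
qed

text \<open>Tilting by x a gives a total mass of about exp (x^2 a^2 / 2). Shifting the tilt by
  \<epsilon> up or down shows that both tails outside (x - \<epsilon>, x + \<epsilon>) lose
  \<epsilon>^2 / 2 in the exponent, because - \<epsilon> (x + \<epsilon>) + (x + \<epsilon>)^2 / 2
  and \<epsilon> (x - \<epsilon>) + (x - \<epsilon>)^2 / 2 both equal x^2 / 2 - \<epsilon>^2 / 2. So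
  the interval carries half of the mass, and dividing by the largest tilt exp (x (x + \<epsilon>)
  a^2) on it yields the bound.\<close>

lemma moderate_interval_lower:
  assumes mgf: "\<And>t. gaussian_trunc_mgf M Z a t" and \<epsilon>: "0 < \<epsilon>" "\<epsilon> < x"
  shows "eventually (\<lambda>n. exp (- (x\<^sup>2 / 2 + x * \<epsilon> + \<epsilon>\<^sup>2 / 8) * (a n)\<^sup>2) / 2
     \<le> measure (M n) {\<omega> \<in> space (M n). (x - \<epsilon>) * a n < Z n \<omega> \<and> Z n \<omega> < (x + \<epsilon>) * a n}) sequentially"
proof -
  \<comment> \<open>Small against the gain \<epsilon>^2 / 2: the two neighbouring tails then have
    exponent x^2 / 2 - 3 \<epsilon>^2 / 8 (the quantity \<open>S\<close> below), and the main term
    has x^2 / 2 - \<epsilon>^2 / 8.\<close>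
  define \<eta> where "\<eta> = \<epsilon>\<^sup>2 / 8"
  have \<eta>: "0 < \<eta>" using \<epsilon> by (simp add: \<eta>_def)
  define E where "E t r n = (\<integral>\<omega>. trunc_exp r (t * a n * Z n \<omega>) \<partial>M n)" for t r n
  define good where "good t L0 \<longleftrightarrow> 0 < L0 \<and> (\<forall>L1 r.
      eventually (\<lambda>n. L0 * (a n)\<^sup>2 \<le> real (r n) \<and> real (r n) \<le> L1 * (a n)\<^sup>2 \<and> even (r n)) sequentially \<longrightarrow>
      eventually (\<lambda>n. exp ((t\<^sup>2 / 2 - \<eta>) * (a n)\<^sup>2) \<le> E t (r n) n \<and>
        E t (r n) n \<le> exp ((t\<^sup>2 / 2 + \<eta>) * (a n)\<^sup>2)) sequentially)" for t L0
  have "\<forall>t. \<exists>L0. good t L0"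
    unfolding E_def good_def using gaussian_trunc_mgf_sandwich [OF mgf \<eta>] by blast
  from choice [OF this] obtain L0 where good: "\<forall>t. good t (L0 t)" ..
  have L0: "L0 t > 0" for t
    using spec [OF good, of t] unfolding good_def by (rule conjunct1)
  have bnd: "eventually (\<lambda>n. exp ((t\<^sup>2 / 2 - \<eta>) * (a n)\<^sup>2) \<le> E t (r n) n \<and>
        E t (r n) n \<le> exp ((t\<^sup>2 / 2 + \<eta>) * (a n)\<^sup>2)) sequentially"
    if "eventually (\<lambda>n. L0 t * (a n)\<^sup>2 \<le> real (r n) \<and> real (r n) \<le> L1 * (a n)\<^sup>2 \<and> even (r n)) sequentially" for t L1 r
    using spec [OF good, of t] that unfolding good_def by blast
  \<comment> \<open>Makes - \<epsilon> l + (x + \<epsilon>)^2 / 2 + \<eta> vanish, so that the far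
    left tail contributes at most a constant.\<close>
  define l where "l = ((x + \<epsilon>)\<^sup>2 / 2 + \<eta>) / \<epsilon>"
  have l: "0 < l" using \<epsilon> \<eta> by (simp add: l_def add_pos_pos)
  \<comment> \<open>B bounds every product of a tilt (at most x + \<epsilon>) and a position (at
    most x + \<epsilon> + l) in the conditions of \<open>prob_interval_ge\<close>; L then covers
    these and the thresholds of all four tilts.\<close>
  define B where "B = (x + \<epsilon>) * (x + \<epsilon> + l)"
  have B: "0 \<le> B" using \<epsilon> l by (simp add: B_def)
  define L where "L = L0 x + L0 (x + \<epsilon>) + L0 (x - \<epsilon>) + L0 (- (x + \<epsilon>)) + exp 1 * B + 1"
  have L: "0 \<le> L" "L0 x \<le> L" "L0 (x + \<epsilon>) \<le> L" "L0 (x - \<epsilon>) \<le> L" "L0 (- (x + \<epsilon>)) \<le> L" "exp 1 * B + 1 \<le> L"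
    using L0 [of x] L0 [of "x + \<epsilon>"] L0 [of "x - \<epsilon>"] L0 [of "- (x + \<epsilon>)"] mult_nonneg_nonneg [OF _ B, of "exp 1"]
    by (simp_all add: L_def)
  define r where "r n = 2 * nat \<lceil>L * (a n)\<^sup>2\<rceil>" for n
  have r_even: "even (r n)" for n by (simp add: r_def)
  have r_ge: "eventually (\<lambda>n. L * (a n)\<^sup>2 \<le> real (r n) \<and> real (r n) \<le> (2 * (L + 1)) * (a n)\<^sup>2) sequentially"
    using speed_ge_1 [OF a]
  proof eventually_elim
    case (elim n)
    show ?case using nat_ceiling_bounds [OF L(1) elim] unfolding r_def by (simp add: algebra_simps)
  qed
  have bnd1: "eventually (\<lambda>n. exp ((t\<^sup>2 / 2 - \<eta>) * (a n)\<^sup>2) \<le> E t (r n) n \<and>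
        E t (r n) n \<le> exp ((t\<^sup>2 / 2 + \<eta>) * (a n)\<^sup>2)) sequentially" if "L0 t \<le> L" for t
  proof (rule bnd)
    show "eventually (\<lambda>n. L0 t * (a n)\<^sup>2 \<le> real (r n) \<and> real (r n) \<le> 2 * (L + 1) * (a n)\<^sup>2 \<and> even (r n)) sequentially"
      using r_ge
    proof eventually_elim
      case (elim n)
      have "L0 t * (a n)\<^sup>2 \<le> L * (a n)\<^sup>2" using that by (intro mult_right_mono) auto
      then show ?case using elim r_even by simp
    qed
  qed
  have bnd2: "eventually (\<lambda>n. exp ((t\<^sup>2 / 2 - \<eta>) * (a n)\<^sup>2) \<le> E t (2 * r n) n \<and>
        E t (2 * r n) n \<le> exp ((t\<^sup>2 / 2 + \<eta>) * (a n)\<^sup>2)) sequentially" if "L0 t \<le> L" for t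
  proof (rule bnd)
    show "eventually (\<lambda>n. L0 t * (a n)\<^sup>2 \<le> real (2 * r n) \<and> real (2 * r n) \<le> 4 * (L + 1) * (a n)\<^sup>2 \<and> even (2 * r n)) sequentially"
      using r_ge
    proof eventually_elim
      case (elim n)
      have "L0 t * (a n)\<^sup>2 \<le> L * (a n)\<^sup>2" using that by (intro mult_right_mono) auto
      then show ?case using elim by (simp add: algebra_simps)
    qed
  qed
  \<comment> \<open>The error terms add up to at most 8 S. The gap \<epsilon>^2 / 4 between the
    exponents eventually makes this at most half of the main term.\<close>
  have big: "eventually (\<lambda>n. 16 \<le> exp (\<epsilon>\<^sup>2 / 4 * (a n)\<^sup>2)) sequentially"
    using speed_sq_large [OF a, of "\<epsilon>\<^sup>2 / 4" "ln 16"] \<epsilon>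
    by (auto elim!: eventually_mono simp: ln_le_cancel_iff [symmetric] simp del: ln_le_cancel_iff)
  show ?thesis
    using bnd1 [OF L(2)] bnd1 [OF L(4)] bnd2 [OF L(3)] bnd2 [OF L(5)] r_ge speed_ge_1 [OF a] big ps int
  proof eventually_elim
    case (elim n)
    interpret prob_space "M n" using elim by simp
    define A where "A = (a n)\<^sup>2"
    have A: "1 \<le> A" using elim by (simp add: A_def)
    define S where "S = exp ((x\<^sup>2 / 2 - 3 * \<epsilon>\<^sup>2 / 8) * A)"
    have an: "0 \<le> a n" using elim by simp
    have rB: "exp 1 * (u * a n * (v * a n)) + 1 \<le> real (r n)" if "0 \<le> u" "u \<le> x + \<epsilon>" "0 \<le> v" "v \<le> x + \<epsilon> + l" for u v
    proof -
      have "u * v \<le> B" unfolding B_def using that by (intro mult_mono) auto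
      then have le: "exp 1 * (u * v) * A \<le> exp 1 * B * A" using A by (intro mult_right_mono mult_left_mono) auto
      have eq: "exp 1 * (u * a n * (v * a n)) = exp 1 * (u * v) * A"
        by (simp add: A_def power2_eq_square)
      have "exp 1 * (u * a n * (v * a n)) + 1 \<le> (exp 1 * B + 1) * A"
        unfolding eq distrib_right using le A by linarith
      also have "\<dots> \<le> L * A" using L A by (intro mult_right_mono) auto
      also have "\<dots> \<le> real (r n)" using elim by (simp add: A_def)
      finally show ?thesis .
    qed
    let ?P = "prob {\<omega> \<in> space (M n). (x - \<epsilon>) * a n < Z n \<omega> \<and> Z n \<omega> < (x + \<epsilon>) * a n}"
    have "(\<integral>\<omega>. trunc_exp (r n) (x * a n * Z n \<omega>) \<partial>M n) \<le>
      exp (x * a n * ((x + \<epsilon>) * a n)) * ?P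
      + 2 * exp (- (\<epsilon> * a n * ((x + \<epsilon>) * a n))) * (\<integral>\<omega>. trunc_exp (2 * r n) ((x * a n + \<epsilon> * a n) * Z n \<omega>) \<partial>M n)
      + 2 * exp (\<epsilon> * a n * ((x - \<epsilon>) * a n)) * (\<integral>\<omega>. trunc_exp (r n) ((x * a n - \<epsilon> * a n) * Z n \<omega>) \<partial>M n)
      + 2
      + 2 * exp (- (\<epsilon> * a n * (l * a n))) * (\<integral>\<omega>. trunc_exp (2 * r n) (- (x * a n + \<epsilon> * a n) * Z n \<omega>) \<partial>M n)"
    proof (rule prob_interval_ge)
      show "integrable (M n) (\<lambda>\<omega>. Z n \<omega> ^ j)" for j using elim by simp
      show "0 \<le> \<epsilon> * a n" "\<epsilon> * a n \<le> x * a n" "0 \<le> (x - \<epsilon>) * a n" "0 \<le> l * a n"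
        using \<epsilon> an l by (auto intro: mult_right_mono)
      show "(x - \<epsilon>) * a n < (x + \<epsilon>) * a n" using \<epsilon> elim by (intro mult_strict_right_mono) auto
    qed (use r_even rB \<epsilon> l in auto)
    also have "\<dots> = exp (x * (x + \<epsilon>) * A) * ?P + 2 * (exp (- (\<epsilon> * (x + \<epsilon>)) * A) * E (x + \<epsilon>) (2 * r n) n)
       + 2 * (exp (\<epsilon> * (x - \<epsilon>) * A) * E (x - \<epsilon>) (r n) n) + 2
       + 2 * (exp (- (\<epsilon> * l) * A) * E (- (x + \<epsilon>)) (2 * r n) n)"
      by (simp add: E_def A_def power2_eq_square algebra_simps)
    finally have main: "E x (r n) n \<le> exp (x * (x + \<epsilon>) * A) * ?P + 2 * (exp (- (\<epsilon> * (x + \<epsilon>)) * A) * E (x + \<epsilon>) (2 * r n) n)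
       + 2 * (exp (\<epsilon> * (x - \<epsilon>) * A) * E (x - \<epsilon>) (r n) n) + 2
       + 2 * (exp (- (\<epsilon> * l) * A) * E (- (x + \<epsilon>)) (2 * r n) n)"
      unfolding E_def .
    have S1: "1 \<le> S"
    proof -
      have "\<epsilon>\<^sup>2 \<le> x\<^sup>2" using \<epsilon> by (intro power_mono) auto
      moreover have "0 \<le> \<epsilon>\<^sup>2" by simp
      ultimately have "0 \<le> x\<^sup>2 / 2 - 3 * \<epsilon>\<^sup>2 / 8" by linarith
      then show ?thesis unfolding S_def using A by simp
    qed
    have t: "exp (u * A) * y \<le> exp (w * A)" if "y \<le> exp (v * A)" "u + v = w" for u v w y
    proof -
      have "exp (u * A) * y \<le> exp (u * A) * exp (v * A)" using that by (intro mult_left_mono) auto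
      also have "\<dots> = exp (w * A)" using that(2) by (simp flip: exp_add distrib_right)
      finally show ?thesis .
    qed
    have t2: "exp (- (\<epsilon> * (x + \<epsilon>)) * A) * E (x + \<epsilon>) (2 * r n) n \<le> S"
      unfolding S_def
    proof (rule t)
      show "E (x + \<epsilon>) (2 * r n) n \<le> exp (((x + \<epsilon>)\<^sup>2 / 2 + \<eta>) * A)" using elim by (simp add: A_def)
    qed (simp add: \<eta>_def power2_eq_square field_simps)
    have t3: "exp (\<epsilon> * (x - \<epsilon>) * A) * E (x - \<epsilon>) (r n) n \<le> S"
      unfolding S_def
    proof (rule t)
      show "E (x - \<epsilon>) (r n) n \<le> exp (((x - \<epsilon>)\<^sup>2 / 2 + \<eta>) * A)" using elim by (simp add: A_def)
    qed (simp add: \<eta>_def power2_eq_square field_simps)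
    have t5: "exp (- (\<epsilon> * l) * A) * E (- (x + \<epsilon>)) (2 * r n) n \<le> exp (0 * A)"
    proof (rule t)
      show "E (- (x + \<epsilon>)) (2 * r n) n \<le> exp (((- (x + \<epsilon>))\<^sup>2 / 2 + \<eta>) * A)" using elim by (simp add: A_def)
      show "- (\<epsilon> * l) + ((- (x + \<epsilon>))\<^sup>2 / 2 + \<eta>) = 0" using \<epsilon> unfolding l_def power2_minus by simp
    qed
    have "16 * S \<le> exp (\<epsilon>\<^sup>2 / 4 * A) * S"
      using elim S1 by (intro mult_right_mono) (auto simp: A_def)
    also have "\<dots> = exp ((x\<^sup>2 / 2 - \<eta>) * A)"
      unfolding S_def \<eta>_def by (simp flip: exp_add add: field_simps)
    finally have S16: "16 * S \<le> exp ((x\<^sup>2 / 2 - \<eta>) * A)" .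
    have "exp ((x\<^sup>2 / 2 - \<eta>) * A) \<le> E x (r n) n" using elim by (simp add: A_def)
    then have "exp ((x\<^sup>2 / 2 - \<eta>) * A) / 2 \<le> exp (x * (x + \<epsilon>) * A) * ?P"
      using main t2 t3 t5 S1 S16 by simp
    then have "exp (- (x * (x + \<epsilon>) * A)) * (exp ((x\<^sup>2 / 2 - \<eta>) * A) / 2) \<le> exp (- (x * (x + \<epsilon>) * A)) * (exp (x * (x + \<epsilon>) * A) * ?P)"
      by (intro mult_left_mono) auto
    also have "\<dots> = ?P" by (simp add: exp_minus)
    also have "exp (- (x * (x + \<epsilon>) * A)) * (exp ((x\<^sup>2 / 2 - \<eta>) * A) / 2) = exp (- (x\<^sup>2 / 2 + x * \<epsilon> + \<epsilon>\<^sup>2 / 8) * A) / 2"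
    proof -
      have "- (x * (x + \<epsilon>) * A) + (x\<^sup>2 / 2 - \<eta>) * A = - (x\<^sup>2 / 2 + x * \<epsilon> + \<epsilon>\<^sup>2 / 8) * A"
        unfolding \<eta>_def by (simp add: power2_eq_square field_simps)
      then show ?thesis by (metis exp_add times_divide_eq_right)
    qed
    finally show ?case unfolding A_def .
  qed
qed

lemma moderate_ball_lower:
  assumes mgf: "\<And>t. gaussian_trunc_mgf M Z a t" and x: "0 < x" and \<delta>: "0 < \<delta>" and \<eta>: "0 < \<eta>"
  shows "eventually (\<lambda>n. exp (- (x\<^sup>2 / 2 + \<eta>) * (a n)\<^sup>2)
     \<le> measure (M n) {\<omega> \<in> space (M n). \<bar>Z n \<omega> / a n - x\<bar> < \<delta>}) sequentially"
proof -
  \<comment> \<open>The bound \<eta> / (4 x) keeps the loss x \<epsilon> + \<epsilon>^2 / 8 below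
    \<eta> / 2; the other half of \<eta> absorbs the factor 1 / 2. The bound x / 2 ensures
    \<epsilon> < x.\<close>
  define \<epsilon> where "\<epsilon> = min \<delta> (min (x / 2) (\<eta> / (4 * x)))"
  have \<epsilon>: "0 < \<epsilon>" "\<epsilon> \<le> \<delta>" "\<epsilon> < x" "\<epsilon> \<le> \<eta> / (4 * x)"
    using x \<delta> \<eta> by (auto simp: \<epsilon>_def min_less_iff_disj)
  have loss: "x * \<epsilon> + \<epsilon>\<^sup>2 / 8 \<le> \<eta> / 2"
  proof -
    have "\<epsilon>\<^sup>2 \<le> x * \<epsilon>" using \<epsilon> by (simp add: power2_eq_square)
    moreover have "x * \<epsilon> \<le> \<eta> / 4" using \<epsilon>(4) x by (simp add: field_simps)
    ultimately show ?thesis using \<eta> by linarith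
  qed
  have big: "eventually (\<lambda>n. ln 2 \<le> \<eta> / 2 * (a n)\<^sup>2) sequentially"
    using \<eta> by (intro speed_sq_large a) simp
  show ?thesis
    using moderate_interval_lower [OF mgf \<epsilon>(1) \<epsilon>(3)] big speed_ge_1 [OF a] ps int
  proof eventually_elim
    case (elim n)
    interpret prob_space "M n" using elim by simp
    have meas: "Z n \<in> borel_measurable (M n)"
      using spec [OF elim(5), of 1] by (simp add: borel_measurable_integrable)
    have "exp (- (x\<^sup>2 / 2 + \<eta>) * (a n)\<^sup>2) \<le> exp (- (x\<^sup>2 / 2 + x * \<epsilon> + \<epsilon>\<^sup>2 / 8) * (a n)\<^sup>2 - ln 2)"
    proof -
      have "(x * \<epsilon> + \<epsilon>\<^sup>2 / 8) * (a n)\<^sup>2 \<le> \<eta> / 2 * (a n)\<^sup>2"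
        by (rule mult_right_mono [OF loss]) simp
      then show ?thesis using elim(2) by (simp add: algebra_simps)
    qed
    also have "\<dots> = exp (- (x\<^sup>2 / 2 + x * \<epsilon> + \<epsilon>\<^sup>2 / 8) * (a n)\<^sup>2) / 2"
      by (simp add: exp_diff)
    also have "\<dots> \<le> prob {\<omega> \<in> space (M n). (x - \<epsilon>) * a n < Z n \<omega> \<and> Z n \<omega> < (x + \<epsilon>) * a n}"
      using elim by simp
    also have "\<dots> \<le> prob {\<omega> \<in> space (M n). \<bar>Z n \<omega> / a n - x\<bar> < \<delta>}"
    proof (rule finite_measure_mono)
      show "{\<omega> \<in> space (M n). \<bar>Z n \<omega> / a n - x\<bar> < \<delta>} \<in> events" using meas by measurable
      show "{\<omega> \<in> space (M n). (x - \<epsilon>) * a n < Z n \<omega> \<and> Z n \<omega> < (x + \<epsilon>) * a n} \<subseteq> {\<omega> \<in> space (M n). \<bar>Z n \<omega> / a n - x\<bar> < \<delta>}"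
      proof clarify
        fix \<omega> assume "(x - \<epsilon>) * a n < Z n \<omega>" "Z n \<omega> < (x + \<epsilon>) * a n"
        then have "x - \<epsilon> < Z n \<omega> / a n" "Z n \<omega> / a n < x + \<epsilon>"
          using elim by (simp_all add: pos_less_divide_eq pos_divide_less_eq)
        then show "\<bar>Z n \<omega> / a n - x\<bar> < \<delta>" using \<epsilon>(2) by linarith
      qed
    qed
    finally show ?case .
  qed
qed

lemma moderate_ball_lower_0:
  assumes up: "\<And>x \<eta>. 0 < x \<Longrightarrow> 0 < \<eta> \<Longrightarrow> eventually (\<lambda>n. measure (M n) {\<omega> \<in> space (M n). x * a n \<le> \<bar>Z n \<omega>\<bar>}
           \<le> 4 * exp ((- x\<^sup>2 / 2 + \<eta>) * (a n)\<^sup>2)) sequentially"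
    and \<delta>: "0 < \<delta>" and \<eta>: "0 < \<eta>"
  shows "eventually (\<lambda>n. exp (- \<eta> * (a n)\<^sup>2)
     \<le> measure (M n) {\<omega> \<in> space (M n). \<bar>Z n \<omega> / a n\<bar> < \<delta>}) sequentially"
proof -
  have \<delta>4: "0 < \<delta>\<^sup>2 / 4" using \<delta> by simp
  show ?thesis
    using up [OF \<delta> \<delta>4] speed_sq_large [OF a \<eta>, of "ln 8"] speed_sq_large [OF a \<delta>4, of "ln 8"] speed_ge_1 [OF a] ps int
  proof eventually_elim
    case (elim n)
    interpret prob_space "M n" using elim by simp
    have meas: "Z n \<in> borel_measurable (M n)"
      using spec [OF elim(6), of 1] by (simp add: borel_measurable_integrable)
    let ?A = "{\<omega> \<in> space (M n). \<bar>Z n \<omega> / a n\<bar> < \<delta>}"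
    have A: "?A \<in> events" using meas by measurable
    have "exp ((- \<delta>\<^sup>2 / 2 + \<delta>\<^sup>2 / 4) * (a n)\<^sup>2) \<le> exp (- ln 8)"
      using elim(3) by (simp add: field_simps)
    also have "\<dots> = 1 / (8::real)" by (simp add: exp_minus)
    finally have u: "prob {\<omega> \<in> space (M n). \<delta> * a n \<le> \<bar>Z n \<omega>\<bar>} \<le> 1 / 2"
      using elim(1) by simp
    have "space (M n) - ?A = {\<omega> \<in> space (M n). \<delta> * a n \<le> \<bar>Z n \<omega>\<bar>}"
      using elim by (auto simp: abs_divide pos_divide_less_eq not_less)
    then have "prob ?A \<ge> 1 / 2" using u prob_compl [OF A] by simp
    moreover have "exp (- \<eta> * (a n)\<^sup>2) \<le> exp (- ln 8)" using elim(2) by simp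
    then have "exp (- \<eta> * (a n)\<^sup>2) \<le> 1 / 8" by (simp add: exp_minus)
    ultimately show ?case by simp
  qed
qed

end

text \<open>The rate function depends on |x| only and increases with it, so the upper bound for an
  arbitrary B is a two-sided tail bound at the distance of its closure from 0. The lower bound comes
  from small balls around interior points.\<close>

theorem moderate_deviation_principle_of_trunc_mgf:
  fixes Z :: "nat \<Rightarrow> 'a \<Rightarrow> real"
  assumes ps: "eventually (\<lambda>n. prob_space (M n)) sequentially"
    and int: "eventually (\<lambda>n. \<forall>j. integrable (M n) (\<lambda>\<omega>. Z n \<omega> ^ j)) sequentially"
    and a: "filterlim a at_top sequentially"
    and mgf: "\<And>t. gaussian_trunc_mgf M Z a t"
  shows "moderate_deviation_principle M (\<lambda>n \<omega>. Z n \<omega> / a n) (\<lambda>n. (a n)\<^sup>2) (\<lambda>x. ereal (x\<^sup>2 / 2))"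
proof -
  have a_sq: "filterlim (\<lambda>n. (a n)\<^sup>2) at_top sequentially"
    by (rule filterlim_pow_at_top [OF _ a]) simp
  note a1 = speed_ge_1 [OF a]
  have intm: "eventually (\<lambda>n. \<forall>j. integrable (M n) (\<lambda>\<omega>. (- Z n \<omega>) ^ j)) sequentially"
    using int
  proof eventually_elim
    case (elim n)
    have "integrable (M n) (\<lambda>\<omega>. (- 1) ^ j * Z n \<omega> ^ j)" for j
      using elim by (intro integrable_mult_right) auto
    then show ?case by (simp flip: power_mult_distrib)
  qed
  have mgfm: "gaussian_trunc_mgf M (\<lambda>n \<omega>. - Z n \<omega>) a t" for t
    by (simp add: gaussian_trunc_mgf_uminus mgf)
  have up: "eventually (\<lambda>n. measure (M n) {\<omega> \<in> space (M n). x * a n \<le> \<bar>Z n \<omega>\<bar>}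
           \<le> 4 * exp ((- x\<^sup>2 / 2 + \<eta>) * (a n)\<^sup>2)) sequentially" if "0 < x" "0 < \<eta>" for x \<eta>
    using moderate_upper_tail [OF ps int a mgf that] moderate_upper_tail [OF ps intm a mgfm that] ps int
  proof eventually_elim
    case (elim n)
    interpret prob_space "M n" using elim by simp
    have meas: "Z n \<in> borel_measurable (M n)"
      using spec [OF elim(4), of 1] by (simp add: borel_measurable_integrable)
    have "prob {\<omega> \<in> space (M n). x * a n \<le> \<bar>Z n \<omega>\<bar>}
       \<le> prob ({\<omega> \<in> space (M n). x * a n \<le> Z n \<omega>} \<union> {\<omega> \<in> space (M n). x * a n \<le> - Z n \<omega>})"
      by (rule finite_measure_mono) (auto simp: abs_if split: if_splits intro!: sets.Un, use meas in measurable)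
    also have "\<dots> \<le> prob {\<omega> \<in> space (M n). x * a n \<le> Z n \<omega>} + prob {\<omega> \<in> space (M n). x * a n \<le> - Z n \<omega>}"
      by (rule measure_Un_le) (use meas in measurable)
    finally show ?case using elim by simp
  qed
  have ball: "eventually (\<lambda>n. exp (- (x\<^sup>2 / 2 + \<eta>) * (a n)\<^sup>2)
     \<le> measure (M n) {\<omega> \<in> space (M n). \<bar>Z n \<omega> / a n - x\<bar> < \<delta>}) sequentially" if "0 < \<delta>" "0 < \<eta>" for x \<delta> \<eta>
  proof -
    consider "0 < x" | "x = 0" | "x < 0" by linarith
    then show ?thesis
    proof cases
      case 1
      show ?thesis by (rule moderate_ball_lower [OF ps int a mgf 1 that])
    next
      case 2
      show ?thesis using moderate_ball_lower_0 [OF ps int a up that] 2 by simp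
    next
      case 3
      then have "0 < - x" by simp
      from moderate_ball_lower [OF ps intm a mgfm this that]
      have "eventually (\<lambda>n. exp (- (x\<^sup>2 / 2 + \<eta>) * (a n)\<^sup>2)
        \<le> measure (M n) {\<omega> \<in> space (M n). \<bar>- Z n \<omega> / a n - - x\<bar> < \<delta>}) sequentially" by simp
      moreover have "\<bar>- Z n \<omega> / a n - - x\<bar> = \<bar>Z n \<omega> / a n - x\<bar>" for n \<omega>
        by (simp add: abs_minus_commute)
      ultimately show ?thesis by simp
    qed
  qed
  show ?thesis
    unfolding moderate_deviation_principle_def Let_def
  proof (intro conjI ballI a_sq)
    fix B :: "real set" assume B: "B \<in> sets borel"
    define P where "P n = measure (M n) {\<omega> \<in> space (M n). Z n \<omega> / a n \<in> B}" for n
    define r where "r n = ereal (1 / (a n)\<^sup>2) * ln_ereal (P n)" for n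
    have r_le: "r n \<le> ereal c" if "P n \<le> exp (c * (a n)\<^sup>2)" "1 \<le> a n" for n c
    proof (cases "P n \<le> 0")
      case True
      then show ?thesis using that by (simp add: r_def ln_ereal_def)
    next
      case False
      then have "ln (P n) \<le> c * (a n)\<^sup>2"
        using that by (simp add: ln_le_cancel_iff [symmetric] del: ln_le_cancel_iff)
      then have "ln (P n) / (a n)\<^sup>2 \<le> c" using that by (simp add: pos_divide_le_eq)
      then show ?thesis using False by (simp add: r_def ln_ereal_def)
    qed
    have r_ge: "ereal c \<le> r n" if "exp (c * (a n)\<^sup>2) \<le> P n" "1 \<le> a n" for n c
    proof -
      have pos: "0 < P n" using that(1) by (meson exp_gt_zero less_le_trans)
      then have "c * (a n)\<^sup>2 \<le> ln (P n)"
        using that by (simp add: ln_ge_iff)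
      then have "c \<le> ln (P n) / (a n)\<^sup>2" using that by (simp add: pos_le_divide_eq)
      then show ?thesis using pos by (simp add: r_def ln_ereal_def)
    qed
    have lower: "- (INF x\<in>interior B. ereal (x\<^sup>2 / 2)) \<le> liminf r"
    proof (subst ereal_uminus_le_reorder, rule INF_greatest)
      fix x assume "x \<in> interior B"
      then obtain \<delta> where \<delta>: "0 < \<delta>" "ball x \<delta> \<subseteq> B"
        by (meson mem_interior)
      have *: "ereal (- x\<^sup>2 / 2) - ereal \<eta> \<le> liminf r" if \<eta>: "0 < \<eta>" for \<eta>
      proof (rule Liminf_bounded)
        show "eventually (\<lambda>n. ereal (- x\<^sup>2 / 2) - ereal \<eta> \<le> r n) sequentially"
          using ball [OF \<delta>(1) \<eta>, of x] a1 ps int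
        proof eventually_elim
          case (elim n)
          interpret prob_space "M n" using elim by simp
          have meas: "Z n \<in> borel_measurable (M n)"
            using spec [OF elim(4), of 1] by (simp add: borel_measurable_integrable)
          have "prob {\<omega> \<in> space (M n). \<bar>Z n \<omega> / a n - x\<bar> < \<delta>} \<le> P n"
            unfolding P_def
          proof (rule finite_measure_mono)
            show "{\<omega> \<in> space (M n). Z n \<omega> / a n \<in> B} \<in> events" using meas B by measurable
            show "{\<omega> \<in> space (M n). \<bar>Z n \<omega> / a n - x\<bar> < \<delta>} \<subseteq> {\<omega> \<in> space (M n). Z n \<omega> / a n \<in> B}"
              using \<delta>(2) by (auto simp: subset_eq dist_real_def abs_minus_commute)
          qed
          with elim have "exp ((- x\<^sup>2 / 2 - \<eta>) * (a n)\<^sup>2) \<le> P n" by simp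
          from r_ge [OF this] show ?case using elim by simp
        qed
      qed
      have **: "ereal (- x\<^sup>2 / 2) \<le> liminf r + ereal \<eta>" if "0 < \<eta>" for \<eta>
        by (rule iffD1 [OF ereal_minus_le, OF _ * [OF that]]) simp
      have "ereal (- x\<^sup>2 / 2) \<le> liminf r"
        by (rule ereal_le_epsilon2) (rule **)
      then show "- liminf r \<le> ereal (x\<^sup>2 / 2)"
        by (subst ereal_uminus_le_reorder) simp
    qed
    have upper: "limsup r \<le> - (INF x\<in>closure B. ereal (x\<^sup>2 / 2))"
    \<comment> \<open>For empty B the logarithm is - \<infinity> by \<open>ln_ereal\<close>, which
      matches the infimum \<infinity> over the empty set.\<close>
    proof (cases "closure B = {}")
      case True
      then have "B = {}" by simp
      then have "P n = 0" for n by (simp add: P_def)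
      then have "r n \<le> ereal c" if "1 \<le> a n" for n c
        using that by (simp add: r_def ln_ereal_def)
      then have "limsup r \<le> ereal c" for c
        using a1 by (intro Limsup_bounded) (auto elim: eventually_mono)
      then have "limsup r = - \<infinity>"
        by (metis ereal_bot)
      then show ?thesis by simp
    next
      case False
      \<comment> \<open>A point of the closure nearest to 0: B lies in {|x| \<ge> |y|}, and the
        infimum of the rate function over the closure is at most y^2 / 2.\<close>
      obtain y where y: "y \<in> closure B" "\<And>x. x \<in> closure B \<Longrightarrow> dist 0 y \<le> dist 0 x"
        using distance_attains_inf [OF closed_closure False] by blast
      have "limsup r \<le> ereal (- y\<^sup>2 / 2)"
      proof (rule ereal_le_epsilon2)
        fix \<eta> :: real assume \<eta>: "0 < \<eta>"
        show "limsup r \<le> ereal (- y\<^sup>2 / 2) + ereal \<eta>"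
        proof (rule Limsup_bounded)
          show "eventually (\<lambda>n. r n \<le> ereal (- y\<^sup>2 / 2) + ereal \<eta>) sequentially"
          proof (cases "y = 0")
            case True
            show ?thesis
              using a1 ps
            proof eventually_elim
              case (elim n)
              interpret prob_space "M n" using elim by simp
              have "P n \<le> 1" unfolding P_def by simp
              also have "1 \<le> exp ((- y\<^sup>2 / 2 + \<eta>) * (a n)\<^sup>2)" using True \<eta> by simp
              finally show ?case using r_le elim by simp
            qed
          next
            case False
            then have ypos: "0 < \<bar>y\<bar>" by simp
            have \<eta>2: "0 < \<eta> / 2" using \<eta> by simp
            note big = speed_sq_large [OF a \<eta>2, of "ln 4"]
            show ?thesis
              using up [OF ypos \<eta>2] big a1 ps int
            proof eventually_elim
              case (elim n)
              interpret prob_space "M n" using elim by simp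
              have meas: "Z n \<in> borel_measurable (M n)"
                using spec [OF elim(5), of 1] by (simp add: borel_measurable_integrable)
              have "P n \<le> prob {\<omega> \<in> space (M n). \<bar>y\<bar> * a n \<le> \<bar>Z n \<omega>\<bar>}"
                unfolding P_def
              proof (rule finite_measure_mono)
                show "{\<omega> \<in> space (M n). \<bar>y\<bar> * a n \<le> \<bar>Z n \<omega>\<bar>} \<in> events" using meas by measurable
                show "{\<omega> \<in> space (M n). Z n \<omega> / a n \<in> B} \<subseteq> {\<omega> \<in> space (M n). \<bar>y\<bar> * a n \<le> \<bar>Z n \<omega>\<bar>}"
                proof clarify
                  fix \<omega> assume "Z n \<omega> / a n \<in> B"
                  then have "dist 0 y \<le> dist 0 (Z n \<omega> / a n)"
                    using y(2) closure_subset by blast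
                  then show "\<bar>y\<bar> * a n \<le> \<bar>Z n \<omega>\<bar>"
                    using elim by (simp add: abs_divide pos_le_divide_eq)
                qed
              qed
              also have "\<dots> \<le> 4 * exp ((- y\<^sup>2 / 2 + \<eta> / 2) * (a n)\<^sup>2)" using elim by simp
              also have "\<dots> = exp (ln 4 + (- y\<^sup>2 / 2 + \<eta> / 2) * (a n)\<^sup>2)" by (simp add: exp_add)
              also have "\<dots> \<le> exp ((- y\<^sup>2 / 2 + \<eta>) * (a n)\<^sup>2)"
                using elim(2) by (simp add: algebra_simps)
              finally show ?case using r_le elim by simp
            qed
          qed
        qed
      qed
      also have "ereal (- y\<^sup>2 / 2) \<le> - (INF x\<in>closure B. ereal (x\<^sup>2 / 2))"
      proof -
        have "(INF x\<in>closure B. ereal (x\<^sup>2 / 2)) \<le> ereal (y\<^sup>2 / 2)"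
          by (rule INF_lower) fact
        then have "- ereal (y\<^sup>2 / 2) \<le> - (INF x\<in>closure B. ereal (x\<^sup>2 / 2))"
          by (simp only: ereal_minus_le_minus)
        then show ?thesis by simp
      qed
      finally show ?thesis .
    qed
    show "- (INF x\<in>interior B. ereal (x\<^sup>2 / 2)) \<le> liminf (\<lambda>n. ereal (1 / (a n)\<^sup>2) *
        ln_ereal (measure (M n) {\<omega> \<in> space (M n). Z n \<omega> / a n \<in> B}))"
      using lower unfolding r_def [abs_def] P_def .
    show "limsup (\<lambda>n. ereal (1 / (a n)\<^sup>2) *
        ln_ereal (measure (M n) {\<omega> \<in> space (M n). Z n \<omega> / a n \<in> B})) \<le> - (INF x\<in>closure B. ereal (x\<^sup>2 / 2))"
      using upper unfolding r_def [abs_def] P_def .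
  qed (rule Liminf_le_Limsup, simp)
qed

section \<open>Joint cumulants\<close>

text \<open>If \<open>F S\<close> is the mixed moment of random variables indexed by \<open>S\<close>, then \<open>joint_cumulant F S\<close>
  is their joint cumulant. The recursion singles out the block of \<open>Min S\<close>.\<close>

function joint_cumulant :: "('b::linorder set \<Rightarrow> real) \<Rightarrow> 'b set \<Rightarrow> real" where
  "joint_cumulant F S = (if finite S \<and> S \<noteq> {} then
     F S - (\<Sum>T\<in>{T. T \<subset> S \<and> Min S \<in> T}. joint_cumulant F T * F (S - T)) else 0)"
  by auto
termination
  by (relation "Wellfounded.measure (card \<circ> snd)") (auto intro: psubset_card_mono)

declare joint_cumulant.simps [simp del]

lemma joint_cumulant_empty [simp]: "joint_cumulant F {} = 0"
  by (simp add: joint_cumulant.simps)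

lemma joint_cumulant_rec:
  assumes "finite S" "S \<noteq> {}"
  shows "joint_cumulant F S = F S - (\<Sum>T\<in>{T. T \<subset> S \<and> Min S \<in> T}. joint_cumulant F T * F (S - T))"
  using assms by (subst joint_cumulant.simps) simp

lemma moment_joint_cumulant:
  assumes S: "finite S" "S \<noteq> {}" and F: "F {} = 1"
  shows "F S = (\<Sum>T\<in>{T. T \<subseteq> S \<and> Min S \<in> T}. joint_cumulant F T * F (S - T))"
proof -
  have fin: "finite {T. T \<subset> S \<and> Min S \<in> T}"
    by (rule finite_subset [of _ "Pow S"]) (use S in auto)
  have "{T. T \<subseteq> S \<and> Min S \<in> T} = insert S {T. T \<subset> S \<and> Min S \<in> T}"
    using Min_in [OF S] by auto
  then have "(\<Sum>T\<in>{T. T \<subseteq> S \<and> Min S \<in> T}. joint_cumulant F T * F (S - T))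
      = joint_cumulant F S + (\<Sum>T\<in>{T. T \<subset> S \<and> Min S \<in> T}. joint_cumulant F T * F (S - T))"
    using S F fin by simp
  then show ?thesis using joint_cumulant_rec [OF S, of F] by simp
qed

lemma joint_cumulant_cong:
  assumes "finite S" "\<And>T. T \<subseteq> S \<Longrightarrow> F T = G T"
  shows "joint_cumulant F S = joint_cumulant G S"
  using assms
proof (induction S rule: finite_psubset_induct)
  case (psubset S)
  show ?case
  proof (cases "S = {}")
    case False
    have "(\<Sum>T\<in>{T. T \<subset> S \<and> Min S \<in> T}. joint_cumulant F T * F (S - T))
        = (\<Sum>T\<in>{T. T \<subset> S \<and> Min S \<in> T}. joint_cumulant G T * G (S - T))"
    proof (rule sum.cong [OF refl])
      fix T assume "T \<in> {T. T \<subset> S \<and> Min S \<in> T}"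
      then have T: "T \<subset> S" by simp
      then have "joint_cumulant F T = joint_cumulant G T"
        using psubset.prems by (intro psubset.IH) auto
      moreover have "F (S - T) = G (S - T)" by (rule psubset.prems) auto
      ultimately show "joint_cumulant F T * F (S - T) = joint_cumulant G T * G (S - T)" by simp
    qed
    then show ?thesis
      using psubset.prems [of S] by (simp add: joint_cumulant_rec [OF psubset.hyps(1) False])
  qed simp
qed

text \<open>Induction over S. Let C be the side containing Min S and D the other one. In the
  recursion, the proper subsets T meeting D have cumulant 0 by induction; the others lie in S
  \<inter> C, and there F (S - T) splits off F (S \<inter> D). What is left is the moment formula
  for S \<inter> C, so the sum equals F (S \<inter> C) F (S \<inter> D) = F S and nothing
  remains.\<close>

lemma joint_cumulant_split_eq_0:
  assumes S: "finite S" and F0: "F {} = 1" and AB: "A \<inter> B = {}"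
    and split: "\<And>T. T \<subseteq> A \<union> B \<Longrightarrow> F T = F (T \<inter> A) * F (T \<inter> B)"
    and "S \<subseteq> A \<union> B" "S \<inter> A \<noteq> {}" "S \<inter> B \<noteq> {}"
  shows "joint_cumulant F S = 0"
  using S assms(5-7)
proof (induction S rule: finite_psubset_induct)
  case (psubset S)
  then have S: "finite S" "S \<noteq> {}" by auto
  define C where "C = (if Min S \<in> A then A else B)"
  define D where "D = (if Min S \<in> A then B else A)"
  have m: "Min S \<in> S" using S by (rule Min_in)
  with psubset.prems have mC: "Min S \<in> C" by (auto simp: C_def)
  have CD: "S \<subseteq> C \<union> D" "C \<inter> D = {}" "S \<inter> C \<noteq> {}" "S \<inter> D \<noteq> {}"
    using psubset.prems AB by (auto simp: C_def D_def)
  have splitCD: "F T = F (T \<inter> C) * F (T \<inter> D)" if "T \<subseteq> S" for T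
    using split [of T] that psubset.prems by (auto simp: C_def D_def)
  have van: "joint_cumulant F T = 0" if "T \<subset> S" "T \<inter> C \<noteq> {}" "T \<inter> D \<noteq> {}" for T
    using that psubset.prems by (intro psubset.IH) (auto simp: C_def D_def split: if_splits)
  have minC: "Min (S \<inter> C) = Min S"
    using S m mC by (intro Min_eqI) auto
  have "(\<Sum>T\<in>{T. T \<subset> S \<and> Min S \<in> T}. joint_cumulant F T * F (S - T))
     = (\<Sum>T\<in>{T. T \<subseteq> S \<inter> C \<and> Min S \<in> T}. joint_cumulant F T * F (S - T))"
  proof (rule sum.mono_neutral_right)
    show "finite {T. T \<subset> S \<and> Min S \<in> T}"
      by (rule finite_subset [of _ "Pow S"]) (use S in auto)
    show "{T. T \<subseteq> S \<inter> C \<and> Min S \<in> T} \<subseteq> {T. T \<subset> S \<and> Min S \<in> T}"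
      using CD by auto
    show "\<forall>T\<in>{T. T \<subset> S \<and> Min S \<in> T} - {T. T \<subseteq> S \<inter> C \<and> Min S \<in> T}. joint_cumulant F T * F (S - T) = 0"
    proof
      fix T assume "T \<in> {T. T \<subset> S \<and> Min S \<in> T} - {T. T \<subseteq> S \<inter> C \<and> Min S \<in> T}"
      then have "T \<subset> S" "T \<inter> C \<noteq> {}" "T \<inter> D \<noteq> {}"
        using mC CD by auto
      then show "joint_cumulant F T * F (S - T) = 0" by (simp add: van)
    qed
  qed
  also have "\<dots> = (\<Sum>T\<in>{T. T \<subseteq> S \<inter> C \<and> Min S \<in> T}. joint_cumulant F T * F (S \<inter> C - T) * F (S \<inter> D))"
  proof (rule sum.cong [OF refl])
    fix T assume T: "T \<in> {T. T \<subseteq> S \<inter> C \<and> Min S \<in> T}"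
    then have "(S - T) \<inter> C = S \<inter> C - T" "(S - T) \<inter> D = S \<inter> D" using CD by auto
    then show "joint_cumulant F T * F (S - T) = joint_cumulant F T * F (S \<inter> C - T) * F (S \<inter> D)"
      using splitCD [of "S - T"] by simp
  qed
  also have "\<dots> = F (S \<inter> C) * F (S \<inter> D)"
    using moment_joint_cumulant [of "S \<inter> C" F] S CD F0 by (simp add: minC sum_distrib_right)
  also have "\<dots> = F S" using splitCD [of S] by simp
  finally show ?case by (simp add: joint_cumulant_rec [OF S])
qed

lemma sum_subsets_card:
  fixes h :: "nat \<Rightarrow> real"
  assumes "finite A"
  shows "(\<Sum>T\<in>Pow A. h (card T)) = (\<Sum>i\<le>card A. real (card A choose i) * h i)"
proof -
  have "(\<Sum>T\<in>Pow A. h (card T)) = (\<Sum>i\<le>card A. \<Sum>T\<in>{T \<in> Pow A. card T = i}. h (card T))"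
    using assms by (intro sum.group [symmetric]) (auto intro: card_mono)
  also have "\<dots> = (\<Sum>i\<le>card A. real (card A choose i) * h i)"
  proof (rule sum.cong [OF refl])
    fix i
    have "card {T \<in> Pow A. card T = i} = (card A choose i)"
      using n_subsets [OF assms, of i] by simp
    then show "(\<Sum>T\<in>{T \<in> Pow A. card T = i}. h (card T)) = real (card A choose i) * h i"
      by simp
  qed
  finally show ?thesis .
qed

lemma sum_psubsets_with_element:
  fixes g :: "nat \<Rightarrow> real"
  assumes S: "finite S" "s \<in> S" and c: "card S = Suc c"
  shows "(\<Sum>T\<in>{T. T \<subset> S \<and> s \<in> T}. g (card T)) = (\<Sum>i<c. real (c choose i) * g (Suc i))"
proof -
  have fin: "finite (S - {s})" and card: "card (S - {s}) = c" using S c by simp_all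
  have "(\<Sum>T\<in>{T. T \<subset> S \<and> s \<in> T}. g (card T)) = (\<Sum>T\<in>Pow (S - {s}) - {S - {s}}. g (Suc (card T)))"
  proof (rule sum.reindex_bij_witness [where i = "insert s" and j = "\<lambda>T. T - {s}"])
    fix T assume "T \<in> {T. T \<subset> S \<and> s \<in> T}"
    then have "s \<in> T" "T \<subseteq> S" by auto
    then have "card T = Suc (card (T - {s}))"
      by (intro card.remove finite_subset [OF _ S(1)])
    then show "g (Suc (card (T - {s}))) = g (card T)" by simp
  qed (use S in auto)
  also have "\<dots> = (\<Sum>T\<in>Pow (S - {s}). g (Suc (card T))) - g (Suc c)"
    using fin card by (simp add: sum_diff1)
  also have "(\<Sum>T\<in>Pow (S - {s}). g (Suc (card T))) = (\<Sum>i\<le>c. real (c choose i) * g (Suc i))"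
    using sum_subsets_card [OF fin, of "\<lambda>i. g (Suc i)"] card by simp
  finally show ?thesis by (simp add: lessThan_Suc_atMost [symmetric])
qed

text \<open>In the recursion w T w (S - T) \<le> w S, so only the numerical factor has to be
  tracked. With card S = c + 1 the proper subsets contribute at most c (c + 1)^c and the term F S at
  most (c + 1)^c; together this is (c + 1)^(c + 1).\<close>

lemma joint_cumulant_bound:
  assumes S: "finite S"
    and F: "\<And>T. T \<subseteq> S \<Longrightarrow> \<bar>F T\<bar> \<le> w T"
    and w: "\<And>T U. T \<subseteq> S \<Longrightarrow> U \<subseteq> S \<Longrightarrow> T \<inter> U = {} \<Longrightarrow> w T * w U \<le> w (T \<union> U)"
  shows "\<bar>joint_cumulant F S\<bar> \<le> real (card S) ^ card S * w S"
  using S F w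
proof (induction S rule: finite_psubset_induct)
  case (psubset S)
  have w0: "0 \<le> w T" if "T \<subseteq> S" for T
    using psubset.prems(1) [OF that] by linarith
  show ?case
  proof (cases "S = {}")
    case True
    then show ?thesis using w0 [of S] by simp
  next
    case False
    define c where "c = card S - 1"
    have c: "card S = Suc c" using False psubset.hyps by (simp add: c_def card_gt_0_iff)
    have m: "Min S \<in> S" using False psubset.hyps by simp
    have "\<bar>joint_cumulant F S\<bar> \<le> \<bar>F S\<bar> + (\<Sum>T\<in>{T. T \<subset> S \<and> Min S \<in> T}. \<bar>joint_cumulant F T * F (S - T)\<bar>)"
      unfolding joint_cumulant_rec [OF psubset.hyps(1) False]
      using sum_abs [of "\<lambda>T. joint_cumulant F T * F (S - T)" "{T. T \<subset> S \<and> Min S \<in> T}"] by linarith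
    also have "(\<Sum>T\<in>{T. T \<subset> S \<and> Min S \<in> T}. \<bar>joint_cumulant F T * F (S - T)\<bar>)
        \<le> (\<Sum>T\<in>{T. T \<subset> S \<and> Min S \<in> T}. real c ^ card T * w S)"
    proof (rule sum_mono)
      fix T assume "T \<in> {T. T \<subset> S \<and> Min S \<in> T}"
      then have T: "T \<subset> S" by simp
      have "card T < card S" by (rule psubset_card_mono [OF psubset.hyps(1) T])
      then have cT: "card T \<le> c" using c by simp
      have "\<bar>joint_cumulant F T\<bar> \<le> real (card T) ^ card T * w T"
        using T psubset.prems by (intro psubset.IH) auto
      also have "\<dots> \<le> real c ^ card T * w T"
        using cT w0 [of T] T by (intro mult_right_mono power_mono) auto
      finally have "\<bar>joint_cumulant F T * F (S - T)\<bar> \<le> real c ^ card T * w T * w (S - T)"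
        unfolding abs_mult using T w0 [of T] psubset.prems(1) [of "S - T"] by (intro mult_mono) auto
      also have "\<dots> = real c ^ card T * (w T * w (S - T))" by simp
      also have "\<dots> \<le> real c ^ card T * w (T \<union> (S - T))"
        using T by (intro mult_left_mono psubset.prems(2)) auto
      also have "T \<union> (S - T) = S" using T by auto
      finally show "\<bar>joint_cumulant F T * F (S - T)\<bar> \<le> real c ^ card T * w S" .
    qed
    also have "\<dots> = (\<Sum>i<c. real (c choose i) * real c ^ Suc i) * w S"
      unfolding sum_psubsets_with_element [OF psubset.hyps(1) m c, of "\<lambda>i. real c ^ i", symmetric]
      by (rule sum_distrib_right [symmetric])
    also have "\<dots> \<le> (real c * (real c + 1) ^ c) * w S"
    proof (rule mult_right_mono)
      have "(\<Sum>i<c. real (c choose i) * real c ^ Suc i) \<le> (\<Sum>i\<le>c. real (c choose i) * real c ^ Suc i)"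
        by (rule sum_mono2) auto
      also have "\<dots> = real c * (real c + 1) ^ c"
        by (simp add: binomial_ring sum_distrib_left mult_ac)
      finally show "(\<Sum>i<c. real (c choose i) * real c ^ Suc i) \<le> real c * (real c + 1) ^ c" .
    qed (use w0 in auto)
    also have "\<bar>F S\<bar> \<le> (real c + 1) ^ c * w S"
    proof -
      have "1 * w S \<le> (real c + 1) ^ c * w S" using w0 by (intro mult_right_mono one_le_power) auto
      then show ?thesis using psubset.prems(1) [of S] by simp
    qed
    finally have "\<bar>joint_cumulant F S\<bar> \<le> (real c * (real c + 1) ^ c + (real c + 1) ^ c) * w S"
      by (simp add: distrib_right)
    also have "real c * (real c + 1) ^ c + (real c + 1) ^ c = real (card S) ^ card S"
      by (simp only: c power_Suc of_nat_Suc distrib_right mult_1 add.commute [of 1])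
    finally show ?thesis .
  qed
qed

lemma sum_PiE_split:
  fixes g h :: "('b \<Rightarrow> 'i) \<Rightarrow> real"
  assumes "T \<subseteq> S"
  shows "(\<Sum>\<alpha>\<in>S \<rightarrow>\<^sub>E I. g (restrict \<alpha> T) * h (restrict \<alpha> (S - T)))
    = (\<Sum>\<alpha>\<in>T \<rightarrow>\<^sub>E I. g \<alpha>) * (\<Sum>\<alpha>\<in>(S - T) \<rightarrow>\<^sub>E I. h \<alpha>)"
proof -
  have "(\<Sum>\<alpha>\<in>T \<rightarrow>\<^sub>E I. g \<alpha>) * (\<Sum>\<alpha>\<in>(S - T) \<rightarrow>\<^sub>E I. h \<alpha>)
      = (\<Sum>p\<in>(T \<rightarrow>\<^sub>E I) \<times> ((S - T) \<rightarrow>\<^sub>E I). g (fst p) * h (snd p))"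
    by (simp add: sum_product sum.cartesian_product case_prod_unfold)
  also have "\<dots> = (\<Sum>\<alpha>\<in>S \<rightarrow>\<^sub>E I. g (restrict \<alpha> T) * h (restrict \<alpha> (S - T)))"
  proof (rule sum.reindex_bij_witness [where i = "\<lambda>\<alpha>. (restrict \<alpha> T, restrict \<alpha> (S - T))"
        and j = "\<lambda>p i. if i \<in> T then fst p i else snd p i"])
    fix p assume p: "p \<in> (T \<rightarrow>\<^sub>E I) \<times> ((S - T) \<rightarrow>\<^sub>E I)"
    let ?q = "\<lambda>i. if i \<in> T then fst p i else snd p i"
    have 1: "restrict ?q T = fst p" and 2: "restrict ?q (S - T) = snd p"
      using p by (auto simp: fun_eq_iff restrict_def PiE_def extensional_def mem_Times_iff)
    show "(restrict ?q T, restrict ?q (S - T)) = p" by (simp add: 1 2)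
    show "g (restrict ?q T) * h (restrict ?q (S - T)) = g (fst p) * h (snd p)" by (simp add: 1 2)
    show "?q \<in> S \<rightarrow>\<^sub>E I"
      using p assms by (auto simp: PiE_def extensional_def mem_Times_iff Pi_def)
  next
    fix \<alpha> assume \<alpha>: "\<alpha> \<in> S \<rightarrow>\<^sub>E I"
    show "(\<lambda>i. if i \<in> T then fst (restrict \<alpha> T, restrict \<alpha> (S - T)) i
        else snd (restrict \<alpha> T, restrict \<alpha> (S - T)) i) = \<alpha>"
      using \<alpha> assms by (auto simp: fun_eq_iff restrict_def PiE_def extensional_def)
    show "(restrict \<alpha> T, restrict \<alpha> (S - T)) \<in> (T \<rightarrow>\<^sub>E I) \<times> ((S - T) \<rightarrow>\<^sub>E I)"
      using \<alpha> assms by (auto simp: PiE_def Pi_def)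
  qed
  finally show ?thesis ..
qed

text \<open>Multilinearity: the cumulant of a sum is the sum of the joint cumulants of its summands,
  f \<alpha> S being the mixed moment of the summands chosen by \<alpha>. As f \<alpha> T depends on
  \<alpha> only through its restriction to T, sums over \<alpha> factorize along T and S - T, and
  the recursion of \<open>joint_cumulant\<close> turns into that of
  \<open>cumulants\<close>.\<close>

lemma sum_joint_cumulants:
  fixes f :: "('b::linorder \<Rightarrow> 'i) \<Rightarrow> 'b set \<Rightarrow> real"
  assumes f0: "\<And>\<alpha>. f \<alpha> {} = 1"
    and local: "\<And>\<alpha> T. f \<alpha> T = f (restrict \<alpha> T) T"
    and tot: "\<And>S. finite S \<Longrightarrow> (\<Sum>\<alpha>\<in>S \<rightarrow>\<^sub>E I. f \<alpha> S) = m (card S)"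
    and S: "finite S"
  shows "(\<Sum>\<alpha>\<in>S \<rightarrow>\<^sub>E I. joint_cumulant (f \<alpha>) S) = cumulants m (card S)"
  using S
proof (induction S rule: finite_psubset_induct)
  case (psubset S)
  show ?case
  proof (cases "S = {}")
    case False
    define c where "c = card S - 1"
    have c: "card S = Suc c" using False psubset.hyps by (simp add: c_def card_gt_0_iff)
    have min: "Min S \<in> S" using False psubset.hyps by simp
    have jc_local: "joint_cumulant (f \<alpha>) T = joint_cumulant (f (restrict \<alpha> T)) T" if "finite T" for \<alpha> T
    proof (rule joint_cumulant_cong [OF that])
      fix U assume "U \<subseteq> T"
      then have "restrict (restrict \<alpha> T) U = restrict \<alpha> U" by (simp add: Int_absorb1)
      then show "f \<alpha> U = f (restrict \<alpha> T) U" using local by metis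
    qed
    have "(\<Sum>\<alpha>\<in>S \<rightarrow>\<^sub>E I. joint_cumulant (f \<alpha>) S) =
        (\<Sum>\<alpha>\<in>S \<rightarrow>\<^sub>E I. f \<alpha> S) -
        (\<Sum>T\<in>{T. T \<subset> S \<and> Min S \<in> T}. \<Sum>\<alpha>\<in>S \<rightarrow>\<^sub>E I. joint_cumulant (f \<alpha>) T * f \<alpha> (S - T))"
      by (subst sum.swap) (simp add: joint_cumulant_rec [OF psubset.hyps(1) False] sum_subtractf)
    also have "(\<Sum>\<alpha>\<in>S \<rightarrow>\<^sub>E I. f \<alpha> S) = m (Suc c)"
      using tot psubset.hyps c by simp
    also have "(\<Sum>T\<in>{T. T \<subset> S \<and> Min S \<in> T}. \<Sum>\<alpha>\<in>S \<rightarrow>\<^sub>E I. joint_cumulant (f \<alpha>) T * f \<alpha> (S - T))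
        = (\<Sum>T\<in>{T. T \<subset> S \<and> Min S \<in> T}. cumulants m (card T) * m (Suc c - card T))"
    proof (rule sum.cong [OF refl])
      fix T assume "T \<in> {T. T \<subset> S \<and> Min S \<in> T}"
      then have T: "T \<subset> S" "T \<subseteq> S" by auto
      have finT: "finite T" using T psubset.hyps by (auto intro: finite_subset)
      have "(\<Sum>\<alpha>\<in>S \<rightarrow>\<^sub>E I. joint_cumulant (f \<alpha>) T * f \<alpha> (S - T))
          = (\<Sum>\<alpha>\<in>S \<rightarrow>\<^sub>E I. joint_cumulant (f (restrict \<alpha> T)) T * f (restrict \<alpha> (S - T)) (S - T))"
        using jc_local [OF finT] local by (intro sum.cong) auto
      also have "\<dots> = (\<Sum>\<alpha>\<in>T \<rightarrow>\<^sub>E I. joint_cumulant (f \<alpha>) T) * (\<Sum>\<alpha>\<in>(S - T) \<rightarrow>\<^sub>E I. f \<alpha> (S - T))"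
        by (rule sum_PiE_split [OF T(2), of "\<lambda>\<alpha>. joint_cumulant (f \<alpha>) T" "\<lambda>\<alpha>. f \<alpha> (S - T)"])
      also have "\<dots> = cumulants m (card T) * m (Suc c - card T)"
        using psubset.IH [OF T(1)] tot [of "S - T"] psubset.hyps T finT c by (simp add: card_Diff_subset)
      finally show "(\<Sum>\<alpha>\<in>S \<rightarrow>\<^sub>E I. joint_cumulant (f \<alpha>) T * f \<alpha> (S - T)) = cumulants m (card T) * m (Suc c - card T)" .
    qed
    also have "\<dots> = (\<Sum>i<c. real (c choose i) * (cumulants m (Suc i) * m (Suc c - Suc i)))"
      by (rule sum_psubsets_with_element [OF psubset.hyps(1) min c])
    also have "m (Suc c) - \<dots> = cumulants m (card S)"
      unfolding c cumulants.simps(2) [of m c] by (simp add: mult.assoc)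
    finally show ?thesis .
  qed simp
qed

section \<open>Overlapping copies of a strongly balanced graph\<close>

definition embeddings :: "nat set \<Rightarrow> nat \<Rightarrow> (nat \<Rightarrow> nat) set" where
  "embeddings V n = {\<beta> \<in> V \<rightarrow>\<^sub>E {1..n}. inj_on \<beta> V}"

definition copy_edges :: "nat set set \<Rightarrow> (nat \<Rightarrow> nat) \<Rightarrow> nat set set" where
  "copy_edges E \<beta> = (\<lambda>e. \<beta> ` e) ` E"

lemma finite_embeddings: "finite V \<Longrightarrow> finite (embeddings V n)"
  unfolding embeddings_def by (rule finite_subset [of _ "V \<rightarrow>\<^sub>E {1..n}"]) (auto intro: finite_PiE)

lemma finite_all_edges: "finite V \<Longrightarrow> finite (all_edges V)"
  unfolding all_edges_def by simp

lemma Union_copy_edges: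
  assumes "simple_graph V E" shows "\<Union> (copy_edges E \<beta>) \<subseteq> \<beta> ` V"
  using assms unfolding copy_edges_def simple_graph_def all_edges_def by blast

lemma copy_edges_subset:
  assumes G: "simple_graph V E" and \<beta>: "\<beta> \<in> embeddings V n"
  shows "copy_edges E \<beta> \<subseteq> all_edges {1..n}"
proof
  fix e' assume "e' \<in> copy_edges E \<beta>"
  then obtain e where e: "e \<in> E" "e' = \<beta> ` e" by (auto simp: copy_edges_def)
  then have "e \<subseteq> V" "card e = 2" using G by (auto simp: simple_graph_def all_edges_def)
  then have "card e' = 2" "e' \<subseteq> {1..n}"
    using e \<beta> card_image [of \<beta> e] by (auto simp: embeddings_def intro: inj_on_subset)
  then show "e' \<in> all_edges {1..n}" by (simp add: all_edges_def)
qed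

lemma inj_on_image_edges:
  assumes "simple_graph V E" "\<beta> \<in> embeddings V n"
  shows "inj_on (\<lambda>e. \<beta> ` e) E"
proof (rule inj_onI)
  fix e f assume "e \<in> E" "f \<in> E" and eq: "\<beta> ` e = \<beta> ` f"
  then have "e \<subseteq> V" "f \<subseteq> V" using assms by (auto simp: simple_graph_def all_edges_def)
  then show "e = f" using eq assms(2) inj_on_image_eq_iff unfolding embeddings_def by blast
qed

lemma card_copy_edges:
  assumes "simple_graph V E" "\<beta> \<in> embeddings V n"
  shows "card (copy_edges E \<beta>) = card E"
  unfolding copy_edges_def by (rule card_image [OF inj_on_image_edges [OF assms]])

text \<open>The density condition with denominators cleared. A single vertex, about which strong
  balance says nothing, carries no edge, so every nonempty V' is covered.\<close>

lemma strongly_balanced_subgraph: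
  assumes bal: "strongly_balanced V E" and V: "finite V" "2 \<le> card V"
    and sub: "V' \<subseteq> V" "E' \<subseteq> E" "E' \<subseteq> all_edges V'" "V' \<noteq> {}"
  shows "card E' * (card V - 1) \<le> (card V' - 1) * card E"
proof (cases "2 \<le> card V'")
  case True
  have fin: "finite V'" using sub(1) V(1) by (rule finite_subset)
  then have "real (card E') / (real (card V') - 1) \<le> real (card E) / (real (card V) - 1)"
    using bal sub True unfolding strongly_balanced_def simple_graph_def by blast
  then have "real (card E') * (real (card V) - 1) \<le> real (card E) * (real (card V') - 1)"
    using True V by (simp add: field_simps)
  then have "real (card E' * (card V - 1)) \<le> real ((card V' - 1) * card E)"
    using True V by (simp add: of_nat_diff mult.commute)
  then show ?thesis by (simp only: of_nat_le_iff)
next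
  case False
  have "all_edges V' = {}"
  proof -
    have "finite V'" using sub(1) V(1) by (rule finite_subset)
    then have "card e < 2" if "e \<subseteq> V'" for e using card_mono [OF _ that] False by simp
    then show ?thesis unfolding all_edges_def by (auto dest: less_imp_neq)
  qed
  then show ?thesis using sub by simp
qed

text \<open>In terms of expected counts: no nonempty subgraph is rarer than the rarer of a single vertex
  and the whole graph.\<close>

lemma balanced_weight:
  fixes x p :: real
  assumes x: "1 \<le> x" and p: "0 < p" "p \<le> 1" and k: "2 \<le> k" and h: "1 \<le> h" "h \<le> k"
    and e: "e' * (k - 1) \<le> (h - 1) * e"
  shows "min x (x ^ k * p ^ e) \<le> x ^ h * p ^ e'"
proof -
  obtain c where c: "k = Suc c" "1 \<le> c" using k by (cases k) auto
  obtain i where i: "h = Suc i" "i \<le> c" using h c by (cases h) auto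
  \<comment> \<open>Balance says q^(h - 1) \<le> y^(k - 1). Hence y \<ge> 1 if q \<ge> 1, and y
    \<ge> q otherwise; multiplying by x gives the claim.\<close>
  define q where "q = x ^ c * p ^ e"
  define y where "y = x ^ i * p ^ e'"
  have q: "0 < q" and y: "0 < y" using x p by (simp_all add: q_def y_def)
  have "q ^ i = x ^ (i * c) * p ^ (i * e)"
    by (simp add: q_def power_mult_distrib power_mult [symmetric] mult.commute)
  also have "\<dots> \<le> x ^ (i * c) * p ^ (e' * c)"
    using e c i x p by (intro mult_left_mono power_decreasing) auto
  also have "\<dots> = y ^ c"
    by (simp add: y_def power_mult_distrib power_mult)
  finally have qy: "q ^ i \<le> y ^ c" .
  have "min 1 q \<le> y"
  proof (cases "1 \<le> q")
    case True
    then have "1 ^ c \<le> y ^ c" using order_trans [OF one_le_power [OF True, of i] qy] by simp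
    then have "1 \<le> y" using y c by (subst (asm) power_mono_iff) auto
    then show ?thesis by simp
  next
    case False
    then have "q ^ c \<le> q ^ i" using q i by (intro power_decreasing) auto
    then have "q ^ c \<le> y ^ c" using qy by simp
    then have "q \<le> y" using q y c by (subst (asm) power_mono_iff) auto
    then show ?thesis by simp
  qed
  then have "x * min 1 q \<le> x * y" using x by (intro mult_left_mono) auto
  moreover have "x * min 1 q = min x (x ^ k * p ^ e)"
    using x by (simp add: min_mult_distrib_left q_def c)
  moreover have "x * y = x ^ h * p ^ e'" by (simp add: y_def i)
  ultimately show ?thesis by simp
qed

lemma connected_family_weight:
  fixes \<alpha> :: "'b \<Rightarrow> nat \<Rightarrow> nat" and p x :: real
  assumes G: "simple_graph V E" "strongly_balanced V E" "2 \<le> card V"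
    and x: "1 \<le> x" and p: "0 < p" "p \<le> 1"
    and S: "finite S" "S \<noteq> {}" and \<alpha>: "\<And>i. i \<in> S \<Longrightarrow> \<alpha> i \<in> embeddings V n"
    and conn: "\<And>A B. A \<union> B = S \<Longrightarrow> A \<inter> B = {} \<Longrightarrow> A \<noteq> {} \<Longrightarrow> B \<noteq> {} \<Longrightarrow>
      (\<Union>i\<in>A. \<alpha> i ` V) \<inter> (\<Union>i\<in>B. \<alpha> i ` V) \<noteq> {}"
  shows "x ^ card (\<Union>i\<in>S. \<alpha> i ` V) * p ^ card (\<Union>i\<in>S. copy_edges E (\<alpha> i)) * min x (x ^ card V * p ^ card E) ^ (card S - 1)
    \<le> (x ^ card V * p ^ card E) ^ card S"
proof -
  define \<Phi> where "\<Phi> = min x (x ^ card V * p ^ card E)"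
  define Q where "Q = x ^ card V * p ^ card E"
  define v where "v T = card (\<Union>i\<in>T. \<alpha> i ` V)" for T
  define d where "d T = card (\<Union>i\<in>T. copy_edges E (\<alpha> i))" for T
  have finV: "finite V" using G by (simp add: simple_graph_def)
  have finE: "finite E" using G finite_all_edges finV finite_subset by (auto simp: simple_graph_def)
  have \<Phi>: "0 < \<Phi>" and Q: "0 < Q" using x p by (simp_all add: \<Phi>_def Q_def)
  have "\<exists>T\<subseteq>S. card T = Suc j \<and> x ^ v T * p ^ d T * \<Phi> ^ j \<le> Q ^ Suc j" if "Suc j \<le> card S" for j
    using that
  proof (induction j)
    case 0
    obtain i where i: "i \<in> S" using S by blast
    have "card (\<alpha> i ` V) = card V" "card (copy_edges E (\<alpha> i)) = card E"
      using \<alpha> [OF i] card_copy_edges [OF G(1) \<alpha> [OF i]] by (auto simp: embeddings_def card_image)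
    then have "x ^ v {i} * p ^ d {i} * \<Phi> ^ 0 \<le> Q ^ Suc 0"
      by (simp add: v_def d_def Q_def)
    then show ?case using i by (intro exI [of _ "{i}"]) auto
  next
    case (Suc j)
    then obtain T where T: "T \<subseteq> S" "card T = Suc j" and IH: "x ^ v T * p ^ d T * \<Phi> ^ j \<le> Q ^ Suc j"
      by auto
    have finT: "finite T" using T S finite_subset by blast
    have "T \<noteq> {}" "S - T \<noteq> {}" using T Suc.prems by auto
    then have "(\<Union>i\<in>T. \<alpha> i ` V) \<inter> (\<Union>i\<in>S - T. \<alpha> i ` V) \<noteq> {}"
      using T by (intro conn) auto
    then obtain b where b: "b \<in> S" "b \<notin> T" and meet: "(\<Union>i\<in>T. \<alpha> i ` V) \<inter> \<alpha> b ` V \<noteq> {}" by blast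
    let ?VT = "\<Union>i\<in>T. \<alpha> i ` V" and ?ET = "\<Union>i\<in>T. copy_edges E (\<alpha> i)"
    define V' where "V' = {u \<in> V. \<alpha> b u \<in> ?VT}"
    \<comment> \<open>The edges of the new copy that occur in the earlier ones, pulled back to G.
      They may stem from different earlier copies, and E' may be empty while V' is not.\<close>
    define E' where "E' = {e \<in> E. \<alpha> b ` e \<in> ?ET}"
    have inj: "inj_on (\<alpha> b) V" using \<alpha> [OF b(1)] by (simp add: embeddings_def)
    have injE: "inj_on (\<lambda>e. \<alpha> b ` e) E" by (rule inj_on_image_edges [OF G(1) \<alpha> [OF b(1)]])
    have V': "V' \<subseteq> V" "V' \<noteq> {}" using meet by (auto simp: V'_def)
    have E': "E' \<subseteq> E" by (auto simp: E'_def)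
    have E'V': "E' \<subseteq> all_edges V'"
    proof
      fix e assume e: "e \<in> E'"
      then have eE: "e \<in> E" and "\<alpha> b ` e \<in> ?ET" by (auto simp: E'_def)
      then obtain i where i: "i \<in> T" "\<alpha> b ` e \<in> copy_edges E (\<alpha> i)" by blast
      then have "\<alpha> b ` e \<subseteq> ?VT" using Union_copy_edges [OF G(1), of "\<alpha> i"] by blast
      moreover have "e \<subseteq> V" and "card e = 2" using eE G by (auto simp: simple_graph_def all_edges_def)
      ultimately have "e \<subseteq> V'" unfolding V'_def by blast
      with \<open>card e = 2\<close> show "e \<in> all_edges V'" by (simp add: all_edges_def)
    qed
    have "card E' * (card V - 1) \<le> (card V' - 1) * card E"
      by (rule strongly_balanced_subgraph [OF G(2) finV G(3) V'(1) E' E'V' V'(2)])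
    moreover have "1 \<le> card V'" "card V' \<le> card V"
      using V' finV finite_subset [OF V'(1) finV] by (simp_all add: Suc_leI card_gt_0_iff card_mono)
    ultimately have \<Phi>_le: "\<Phi> \<le> x ^ card V' * p ^ card E'"
      unfolding \<Phi>_def by (intro balanced_weight x p G(3))
    have fVT: "finite ?VT" and fET: "finite ?ET"
      using finT finV finE by (auto simp: copy_edges_def)
    have "v (insert b T) + card V' = v T + card V"
    proof -
      have "card (?VT \<union> \<alpha> b ` V) + card (?VT \<inter> \<alpha> b ` V) = card ?VT + card (\<alpha> b ` V)"
        using fVT finV by (intro card_Un_Int [symmetric]) auto
      moreover have "?VT \<inter> \<alpha> b ` V = \<alpha> b ` V'" by (auto simp: V'_def)
      moreover have "card (\<alpha> b ` V') = card V'" by (rule card_image [OF inj_on_subset [OF inj V'(1)]])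
      moreover have "card (\<alpha> b ` V) = card V" by (rule card_image [OF inj])
      moreover have "(\<Union>i\<in>insert b T. \<alpha> i ` V) = ?VT \<union> \<alpha> b ` V" by auto
      ultimately show ?thesis by (simp add: v_def)
    qed
    then have xeq: "x ^ v (insert b T) * x ^ card V' = x ^ v T * x ^ card V"
      by (simp flip: power_add)
    have "d (insert b T) + card E' = d T + card E"
    proof -
      have "card (?ET \<union> copy_edges E (\<alpha> b)) + card (?ET \<inter> copy_edges E (\<alpha> b)) = card ?ET + card (copy_edges E (\<alpha> b))"
        using fET finE by (intro card_Un_Int [symmetric]) (auto simp: copy_edges_def)
      moreover have "?ET \<inter> copy_edges E (\<alpha> b) = (\<lambda>e. \<alpha> b ` e) ` E'" by (auto simp: E'_def copy_edges_def)
      moreover have "card ((\<lambda>e. \<alpha> b ` e) ` E') = card E'" by (rule card_image [OF inj_on_subset [OF injE E']])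
      moreover have "card (copy_edges E (\<alpha> b)) = card E" by (rule card_copy_edges [OF G(1) \<alpha> [OF b(1)]])
      moreover have "(\<Union>i\<in>insert b T. copy_edges E (\<alpha> i)) = ?ET \<union> copy_edges E (\<alpha> b)" by auto
      ultimately show ?thesis by (simp add: d_def)
    qed
    then have peq: "p ^ d (insert b T) * p ^ card E' = p ^ d T * p ^ card E"
      by (simp flip: power_add)
    have "x ^ v (insert b T) * p ^ d (insert b T) * \<Phi> ^ Suc j
        = (x ^ v (insert b T) * p ^ d (insert b T) * \<Phi> ^ j) * \<Phi>" by simp
    also have "\<dots> \<le> (x ^ v (insert b T) * p ^ d (insert b T) * \<Phi> ^ j) * (x ^ card V' * p ^ card E')"
      using \<Phi>_le \<Phi> x p by (intro mult_left_mono) auto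
    also have "\<dots> = (x ^ v (insert b T) * x ^ card V') * (p ^ d (insert b T) * p ^ card E') * \<Phi> ^ j"
      by (simp only: mult_ac)
    also have "\<dots> = (x ^ v T * p ^ d T * \<Phi> ^ j) * Q"
      unfolding xeq peq Q_def by (simp only: mult_ac)
    also have "\<dots> \<le> Q ^ Suc j * Q"
      using IH Q by (intro mult_right_mono) auto
    finally have "x ^ v (insert b T) * p ^ d (insert b T) * \<Phi> ^ Suc j \<le> Q ^ Suc (Suc j)"
      by (simp only: power_Suc2)
    then show ?case using b T finT by (intro exI [of _ "insert b T"]) auto
  qed
  moreover have "Suc (card S - 1) \<le> card S" using S by (simp add: card_gt_0_iff Suc_leI)
  ultimately obtain T where T: "T \<subseteq> S" "card T = Suc (card S - 1)"
    "x ^ v T * p ^ d T * \<Phi> ^ (card S - 1) \<le> Q ^ Suc (card S - 1)" by blast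
  have cS: "Suc (card S - 1) = card S" using S by (simp add: card_gt_0_iff)
  with T S have "T = S" by (simp add: card_subset_eq)
  then show ?thesis using T(3) unfolding cS v_def d_def \<Phi>_def Q_def by simp
qed

text \<open>Group the families by their vertex set U. A set of size j carries at most (k m)^(k m)
  families, and there are at most n^j such sets, which cancels the weight n^(- j). This leaves one
  term for each j \<le> k m.\<close>

lemma sum_inverse_power_union:
  fixes S :: "'b set"
  assumes V: "finite V" "card V = k" and S: "finite S" "card S = m" and n: "1 \<le> n" and I: "I \<subseteq> V \<rightarrow>\<^sub>E {1..n}"
  shows "(\<Sum>\<alpha>\<in>S \<rightarrow>\<^sub>E I. (1 / real n) ^ card (\<Union>i\<in>S. \<alpha> i ` V)) \<le> (real (k * m) + 1) * real (k * m) ^ (k * m)"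
proof -
  let ?W = "\<lambda>\<alpha>. \<Union>i\<in>S. \<alpha> i ` V"
  have finI: "finite I" using I V by (auto intro: finite_subset finite_PiE)
  then have fin: "finite (S \<rightarrow>\<^sub>E I)" using S by (intro finite_PiE)
  have Wsub: "?W \<alpha> \<in> Pow {1..n}" and Wcard: "card (?W \<alpha>) \<le> k * m" if "\<alpha> \<in> S \<rightarrow>\<^sub>E I" for \<alpha>
  proof -
    show "?W \<alpha> \<in> Pow {1..n}" using that I by (fastforce simp: PiE_def Pi_def)
    have "card (?W \<alpha>) \<le> (\<Sum>i\<in>S. card (\<alpha> i ` V))" by (rule card_UN_le [OF S(1)])
    also have "\<dots> \<le> (\<Sum>i\<in>S. k)" using V by (intro sum_mono) (auto intro: card_image_le)
    finally show "card (?W \<alpha>) \<le> k * m" using S by (simp add: mult.commute)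
  qed
  define g where "g j = (if j \<le> k * m then real (k * m) ^ (k * m) * (1 / real n) ^ j else 0)" for j
  have "(\<Sum>\<alpha>\<in>S \<rightarrow>\<^sub>E I. (1 / real n) ^ card (?W \<alpha>))
      = (\<Sum>U\<in>Pow {1..n}. \<Sum>\<alpha>\<in>{\<alpha> \<in> S \<rightarrow>\<^sub>E I. ?W \<alpha> = U}. (1 / real n) ^ card (?W \<alpha>))"
    using Wsub fin by (intro sum.group [symmetric]) auto
  also have "\<dots> \<le> (\<Sum>U\<in>Pow {1..n}. g (card U))"
  proof (rule sum_mono)
    fix U :: "nat set" assume U: "U \<in> Pow {1..n}"
    have finU: "finite U" using U finite_subset by blast
    have "(\<Sum>\<alpha>\<in>{\<alpha> \<in> S \<rightarrow>\<^sub>E I. ?W \<alpha> = U}. (1 / real n) ^ card (?W \<alpha>))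
        = real (card {\<alpha> \<in> S \<rightarrow>\<^sub>E I. ?W \<alpha> = U}) * (1 / real n) ^ card U" by simp
    also have "\<dots> \<le> g (card U)"
    proof (cases "card U \<le> k * m")
      case True
      have "{\<alpha> \<in> S \<rightarrow>\<^sub>E I. ?W \<alpha> = U} \<subseteq> S \<rightarrow>\<^sub>E (V \<rightarrow>\<^sub>E U)"
      proof
        fix \<alpha> assume "\<alpha> \<in> {\<alpha> \<in> S \<rightarrow>\<^sub>E I. ?W \<alpha> = U}"
        then have \<alpha>: "\<alpha> \<in> S \<rightarrow>\<^sub>E I" and W: "?W \<alpha> = U" by simp_all
        have "\<alpha> i \<in> V \<rightarrow>\<^sub>E U" if "i \<in> S" for i
        proof -
          have "\<alpha> i \<in> extensional V" using PiE_mem [OF \<alpha> that] I by (auto simp: PiE_def)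
          moreover have "\<alpha> i ` V \<subseteq> U" using that W by blast
          ultimately show ?thesis by (auto simp: PiE_def)
        qed
        then show "\<alpha> \<in> S \<rightarrow>\<^sub>E (V \<rightarrow>\<^sub>E U)" using \<alpha> by (simp add: PiE_def Pi_def)
      qed
      moreover have "finite (S \<rightarrow>\<^sub>E (V \<rightarrow>\<^sub>E U))" by (intro finite_PiE S V finU)
      ultimately have "card {\<alpha> \<in> S \<rightarrow>\<^sub>E I. ?W \<alpha> = U} \<le> card (S \<rightarrow>\<^sub>E (V \<rightarrow>\<^sub>E U))"
        by (intro card_mono)
      also have "\<dots> = (card U ^ k) ^ m" using S V finU by (simp add: card_PiE prod_constant)
      also have "\<dots> = card U ^ (k * m)" by (simp add: power_mult)
      also have "\<dots> \<le> (k * m) ^ (k * m)" using True by (intro power_mono) auto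
      finally have "real (card {\<alpha> \<in> S \<rightarrow>\<^sub>E I. ?W \<alpha> = U}) \<le> real ((k * m) ^ (k * m))"
        by (simp only: of_nat_le_iff)
      then show ?thesis using True by (auto simp: g_def intro!: mult_right_mono)
    next
      case False
      then have empty: "{\<alpha> \<in> S \<rightarrow>\<^sub>E I. ?W \<alpha> = U} = {}" using Wcard by auto
      show ?thesis unfolding empty using False by (simp add: g_def)
    qed
    finally show "(\<Sum>\<alpha>\<in>{\<alpha> \<in> S \<rightarrow>\<^sub>E I. ?W \<alpha> = U}. (1 / real n) ^ card (?W \<alpha>)) \<le> g (card U)" .
  qed
  also have "\<dots> = (\<Sum>j\<le>n. real (n choose j) * g j)"
    using sum_subsets_card [of "{1..n}" g] by simp
  also have "\<dots> \<le> (\<Sum>j\<le>n. if j \<le> k * m then real (k * m) ^ (k * m) else 0)"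
  proof (rule sum_mono)
    fix j assume "j \<in> {..n}"
    then have "n choose j \<le> n ^ j" by (intro binomial_le_pow) simp
    then have "real (n choose j) \<le> real n ^ j" by (simp flip: of_nat_power)
    then have "real (n choose j) * (1 / real n) ^ j \<le> 1"
      using n by (simp add: power_divide)
    then have "real (k * m) ^ (k * m) * (real (n choose j) * (1 / real n) ^ j) \<le> real (k * m) ^ (k * m) * 1"
      by (rule mult_left_mono) simp
    then show "real (n choose j) * g j \<le> (if j \<le> k * m then real (k * m) ^ (k * m) else 0)"
      unfolding g_def by (simp only: if_distrib mult_ac mult_1_right mult_zero_right split: if_split) simp
  qed
  also have "\<dots> = (\<Sum>j\<in>{..n} \<inter> {..k * m}. real (k * m) ^ (k * m))"
    by (subst sum.inter_restrict) (auto intro: sum.cong)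
  also have "\<dots> \<le> (\<Sum>j\<le>k * m. real (k * m) ^ (k * m))"
    by (rule sum_mono2) auto
  also have "\<dots> = (real (k * m) + 1) * real (k * m) ^ (k * m)" by (simp add: algebra_simps)
  finally show ?thesis .
qed

section \<open>Cumulants of a shifted random variable\<close>

text \<open>b' is the moment sequence of the variable minus c. Lowering the first cumulant by c
  yields a sequence that satisfies the recursion for b', and uniqueness identifies it.\<close>

lemma cumulants_shift:
  fixes b :: "nat \<Rightarrow> real" and c :: real
  assumes b0: "b 0 = 1"
  defines "b' \<equiv> \<lambda>j. \<Sum>i\<le>j. real (j choose i) * (- c) ^ (j - i) * b i"
  shows "cumulants b' (Suc m) = cumulants b (Suc m) - (if m = 0 then c else 0)"
proof -
  define \<kappa> where "\<kappa> j = cumulants b j - (if j = 1 then c else 0)" for j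
  have "cumulants b' (Suc m) = \<kappa> (Suc m)"
  proof (rule cumulants_unique)
    show "b' 0 = 1" by (simp add: b'_def b0)
    fix m
    \<comment> \<open>This is E Z (Z - c)^m in terms of moments. Inserting the recursion for b and
      exchanging the summations lets the inner sum reassemble to b' (m - i).\<close>
    have "(\<Sum>j\<le>m. real (m choose j) * (- c) ^ (m - j) * b (Suc j))
        = (\<Sum>j\<le>m. \<Sum>i\<le>j. real (m choose j) * (- c) ^ (m - j) * (real (j choose i) * cumulants b (Suc i) * b (j - i)))"
    proof (rule sum.cong [OF refl])
      fix j
      show "real (m choose j) * (- c) ^ (m - j) * b (Suc j)
        = (\<Sum>i\<le>j. real (m choose j) * (- c) ^ (m - j) * (real (j choose i) * cumulants b (Suc i) * b (j - i)))"
        unfolding moment_cumulant_recursion [of b, OF b0, of j] by (rule sum_distrib_left)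
    qed
    also have "\<dots> = (\<Sum>j\<le>m. \<Sum>i\<le>j. (real (m choose i) * cumulants b (Suc i)) *
        (real ((m - i) choose (j - i)) * (- c) ^ (m - i - (j - i)) * b (j - i)))"
    proof (intro sum.cong refl)
      fix j i assume "j \<in> {..m}" "i \<in> {..j}"
      then have ij: "i \<le> j" "j \<le> m" by auto
      have eq: "real (m choose j) * real (j choose i) = real (m choose i) * real ((m - i) choose (j - i))"
        using choose_mult [OF ij] by (simp flip: of_nat_mult)
      have idx: "m - i - (j - i) = m - j" using ij by simp
      have "real (m choose j) * (- c) ^ (m - j) * (real (j choose i) * cumulants b (Suc i) * b (j - i))
        = (real (m choose j) * real (j choose i)) * (cumulants b (Suc i) * ((- c) ^ (m - j) * b (j - i)))"
        by (simp only: mult_ac)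
      then show "real (m choose j) * (- c) ^ (m - j) * (real (j choose i) * cumulants b (Suc i) * b (j - i))
        = (real (m choose i) * cumulants b (Suc i)) * (real ((m - i) choose (j - i)) * (- c) ^ (m - i - (j - i)) * b (j - i))"
        unfolding eq idx by (simp only: mult_ac)
    qed
    also have "\<dots> = (\<Sum>(i, l)\<in>{(i, l). i + l \<le> m}. (real (m choose i) * cumulants b (Suc i)) *
        (real ((m - i) choose l) * (- c) ^ (m - i - l) * b l))"
      by (rule sum.triangle_reindex_eq [symmetric, of "(\<lambda>i l. (real (m choose i) * cumulants b (Suc i)) * (real ((m - i) choose l) * (- c) ^ (m - i - l) * b l))"])
    also have "{(i, l). i + l \<le> m} = Sigma {..m} (\<lambda>i. {..m - i})" by auto
    also have "(\<Sum>(i, l)\<in>\<dots>. (real (m choose i) * cumulants b (Suc i)) * (real ((m - i) choose l) * (- c) ^ (m - i - l) * b l))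
        = (\<Sum>i\<le>m. \<Sum>l\<le>m - i. (real (m choose i) * cumulants b (Suc i)) * (real ((m - i) choose l) * (- c) ^ (m - i - l) * b l))"
      by (rule sum.Sigma [symmetric]) auto
    also have "\<dots> = (\<Sum>i\<le>m. real (m choose i) * cumulants b (Suc i) * b' (m - i))"
      unfolding b'_def by (simp only: sum_distrib_left)
    finally have A: "(\<Sum>j\<le>m. real (m choose j) * (- c) ^ (m - j) * b (Suc j))
        = (\<Sum>i\<le>m. real (m choose i) * cumulants b (Suc i) * b' (m - i))" .
    \<comment> \<open>The counterpart of E (Z - c)^(m + 1) = E Z (Z - c)^m - c E (Z - c)^m, obtained
      from Pascal's rule. The last term accounts for the change of the first cumulant.\<close>
    have "b' (Suc m) = (\<Sum>j\<le>m. real (m choose j) * (- c) ^ (m - j) * b (Suc j)) - c * b' m"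
    proof -
      have "b' (Suc m) = (- c) ^ Suc m * b 0 + (\<Sum>j\<le>m. real (Suc m choose Suc j) * (- c) ^ (m - j) * b (Suc j))"
        unfolding b'_def sum.atMost_Suc_shift by simp
      also have "(\<Sum>j\<le>m. real (Suc m choose Suc j) * (- c) ^ (m - j) * b (Suc j))
          = (\<Sum>j\<le>m. real (m choose j) * (- c) ^ (m - j) * b (Suc j))
          + (\<Sum>j\<le>m. real (m choose Suc j) * (- c) ^ (m - j) * b (Suc j))"
        by (simp add: distrib_right sum.distrib)
      also have "(\<Sum>j\<le>m. real (m choose Suc j) * (- c) ^ (m - j) * b (Suc j))
          = (\<Sum>j<m. - c * (real (m choose Suc j) * (- c) ^ (m - Suc j) * b (Suc j)))"
      proof -
        have "(\<Sum>j\<le>m. real (m choose Suc j) * (- c) ^ (m - j) * b (Suc j))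
            = (\<Sum>j<m. real (m choose Suc j) * (- c) ^ (m - j) * b (Suc j))"
          by (simp add: lessThan_Suc_atMost [symmetric])
        also have "\<dots> = (\<Sum>j<m. - c * (real (m choose Suc j) * (- c) ^ (m - Suc j) * b (Suc j)))"
        proof (rule sum.cong [OF refl])
          fix j assume "j \<in> {..<m}"
          then have "m - j = Suc (m - Suc j)" by auto
          then have "(- c) ^ (m - j) = - c * (- c) ^ (m - Suc j)" by (simp only: power_Suc)
          then show "real (m choose Suc j) * (- c) ^ (m - j) * b (Suc j) = - c * (real (m choose Suc j) * (- c) ^ (m - Suc j) * b (Suc j))"
            by simp
        qed
        finally show ?thesis .
      qed
      also have "\<dots> = - c * (\<Sum>j<m. real (m choose Suc j) * (- c) ^ (m - Suc j) * b (Suc j))"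
        by (rule sum_distrib_left [symmetric])
      also have "(- c) ^ Suc m * b 0 + ((\<Sum>j\<le>m. real (m choose j) * (- c) ^ (m - j) * b (Suc j)) + \<dots>)
          = (\<Sum>j\<le>m. real (m choose j) * (- c) ^ (m - j) * b (Suc j)) - c * ((- c) ^ m * b 0 + (\<Sum>j<m. real (m choose Suc j) * (- c) ^ (m - Suc j) * b (Suc j)))"
        by (simp add: distrib_left)
      also have "(- c) ^ m * b 0 + (\<Sum>j<m. real (m choose Suc j) * (- c) ^ (m - Suc j) * b (Suc j)) = b' m"
        unfolding b'_def sum.atMost_shift by simp
      finally show ?thesis .
    qed
    also have "\<dots> = (\<Sum>i\<le>m. real (m choose i) * cumulants b (Suc i) * b' (m - i)) - (\<Sum>i\<le>m. if i = 0 then c * b' m else 0)"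
      unfolding A by simp
    also have "\<dots> = (\<Sum>i\<le>m. real (m choose i) * \<kappa> (Suc i) * b' (m - i))"
      unfolding sum_subtractf [symmetric] by (rule sum.cong) (auto simp: \<kappa>_def algebra_simps)
    finally show "b' (Suc m) = (\<Sum>i\<le>m. real (m choose i) * \<kappa> (Suc i) * b' (m - i))" .
  qed
  then show ?thesis by (simp add: \<kappa>_def)
qed

lemma (in prob_space) cumulants_moments_shift:
  assumes int: "\<And>j. integrable M (\<lambda>\<omega>. Z \<omega> ^ j)"
  shows "cumulants (moments M (\<lambda>\<omega>. Z \<omega> - c)) (Suc m) = cumulants (moments M Z) (Suc m) - (if m = 0 then c else 0)"
proof -
  have "moments M (\<lambda>\<omega>. Z \<omega> - c) = (\<lambda>j. \<Sum>i\<le>j. real (j choose i) * (- c) ^ (j - i) * moments M Z i)"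
  proof
    fix j
    have "moments M (\<lambda>\<omega>. Z \<omega> - c) j = (\<integral>\<omega>. (\<Sum>i\<le>j. real (j choose i) * (- c) ^ (j - i) * Z \<omega> ^ i) \<partial>M)"
      unfolding moments_def
    proof (rule Bochner_Integration.integral_cong [OF refl])
      fix \<omega>
      have "(Z \<omega> - c) ^ j = (Z \<omega> + - c) ^ j" by simp
      also have "\<dots> = (\<Sum>i\<le>j. real (j choose i) * (- c) ^ (j - i) * Z \<omega> ^ i)"
        unfolding binomial_ring by (rule sum.cong) auto
      finally show "(Z \<omega> - c) ^ j = (\<Sum>i\<le>j. real (j choose i) * (- c) ^ (j - i) * Z \<omega> ^ i)" .
    qed
    also have "\<dots> = (\<Sum>i\<le>j. real (j choose i) * (- c) ^ (j - i) * moments M Z i)"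
      unfolding moments_def using int by (subst Bochner_Integration.integral_sum) auto
    finally show "moments M (\<lambda>\<omega>. Z \<omega> - c) j = (\<Sum>i\<le>j. real (j choose i) * (- c) ^ (j - i) * moments M Z i)" .
  qed
  then show ?thesis using cumulants_shift [of "moments M Z" c m] by simp
qed

section \<open>Edge probabilities in the random-connection model\<close>

text \<open>The conditional probability, given points at x, that all edges of A are present.\<close>

definition edge_weight :: "real \<Rightarrow> ('v \<Rightarrow> 'v \<Rightarrow> real) \<Rightarrow> nat set set \<Rightarrow> (nat \<Rightarrow> 'v) \<Rightarrow> real" where
  "edge_weight p H A x = (\<Prod>e\<in>A. p * H (x (Min e)) (x (Max e)))"

lemma edge_Min_Max:
  assumes "card e = 2"
  shows "Min e \<in> e" "Max e \<in> e" "e = {Min e, Max e}"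
proof -
  have fin: "finite e" "e \<noteq> {}" using assms by (auto intro: card_ge_0_finite)
  then show "Min e \<in> e" "Max e \<in> e" by simp_all
  from assms obtain x y where e: "e = {x, y}" "x \<noteq> y" by (auto simp: card_2_iff)
  then show "e = {Min e, Max e}" by (auto simp: min_def max_def)
qed

lemma edge_weight_cong:
  assumes "A \<subseteq> all_edges J" "\<And>i. i \<in> J \<Longrightarrow> x i = y i"
  shows "edge_weight p H A x = edge_weight p H A y"
  unfolding edge_weight_def
proof (rule prod.cong [OF refl])
  fix e assume "e \<in> A"
  then have e: "e \<subseteq> J" "card e = 2" using assms by (auto simp: all_edges_def)
  then have "Min e \<in> J" "Max e \<in> J" using edge_Min_Max by blast+
  then show "p * H (x (Min e)) (x (Max e)) = p * H (y (Min e)) (y (Max e))" using assms by simp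
qed

lemma edge_weight_restrict:
  "A \<subseteq> all_edges J \<Longrightarrow> edge_weight p H A (restrict x J) = edge_weight p H A x"
  by (rule edge_weight_cong) auto

lemma edge_weight_Un:
  assumes "finite A" "finite B" "A \<inter> B = {}"
  shows "edge_weight p H (A \<union> B) x = edge_weight p H A x * edge_weight p H B x"
  unfolding edge_weight_def by (rule prod.union_disjoint [OF assms])

lemma edge_weight_bounds:
  assumes p: "0 \<le> p" "p \<le> 1" and H: "\<And>x y. H x y \<in> {0..1}"
  shows "0 \<le> edge_weight p H A x" "edge_weight p H A x \<le> p ^ card A"
proof -
  show "0 \<le> edge_weight p H A x"
    unfolding edge_weight_def using p H by (intro prod_nonneg) auto
  have "edge_weight p H A x \<le> (\<Prod>e\<in>A. p)"
    unfolding edge_weight_def using p H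
    by (intro prod_mono) (auto intro: mult_left_le)
  then show "edge_weight p H A x \<le> p ^ card A" by simp
qed

text \<open>\<beta> may reverse the order of the endpoints of an edge, so Min and Max of its image
  can be swapped; the symmetry of H absorbs this.\<close>

lemma edge_weight_copy:
  assumes G: "simple_graph V E" and \<beta>: "\<beta> \<in> embeddings V n" and sym: "\<And>x y. H x y = H y x"
  shows "edge_weight p H (copy_edges E \<beta>) x = edge_weight p H E (\<lambda>v. x (\<beta> v))"
proof -
  have "edge_weight p H (copy_edges E \<beta>) x = (\<Prod>e\<in>E. p * H (x (Min (\<beta> ` e))) (x (Max (\<beta> ` e))))"
    unfolding edge_weight_def copy_edges_def
    using inj_on_image_edges [OF G \<beta>] by (subst prod.reindex) auto
  also have "\<dots> = edge_weight p H E (\<lambda>v. x (\<beta> v))"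
    unfolding edge_weight_def
  proof (rule prod.cong [OF refl])
    fix e assume "e \<in> E"
    then have "card e = 2" using G by (auto simp: simple_graph_def all_edges_def)
    then have e: "e = {Min e, Max e}" by (rule edge_Min_Max)
    have "\<beta> ` e = {\<beta> (Min e), \<beta> (Max e)}" by (subst e) simp
    then have "Min (\<beta> ` e) = min (\<beta> (Min e)) (\<beta> (Max e))" "Max (\<beta> ` e) = max (\<beta> (Min e)) (\<beta> (Max e))"
      by simp_all
    then show "p * H (x (Min (\<beta> ` e))) (x (Max (\<beta> ` e))) = p * H (x (\<beta> (Min e))) (x (\<beta> (Max e)))"
      using sym by (auto simp: min_def max_def)
  qed
  finally show ?thesis .
qed

lemma edge_weight_measurable:
  fixes H :: "'v::euclidean_space \<Rightarrow> 'v \<Rightarrow> real"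
  assumes H: "(\<lambda>(x, y). H x y) \<in> borel_measurable (borel \<Otimes>\<^sub>M borel)" and A: "A \<subseteq> all_edges J"
  shows "edge_weight p H A \<in> borel_measurable (\<Pi>\<^sub>M i\<in>J. borel)"
  unfolding edge_weight_def [abs_def]
proof (rule borel_measurable_prod)
  fix e assume "e \<in> A"
  then have e: "e \<subseteq> J" "card e = 2" using A by (auto simp: all_edges_def)
  then have "Min e \<in> J" "Max e \<in> J" using edge_Min_Max by blast+
  then have "(\<lambda>x. (x (Min e), x (Max e))) \<in> measurable (\<Pi>\<^sub>M i\<in>J. borel) (borel \<Otimes>\<^sub>M borel :: ('v \<times> 'v) measure)"
    by (intro measurable_Pair measurable_component_singleton)
  from measurable_compose [OF this H]
  have "(\<lambda>x. H (x (Min e)) (x (Max e))) \<in> borel_measurable (\<Pi>\<^sub>M i\<in>J. borel)" by simp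
  then show "(\<lambda>x. p * H (x (Min e)) (x (Max e))) \<in> borel_measurable (\<Pi>\<^sub>M i\<in>J. borel)" by simp
qed

lemma (in finite_measure) integrable_bounded:
  fixes u :: "'a \<Rightarrow> real"
  assumes "u \<in> borel_measurable M" "\<And>\<omega>. \<bar>u \<omega>\<bar> \<le> C"
  shows "integrable M u"
  by (rule integrable_const_bound [of _ C]) (use assms in auto)

section \<open>The random-connection model with a fixed number of points\<close>

locale random_connection = prob_space M
  for M :: "'a measure" +
  fixes n :: nat and \<mu> :: "'v::euclidean_space measure" and H :: "'v \<Rightarrow> 'v \<Rightarrow> real" and p :: real
    and X :: "nat \<Rightarrow> 'a \<Rightarrow> 'v" and \<Gamma> :: "'a \<Rightarrow> nat set set"
  assumes model: "binomial_random_connection_model M n \<mu> H p X \<Gamma>"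
    and mu: "prob_space \<mu>" "sets \<mu> = sets borel"
    and H_meas: "(\<lambda>(x, y). H x y) \<in> borel_measurable (borel \<Otimes>\<^sub>M borel)"
    and H_range: "\<And>x y. H x y \<in> {0..1}" and H_sym: "\<And>x y. H x y = H y x"
    and p01: "0 < p" "p < 1"
begin

lemma X_meas: "i \<in> {1..n} \<Longrightarrow> X i \<in> measurable M borel"
  and X_distr: "i \<in> {1..n} \<Longrightarrow> distr M borel (X i) = \<mu>"
  and X_indep: "indep_vars (\<lambda>_. borel) X {1..n}"
  using model unfolding binomial_random_connection_model_def by auto

text \<open>Restricted to {1..n} so that it takes values in the finite product space whose preimages
  generate \<open>points_sigma\<close>.\<close>

definition points :: "'a \<Rightarrow> nat \<Rightarrow> 'v" where
  "points \<omega> = (\<lambda>i\<in>{1..n}. X i \<omega>)"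

lemma points_meas: "J \<subseteq> {1..n} \<Longrightarrow> (\<lambda>\<omega>. restrict (points \<omega>) J) \<in> measurable M (\<Pi>\<^sub>M i\<in>J. borel)"
  unfolding points_def by (intro measurable_restrict) (use X_meas in \<open>auto simp: restrict_def\<close>)

lemma edge_event: "e \<in> all_edges {1..n} \<Longrightarrow> {\<omega> \<in> space M. e \<in> \<Gamma> \<omega>} \<in> events"
  using model unfolding binomial_random_connection_model_def by blast

lemma edges_event: "A \<subseteq> all_edges {1..n} \<Longrightarrow> {\<omega> \<in> space M. A \<subseteq> \<Gamma> \<omega>} \<in> events"
proof -
  assume A: "A \<subseteq> all_edges {1..n}"
  then have fin: "finite A" using finite_all_edges finite_subset by blast
  have "{\<omega> \<in> space M. \<forall>e\<in>A. e \<in> \<Gamma> \<omega>} \<in> events"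
    using A by (intro sets.sets_Collect_finite_All fin edge_event) blast
  then show ?thesis by (simp add: subset_eq)
qed

lemma weight_bounds: "0 \<le> edge_weight p H A x" "edge_weight p H A x \<le> p ^ card A"
  using edge_weight_bounds [of p H A x] p01 H_range by auto

definition edge_prob :: "nat set set \<Rightarrow> real" where
  "edge_prob A = prob {\<omega> \<in> space M. A \<subseteq> \<Gamma> \<omega>}"

lemma edge_weight_points_measurable:
  assumes "A \<subseteq> all_edges {1..n}"
  shows "(\<lambda>\<omega>. edge_weight p H A (points \<omega>)) \<in> borel_measurable M"
proof -
  have "(\<lambda>\<omega>. edge_weight p H A (restrict (points \<omega>) {1..n})) \<in> borel_measurable M"
    by (rule measurable_compose [OF points_meas edge_weight_measurable [OF H_meas assms]]) simp
  then show ?thesis unfolding edge_weight_restrict [OF assms] .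
qed

text \<open>g of the points is measurable for \<open>points_sigma\<close>, so the indicator may be
  replaced by its conditional expectation, which the model gives as the edge weight. The case g = 1
  computes \<open>edge_prob\<close>; a g of one point gives correlations with sums over
  points.\<close>

lemma expectation_edges_times:
  assumes A: "A \<subseteq> all_edges {1..n}" and g: "g \<in> borel_measurable (\<Pi>\<^sub>M i\<in>{1..n}. borel)"
    and bnd: "\<And>x. \<bar>g x\<bar> \<le> C"
  shows "expectation (\<lambda>\<omega>. g (points \<omega>) * indicator {\<omega> \<in> space M. A \<subseteq> \<Gamma> \<omega>} \<omega>)
    = expectation (\<lambda>\<omega>. g (points \<omega>) * edge_weight p H A (points \<omega>))"
proof -
  let ?F = "points_sigma M n X" and ?I = "indicator {\<omega> \<in> space M. A \<subseteq> \<Gamma> \<omega>} :: 'a \<Rightarrow> real"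
  have pm: "points \<in> measurable M (\<Pi>\<^sub>M i\<in>{1..n}. borel)"
    using points_meas [OF order_refl] by (simp only: points_def [abs_def] restrict_restrict Int_absorb)
  have F: "?F = vimage_algebra (space M) points (\<Pi>\<^sub>M i\<in>{1..n}. borel)"
    by (simp add: points_sigma_def points_def [abs_def])
  have "subalgebra M ?F"
    unfolding subalgebra_def F using sets_image_in_sets [OF refl pm] by simp
  then interpret F: finite_measure_subalgebra M ?F
    by unfold_locales
  have gF: "(\<lambda>\<omega>. g (points \<omega>)) \<in> borel_measurable ?F"
    unfolding F
    by (rule measurable_compose [OF measurable_vimage_algebra1 g]) (use pm in \<open>auto simp: measurable_def\<close>)
  have gM: "(\<lambda>\<omega>. g (points \<omega>)) \<in> borel_measurable M"
    by (rule measurable_compose [OF pm g])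
  have IM: "?I \<in> borel_measurable M" using edges_event [OF A] by simp
  have C: "0 \<le> C" using bnd [of undefined] by linarith
  have int: "integrable M (\<lambda>\<omega>. g (points \<omega>) * ?I \<omega>)"
  proof (rule integrable_const_bound [of _ C])
    show "AE \<omega> in M. norm (g (points \<omega>) * ?I \<omega>) \<le> C"
      using bnd C by (auto simp: indicator_def)
    show "(\<lambda>\<omega>. g (points \<omega>) * ?I \<omega>) \<in> borel_measurable M" using gM IM by simp
  qed
  have AE: "AE \<omega> in M. real_cond_exp M ?F ?I \<omega> = (\<Prod>e\<in>A. p * H (X (Min e) \<omega>) (X (Max e) \<omega>))"
    using model A unfolding binomial_random_connection_model_def by auto
  have pts: "(\<Prod>e\<in>A. p * H (X (Min e) \<omega>) (X (Max e) \<omega>)) = edge_weight p H A (points \<omega>)" for \<omega>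
  proof -
    have "(\<Prod>e\<in>A. p * H (X (Min e) \<omega>) (X (Max e) \<omega>)) = edge_weight p H A (\<lambda>i. X i \<omega>)"
      by (simp add: edge_weight_def)
    also have "\<dots> = edge_weight p H A (points \<omega>)"
      by (rule edge_weight_cong [OF A]) (simp add: points_def)
    finally show ?thesis .
  qed
  have "expectation (\<lambda>\<omega>. g (points \<omega>) * ?I \<omega>) = expectation (\<lambda>\<omega>. g (points \<omega>) * real_cond_exp M ?F ?I \<omega>)"
    by (rule F.real_cond_exp_intg(2) [symmetric, OF int gF IM])
  also have "\<dots> = expectation (\<lambda>\<omega>. g (points \<omega>) * edge_weight p H A (points \<omega>))"
  proof (rule integral_cong_AE)
    show "(\<lambda>\<omega>. g (points \<omega>) * real_cond_exp M ?F ?I \<omega>) \<in> borel_measurable M"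
      using gM by simp
    show "(\<lambda>\<omega>. g (points \<omega>) * edge_weight p H A (points \<omega>)) \<in> borel_measurable M"
      using gM edge_weight_points_measurable [OF A] by simp
    show "AE \<omega> in M. g (points \<omega>) * real_cond_exp M ?F ?I \<omega> = g (points \<omega>) * edge_weight p H A (points \<omega>)"
      using AE by eventually_elim (simp add: pts)
  qed
  finally show ?thesis .
qed

lemma edge_prob_eq:
  assumes A: "A \<subseteq> all_edges {1..n}"
  shows "edge_prob A = expectation (\<lambda>\<omega>. edge_weight p H A (points \<omega>))"
proof -
  define S where "S = {\<omega> \<in> space M. A \<subseteq> \<Gamma> \<omega>}"
  have S: "S \<in> events" unfolding S_def by (rule edges_event [OF A])
  have "expectation (indicator S) = prob S"
    using S sets.sets_into_space [OF S] by (simp add: Int_absorb2)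
  then show ?thesis
    using expectation_edges_times [OF A, of "\<lambda>_. 1" 1] by (simp add: edge_prob_def S_def [symmetric])
qed

lemma integrable_edge_weight:
  assumes A: "A \<subseteq> all_edges {1..n}"
  shows "integrable M (\<lambda>\<omega>. edge_weight p H A (points \<omega>))"
proof (rule integrable_const_bound [of _ "p ^ card A"])
  show "AE \<omega> in M. norm (edge_weight p H A (points \<omega>)) \<le> p ^ card A"
    using weight_bounds by (intro AE_I2) simp
qed (rule edge_weight_points_measurable [OF A])

lemma edge_prob_le:
  assumes A: "A \<subseteq> all_edges {1..n}"
  shows "edge_prob A \<le> p ^ card A"
proof -
  have "edge_prob A \<le> expectation (\<lambda>_. p ^ card A)"
    unfolding edge_prob_eq [OF A]
    by (rule integral_mono [OF integrable_edge_weight [OF A] integrable_const weight_bounds(2)])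
  then show ?thesis by (simp add: prob_space)
qed

lemma expectation_disjoint:
  fixes f g :: "(nat \<Rightarrow> 'v) \<Rightarrow> real"
  assumes J: "J \<inter> K = {}" "J \<subseteq> {1..n}" "K \<subseteq> {1..n}"
    and f: "f \<in> borel_measurable (\<Pi>\<^sub>M i\<in>J. borel)" "\<And>x. \<bar>f x\<bar> \<le> C"
    and g: "g \<in> borel_measurable (\<Pi>\<^sub>M i\<in>K. borel)" "\<And>x. \<bar>g x\<bar> \<le> D"
  shows "expectation (\<lambda>\<omega>. f (restrict (points \<omega>) J) * g (restrict (points \<omega>) K))
    = expectation (\<lambda>\<omega>. f (restrict (points \<omega>) J)) * expectation (\<lambda>\<omega>. g (restrict (points \<omega>) K))"
proof -
  have r: "restrict (points \<omega>) L = restrict (\<lambda>i. X i \<omega>) L" if "L \<subseteq> {1..n}" for L \<omega>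
    by (rule restrict_ext) (use that in \<open>auto simp: points_def\<close>)
  have ind: "indep_var borel (f \<circ> (\<lambda>\<omega>. restrict (points \<omega>) J)) borel (g \<circ> (\<lambda>\<omega>. restrict (points \<omega>) K))"
    unfolding r [OF J(2)] r [OF J(3)]
    by (rule indep_var_compose [OF indep_var_restrict [OF X_indep J] f(1) g(1)])
  have i1: "integrable M (f \<circ> (\<lambda>\<omega>. restrict (points \<omega>) J))"
    unfolding comp_def
    by (rule integrable_bounded [OF measurable_compose [OF points_meas [OF J(2)] f(1)] f(2)])
  have i2: "integrable M (g \<circ> (\<lambda>\<omega>. restrict (points \<omega>) K))"
    unfolding comp_def
    by (rule integrable_bounded [OF measurable_compose [OF points_meas [OF J(3)] g(1)] g(2)])
  show ?thesis
    using indep_var_lebesgue_integral [OF ind i1 i2] unfolding comp_def .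
qed

text \<open>The edge weight of the union is the product of the two weights, and these depend on
  disjoint sets of independent points. This is the independence behind the vanishing of joint
  cumulants.\<close>

lemma edge_prob_disjoint:
  assumes A: "A \<subseteq> all_edges {1..n}" and B: "B \<subseteq> all_edges {1..n}" and disj: "\<Union>A \<inter> \<Union>B = {}"
  shows "edge_prob (A \<union> B) = edge_prob A * edge_prob B"
proof -
  note b = weight_bounds
  have le1: "\<bar>edge_weight p H C x\<bar> \<le> 1" for C x
    using b [of C x] power_le_one [of p "card C"] p01 by auto
  have sub: "\<Union>A \<subseteq> {1..n}" "\<Union>B \<subseteq> {1..n}" and AJ: "A \<subseteq> all_edges (\<Union>A)" "B \<subseteq> all_edges (\<Union>B)"
    using A B by (auto simp: all_edges_def)
  have fin: "finite A" "finite B" using A B finite_all_edges finite_subset by blast+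
  have "A \<inter> B = {}"
  proof (rule equals0I)
    fix e assume "e \<in> A \<inter> B"
    then have "e \<subseteq> \<Union>A \<inter> \<Union>B" "card e = 2" using A by (auto simp: all_edges_def)
    then show False using disj by auto
  qed
  then have "edge_prob (A \<union> B) = expectation (\<lambda>\<omega>. edge_weight p H A (points \<omega>) * edge_weight p H B (points \<omega>))"
    using A B fin by (simp add: edge_prob_eq edge_weight_Un)
  also have "\<dots> = expectation (\<lambda>\<omega>. edge_weight p H A (restrict (points \<omega>) (\<Union>A)) * edge_weight p H B (restrict (points \<omega>) (\<Union>B)))"
    by (simp add: edge_weight_restrict [OF AJ(1)] edge_weight_restrict [OF AJ(2)])
  also have "\<dots> = expectation (\<lambda>\<omega>. edge_weight p H A (restrict (points \<omega>) (\<Union>A))) * expectation (\<lambda>\<omega>. edge_weight p H B (restrict (points \<omega>) (\<Union>B)))"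
    by (rule expectation_disjoint [OF disj sub edge_weight_measurable [OF H_meas AJ(1)] le1 edge_weight_measurable [OF H_meas AJ(2)] le1])
  also have "\<dots> = edge_prob A * edge_prob B"
    using A B by (simp add: edge_prob_eq edge_weight_restrict [OF AJ(1)] edge_weight_restrict [OF AJ(2)])
  finally show ?thesis .
qed

lemma embedding_law:
  assumes V: "V \<noteq> {}" and \<beta>: "\<beta> \<in> embeddings V n"
  shows "distr M (\<Pi>\<^sub>M v\<in>V. borel) (\<lambda>\<omega>. \<lambda>v\<in>V. X (\<beta> v) \<omega>) = (\<Pi>\<^sub>M v\<in>V. \<mu>)"
proof -
  have \<beta>V: "\<beta> v \<in> {1..n}" if "v \<in> V" for v using \<beta> that by (auto simp: embeddings_def)
  \<comment> \<open>Reindexing along the injective \<beta> is done by grouping the points into the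
    disjoint singleton blocks {\<beta> v}.\<close>
  have "indep_vars (\<lambda>v. \<Pi>\<^sub>M i\<in>{\<beta> v}. borel) (\<lambda>v \<omega>. restrict (\<lambda>i. X i \<omega>) {\<beta> v}) V"
    using \<beta> by (intro indep_vars_restrict [OF X_indep]) (auto simp: embeddings_def disjoint_family_on_def inj_on_def)
  then have "indep_vars (\<lambda>_. borel) (\<lambda>v \<omega>. (\<lambda>x. x (\<beta> v)) (restrict (\<lambda>i. X i \<omega>) {\<beta> v})) V"
    by (rule indep_vars_compose2) (rule measurable_component_singleton, simp)
  then have "indep_vars (\<lambda>_. borel) (\<lambda>v. X (\<beta> v)) V" by simp
  moreover have "random_variable borel (X (\<beta> v))" if "v \<in> V" for v using X_meas \<beta>V that by simp
  ultimately have "distr M (\<Pi>\<^sub>M v\<in>V. borel) (\<lambda>\<omega>. \<lambda>v\<in>V. X (\<beta> v) \<omega>) = (\<Pi>\<^sub>M v\<in>V. distr M borel (X (\<beta> v)))"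
    using indep_vars_iff_distr_eq_PiM' [OF V, where M' = "\<lambda>_. borel" and X = "\<lambda>v. X (\<beta> v)"] by simp
  also have "\<dots> = (\<Pi>\<^sub>M v\<in>V. \<mu>)"
    by (rule PiM_cong) (use X_distr \<beta>V in auto)
  finally show ?thesis .
qed

lemma expectation_embedding:
  fixes f :: "(nat \<Rightarrow> 'v) \<Rightarrow> real"
  assumes V: "V \<noteq> {}" and \<beta>: "\<beta> \<in> embeddings V n" and f: "f \<in> borel_measurable (\<Pi>\<^sub>M v\<in>V. borel)"
  shows "expectation (\<lambda>\<omega>. f (\<lambda>v\<in>V. points \<omega> (\<beta> v))) = (\<integral>x. f x \<partial>(\<Pi>\<^sub>M v\<in>V. \<mu>))"
proof -
  have \<beta>V: "\<beta> v \<in> {1..n}" if "v \<in> V" for v using \<beta> that by (auto simp: embeddings_def)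
  have eq: "(\<lambda>v\<in>V. points \<omega> (\<beta> v)) = (\<lambda>v\<in>V. X (\<beta> v) \<omega>)" for \<omega>
    using \<beta>V by (auto simp: points_def restrict_def fun_eq_iff)
  have "(\<lambda>\<omega>. \<lambda>v\<in>V. X (\<beta> v) \<omega>) \<in> measurable M (\<Pi>\<^sub>M v\<in>V. borel)"
    using X_meas \<beta>V by (intro measurable_restrict) auto
  from integral_distr [OF this f] show ?thesis
    unfolding eq embedding_law [OF V \<beta>] by simp
qed

end

section \<open>Cumulants of the number of copies\<close>

lemma prod_of_bool: "finite A \<Longrightarrow> (\<Prod>i\<in>A. of_bool (P i)) = (of_bool (\<forall>i\<in>A. P i) :: real)"
  by (induction A rule: finite_induct) auto

context random_connection
begin

text \<open>Labelled copies, that is a(G) times the subgraph count. The factor cancels in the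
  normalized variable, so the cumulants are computed without it.\<close>

definition copies :: "nat set \<Rightarrow> nat set set \<Rightarrow> 'a \<Rightarrow> real" where
  "copies V E \<omega> = (\<Sum>\<beta>\<in>embeddings V n. of_bool (copy_edges E \<beta> \<subseteq> \<Gamma> \<omega>))"

lemma subgraph_count_eq:
  assumes "finite E"
  shows "subgraph_count V E n (\<Gamma> \<omega>) = copies V E \<omega> / real (card (graph_automorphisms V E))"
proof -
  have "(\<Prod>e\<in>E. of_bool (\<beta> ` e \<in> \<Gamma> \<omega>)) = (of_bool (copy_edges E \<beta> \<subseteq> \<Gamma> \<omega>) :: real)" for \<beta>
    unfolding prod_of_bool [OF assms] copy_edges_def by (rule arg_cong [of _ _ of_bool]) blast
  then show ?thesis
    unfolding subgraph_count_def copies_def embeddings_def by simp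
qed

lemma copies_bounds: "0 \<le> copies V E \<omega>" "copies V E \<omega> \<le> real (card (embeddings V n))"
proof -
  show "0 \<le> copies V E \<omega>" unfolding copies_def by (intro sum_nonneg) auto
  have "copies V E \<omega> \<le> (\<Sum>\<beta>\<in>embeddings V n. 1)"
    unfolding copies_def by (rule sum_mono) auto
  then show "copies V E \<omega> \<le> real (card (embeddings V n))" by simp
qed

lemma edges_indicator_measurable:
  assumes "A \<subseteq> all_edges {1..n}"
  shows "(\<lambda>\<omega>. of_bool (A \<subseteq> \<Gamma> \<omega>) :: real) \<in> borel_measurable M"
proof -
  have "(indicator {\<omega> \<in> space M. A \<subseteq> \<Gamma> \<omega>} :: 'a \<Rightarrow> real) \<in> borel_measurable M"
    using edges_event [OF assms] by simp
  then show ?thesis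
    by (subst measurable_cong [where g = "indicator {\<omega> \<in> space M. A \<subseteq> \<Gamma> \<omega>}"]) (auto simp: indicator_def)
qed

lemma edges_indicator_integrable:
  assumes "A \<subseteq> all_edges {1..n}"
  shows "integrable M (\<lambda>\<omega>. of_bool (A \<subseteq> \<Gamma> \<omega>) :: real)"
  by (rule integrable_bounded [OF edges_indicator_measurable [OF assms], of 1]) simp

lemma expectation_edges_indicator:
  assumes "A \<subseteq> all_edges {1..n}"
  shows "expectation (\<lambda>\<omega>. of_bool (A \<subseteq> \<Gamma> \<omega>)) = edge_prob A"
proof -
  define S where "S = {\<omega> \<in> space M. A \<subseteq> \<Gamma> \<omega>}"
  have S: "S \<in> events" unfolding S_def by (rule edges_event [OF assms])
  have "expectation (\<lambda>\<omega>. of_bool (A \<subseteq> \<Gamma> \<omega>)) = expectation (indicator S)"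
    by (rule Bochner_Integration.integral_cong) (auto simp: S_def indicator_def)
  also have "\<dots> = prob S"
    using S sets.sets_into_space [OF S] by (simp add: Int_absorb2)
  finally show ?thesis by (simp add: edge_prob_def S_def)
qed

lemma copies_measurable:
  assumes "simple_graph V E" shows "copies V E \<in> borel_measurable M"
  unfolding copies_def [abs_def]
  by (intro borel_measurable_sum edges_indicator_measurable copy_edges_subset [OF assms])

lemma copies_power_integrable:
  assumes "simple_graph V E" shows "integrable M (\<lambda>\<omega>. copies V E \<omega> ^ j)"
proof (rule integrable_bounded [of _ "real (card (embeddings V n)) ^ j"])
  show "(\<lambda>\<omega>. copies V E \<omega> ^ j) \<in> borel_measurable M" using copies_measurable [OF assms] by simp
  fix \<omega>
  show "\<bar>copies V E \<omega> ^ j\<bar> \<le> real (card (embeddings V n)) ^ j"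
    using copies_bounds [of V E \<omega>] power_mono [of "copies V E \<omega>" _ j] by simp
qed

text \<open>The mixed moment of the indicators of the copies \<alpha> i with i \<in> S. The family
  is indexed so that the same copy may occur repeatedly.\<close>

definition family_prob :: "nat set set \<Rightarrow> (nat \<Rightarrow> nat \<Rightarrow> nat) \<Rightarrow> nat set \<Rightarrow> real" where
  "family_prob E \<alpha> S = edge_prob (\<Union>i\<in>S. copy_edges E (\<alpha> i))"

lemma edge_prob_empty: "edge_prob {} = 1"
  by (simp add: edge_prob_def prob_space)

lemma family_prob_empty: "family_prob E \<alpha> {} = 1"
  by (simp add: family_prob_def edge_prob_empty)

lemma family_edges_subset:
  assumes "simple_graph V E" "\<alpha> \<in> S \<rightarrow>\<^sub>E embeddings V n" "T \<subseteq> S"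
  shows "(\<Union>i\<in>T. copy_edges E (\<alpha> i)) \<subseteq> all_edges {1..n}"
proof -
  have "copy_edges E (\<alpha> i) \<subseteq> all_edges {1..n}" if "i \<in> T" for i
    using assms(2,3) that by (intro copy_edges_subset [OF assms(1)]) (auto simp: PiE_def Pi_def)
  then show ?thesis by blast
qed

lemma sum_family_prob:
  assumes G: "simple_graph V E" and S: "finite S"
  shows "(\<Sum>\<alpha>\<in>S \<rightarrow>\<^sub>E embeddings V n. family_prob E \<alpha> S) = moments M (copies V E) (card S)"
proof -
  have V: "finite V" using G by (simp add: simple_graph_def)
  have "moments M (copies V E) (card S)
      = expectation (\<lambda>\<omega>. \<Sum>\<alpha>\<in>S \<rightarrow>\<^sub>E embeddings V n. of_bool ((\<Union>i\<in>S. copy_edges E (\<alpha> i)) \<subseteq> \<Gamma> \<omega>))"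
    unfolding moments_def
  proof (rule Bochner_Integration.integral_cong [OF refl])
    fix \<omega>
    have "copies V E \<omega> ^ card S = (\<Prod>i\<in>S. \<Sum>\<beta>\<in>embeddings V n. of_bool (copy_edges E \<beta> \<subseteq> \<Gamma> \<omega>))"
      by (simp add: copies_def)
    also have "\<dots> = (\<Sum>\<alpha>\<in>S \<rightarrow>\<^sub>E embeddings V n. \<Prod>i\<in>S. of_bool (copy_edges E (\<alpha> i) \<subseteq> \<Gamma> \<omega>))"
      by (rule prod_sum_PiE [OF S finite_embeddings [OF V]])
    also have "\<dots> = (\<Sum>\<alpha>\<in>S \<rightarrow>\<^sub>E embeddings V n. of_bool ((\<Union>i\<in>S. copy_edges E (\<alpha> i)) \<subseteq> \<Gamma> \<omega>))"
      by (simp add: prod_of_bool [OF S] UN_subset_iff)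
    finally show "copies V E \<omega> ^ card S = (\<Sum>\<alpha>\<in>S \<rightarrow>\<^sub>E embeddings V n. of_bool ((\<Union>i\<in>S. copy_edges E (\<alpha> i)) \<subseteq> \<Gamma> \<omega>))" .
  qed
  also have "\<dots> = (\<Sum>\<alpha>\<in>S \<rightarrow>\<^sub>E embeddings V n. expectation (\<lambda>\<omega>. of_bool ((\<Union>i\<in>S. copy_edges E (\<alpha> i)) \<subseteq> \<Gamma> \<omega>)))"
    by (intro Bochner_Integration.integral_sum edges_indicator_integrable family_edges_subset [OF G _ order_refl])
  also have "\<dots> = (\<Sum>\<alpha>\<in>S \<rightarrow>\<^sub>E embeddings V n. family_prob E \<alpha> S)"
    unfolding family_prob_def
    by (intro sum.cong refl expectation_edges_indicator family_edges_subset [OF G _ order_refl])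
  finally show ?thesis ..
qed

text \<open>Either the family splits into two parts without common vertices, and the cumulant
  vanishes by independence, or it is connected and \<open>connected_family_weight\<close> applies.
  The factor n^(- v), v being the number of vertices covered, is kept to compensate for the number
  of families in the later sum.\<close>

lemma joint_cumulant_family_bound:
  assumes G: "simple_graph V E" "strongly_balanced V E" "2 \<le> card V"
    and n: "1 \<le> n" and S: "finite S" "S \<noteq> {}" and \<alpha>: "\<alpha> \<in> S \<rightarrow>\<^sub>E embeddings V n"
  defines "Q \<equiv> real n ^ card V * p ^ card E"
  shows "\<bar>joint_cumulant (family_prob E \<alpha>) S\<bar> * min (real n) Q ^ (card S - 1)
    \<le> real (card S) ^ card S * Q ^ card S * (1 / real n) ^ card (\<Union>i\<in>S. \<alpha> i ` V)"
proof (cases "\<exists>A B. A \<union> B = S \<and> A \<inter> B = {} \<and> A \<noteq> {} \<and> B \<noteq> {} \<and> (\<Union>i\<in>A. \<alpha> i ` V) \<inter> (\<Union>i\<in>B. \<alpha> i ` V) = {}")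
  case True
  then obtain A B where AB: "A \<union> B = S" "A \<inter> B = {}" "A \<noteq> {}" "B \<noteq> {}"
    and disj: "(\<Union>i\<in>A. \<alpha> i ` V) \<inter> (\<Union>i\<in>B. \<alpha> i ` V) = {}" by blast
  have "joint_cumulant (family_prob E \<alpha>) S = 0"
  proof (rule joint_cumulant_split_eq_0 [where A = A and B = B])
    fix T assume T: "T \<subseteq> A \<union> B"
    have un: "(\<Union>i\<in>T. copy_edges E (\<alpha> i)) = (\<Union>i\<in>T \<inter> A. copy_edges E (\<alpha> i)) \<union> (\<Union>i\<in>T \<inter> B. copy_edges E (\<alpha> i))"
      using T by blast
    show "family_prob E \<alpha> T = family_prob E \<alpha> (T \<inter> A) * family_prob E \<alpha> (T \<inter> B)"
      unfolding family_prob_def un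
    proof (rule edge_prob_disjoint)
      show "(\<Union>i\<in>T \<inter> A. copy_edges E (\<alpha> i)) \<subseteq> all_edges {1..n}"
        by (rule family_edges_subset [OF G(1) \<alpha>]) (use AB(1) in blast)
      show "(\<Union>i\<in>T \<inter> B. copy_edges E (\<alpha> i)) \<subseteq> all_edges {1..n}"
        by (rule family_edges_subset [OF G(1) \<alpha>]) (use AB(1) in blast)
      have "\<Union> (\<Union>i\<in>T \<inter> A. copy_edges E (\<alpha> i)) \<subseteq> (\<Union>i\<in>A. \<alpha> i ` V)" "\<Union> (\<Union>i\<in>T \<inter> B. copy_edges E (\<alpha> i)) \<subseteq> (\<Union>i\<in>B. \<alpha> i ` V)"
        using Union_copy_edges [OF G(1)] by blast+
      then show "\<Union> (\<Union>i\<in>T \<inter> A. copy_edges E (\<alpha> i)) \<inter> \<Union> (\<Union>i\<in>T \<inter> B. copy_edges E (\<alpha> i)) = {}"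
        using disj by blast
    qed
  qed (use S AB in \<open>auto simp: family_prob_empty\<close>)
  moreover have "0 \<le> Q" using p01 by (simp add: Q_def)
  ultimately show ?thesis by simp
next
  case False
  \<comment> \<open>A union has at most as many edges as its parts together and p \<le> 1, so w T w
    U \<le> w (T \<union> U), as \<open>joint_cumulant_bound\<close> requires.\<close>
  define w where "w T = p ^ card (\<Union>i\<in>T. copy_edges E (\<alpha> i))" for T
  define v where "v = card (\<Union>i\<in>S. \<alpha> i ` V)"
  have Q: "0 < Q" using p01 n by (simp add: Q_def)
  have fin: "finite (\<Union>i\<in>T. copy_edges E (\<alpha> i))" if "T \<subseteq> S" for T
    by (rule finite_subset [OF family_edges_subset [OF G(1) \<alpha> that]]) (simp add: finite_all_edges)
  have jc: "\<bar>joint_cumulant (family_prob E \<alpha>) S\<bar> \<le> real (card S) ^ card S * w S"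
  proof (rule joint_cumulant_bound [OF S(1)])
    fix T assume T: "T \<subseteq> S"
    have "0 \<le> family_prob E \<alpha> T" by (simp add: family_prob_def edge_prob_def)
    then show "\<bar>family_prob E \<alpha> T\<bar> \<le> w T"
      unfolding w_def using edge_prob_le [OF family_edges_subset [OF G(1) \<alpha> T]] by (simp add: family_prob_def)
  next
    fix T U assume TU: "T \<subseteq> S" "U \<subseteq> S"
    have "w T * w U = p ^ (card (\<Union>i\<in>T. copy_edges E (\<alpha> i)) + card (\<Union>i\<in>U. copy_edges E (\<alpha> i)))"
      by (simp add: w_def power_add)
    also have "\<dots> \<le> p ^ card ((\<Union>i\<in>T. copy_edges E (\<alpha> i)) \<union> (\<Union>i\<in>U. copy_edges E (\<alpha> i)))"
      using p01 by (intro power_decreasing card_Un_le) auto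
    also have "\<dots> = w (T \<union> U)" by (simp add: w_def UN_Un)
    finally show "w T * w U \<le> w (T \<union> U)" .
  qed
  have "real n ^ v * w S * min (real n) Q ^ (card S - 1) \<le> Q ^ card S"
    unfolding v_def w_def Q_def
  proof (rule connected_family_weight [OF G _ _ _ S])
    show "\<alpha> i \<in> embeddings V n" if "i \<in> S" for i using \<alpha> that by auto
    show "(\<Union>i\<in>A. \<alpha> i ` V) \<inter> (\<Union>i\<in>B. \<alpha> i ` V) \<noteq> {}"
      if "A \<union> B = S" "A \<inter> B = {}" "A \<noteq> {}" "B \<noteq> {}" for A B
      using False that by blast
  qed (use n p01 in auto)
  then have "w S * min (real n) Q ^ (card S - 1) \<le> Q ^ card S * (1 / real n) ^ v"
    using n by (simp add: power_divide field_simps)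
  then have "real (card S) ^ card S * (w S * min (real n) Q ^ (card S - 1)) \<le> real (card S) ^ card S * (Q ^ card S * (1 / real n) ^ v)"
    by (rule mult_left_mono) simp
  moreover have "\<bar>joint_cumulant (family_prob E \<alpha>) S\<bar> * min (real n) Q ^ (card S - 1)
      \<le> real (card S) ^ card S * w S * min (real n) Q ^ (card S - 1)"
    using jc Q n by (intro mult_right_mono) auto
  ultimately show ?thesis unfolding v_def by (simp only: mult.assoc)
qed

text \<open>The sum of n^(- v) over all families is bounded independently of n by
  \<open>sum_inverse_power_union\<close>, so the dependence on n and p sits entirely in Q and min n
  Q.\<close>

theorem cumulant_copies_bound:
  assumes G: "simple_graph V E" "strongly_balanced V E" "2 \<le> card V" and n: "1 \<le> n" and m: "1 \<le> m"
  defines "Q \<equiv> real n ^ card V * p ^ card E"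
  shows "\<bar>cumulants (moments M (copies V E)) m\<bar> * min (real n) Q ^ (m - 1)
    \<le> real m ^ m * Q ^ m * ((real (card V * m) + 1) * real (card V * m) ^ (card V * m))"
proof -
  define S where "S = {..<m}"
  have S: "finite S" "S \<noteq> {}" "card S = m" using m by (simp_all add: S_def lessThan_empty_iff)
  have V: "finite V" using G by (simp add: simple_graph_def)
  have Q: "0 < Q" using p01 n by (simp add: Q_def)
  let ?I = "embeddings V n"
  have "cumulants (moments M (copies V E)) m = (\<Sum>\<alpha>\<in>S \<rightarrow>\<^sub>E ?I. joint_cumulant (family_prob E \<alpha>) S)"
    unfolding S(3) [symmetric]
  proof (rule sum_joint_cumulants [symmetric])
    show "family_prob E \<alpha> {} = 1" for \<alpha> by (rule family_prob_empty)
    show "family_prob E \<alpha> T = family_prob E (restrict \<alpha> T) T" for \<alpha> T by (simp add: family_prob_def)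
    show "(\<Sum>\<alpha>\<in>T \<rightarrow>\<^sub>E ?I. family_prob E \<alpha> T) = moments M (copies V E) (card T)" if "finite T" for T
      by (rule sum_family_prob [OF G(1) that])
  qed (rule S(1))
  then have "\<bar>cumulants (moments M (copies V E)) m\<bar> * min (real n) Q ^ (m - 1)
      \<le> (\<Sum>\<alpha>\<in>S \<rightarrow>\<^sub>E ?I. \<bar>joint_cumulant (family_prob E \<alpha>) S\<bar>) * min (real n) Q ^ (m - 1)"
    using Q n by (intro mult_right_mono) auto
  also have "\<dots> = (\<Sum>\<alpha>\<in>S \<rightarrow>\<^sub>E ?I. \<bar>joint_cumulant (family_prob E \<alpha>) S\<bar> * min (real n) Q ^ (m - 1))"
    by (rule sum_distrib_right)
  also have "\<dots> \<le> (\<Sum>\<alpha>\<in>S \<rightarrow>\<^sub>E ?I. real m ^ m * Q ^ m * (1 / real n) ^ card (\<Union>i\<in>S. \<alpha> i ` V))"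
    using joint_cumulant_family_bound [OF G n S(1,2)] unfolding S(3) Q_def by (intro sum_mono) auto
  also have "\<dots> = real m ^ m * Q ^ m * (\<Sum>\<alpha>\<in>S \<rightarrow>\<^sub>E ?I. (1 / real n) ^ card (\<Union>i\<in>S. \<alpha> i ` V))"
    by (rule sum_distrib_left [symmetric])
  also have "\<dots> \<le> real m ^ m * Q ^ m * ((real (card V * m) + 1) * real (card V * m) ^ (card V * m))"
    using Q by (intro mult_left_mono sum_inverse_power_union [OF V refl S(1,3) n]) (auto simp: embeddings_def)
  finally show ?thesis .
qed

end

section \<open>Lower bounds for the variance\<close>

lemma card_PiE_fixed:
  assumes "finite V" "u \<in> V" "card V = k"
  shows "card {\<beta> \<in> V \<rightarrow>\<^sub>E {1..n::nat}. \<beta> u = c} \<le> n ^ (k - 1)"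
proof -
  let ?F = "\<lambda>w. if w = u then {c} else {1..n}"
  have "card {\<beta> \<in> V \<rightarrow>\<^sub>E {1..n}. \<beta> u = c} \<le> card (Pi\<^sub>E V ?F)"
  proof (rule card_mono)
    show "finite (Pi\<^sub>E V ?F)" by (intro finite_PiE assms) auto
    show "{\<beta> \<in> V \<rightarrow>\<^sub>E {1..n}. \<beta> u = c} \<subseteq> Pi\<^sub>E V ?F" by (auto simp: PiE_def Pi_def)
  qed
  also have "\<dots> = (\<Prod>w\<in>V. card (?F w))" by (rule card_PiE [OF assms(1)])
  also have "\<dots> = card (?F u) * (\<Prod>w\<in>V - {u}. card (?F w))"
    by (rule prod.remove [OF assms(1,2)])
  also have "(\<Prod>w\<in>V - {u}. card (?F w)) = (\<Prod>w\<in>V - {u}. n)" by (rule prod.cong) auto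
  also have "card (?F u) * (\<Prod>w\<in>V - {u}. n) = n ^ (k - 1)" using assms by simp
  finally show ?thesis .
qed

text \<open>Each factor n - i of the falling factorial is at least n / 2.\<close>

lemma card_embeddings_ge:
  assumes V: "finite V" "card V = k" and n: "2 * k \<le> n"
  shows "(real n / 2) ^ k \<le> real (card (embeddings V n))"
proof -
  have "card (embeddings V n) = prod ((-) n) {0..<k}"
    using card_inj_on_subset_funcset [OF V(1) _ order_refl, of "{1..n}"] V
    unfolding embeddings_def by simp
  then have "real (card (embeddings V n)) = (\<Prod>i\<in>{0..<k}. real (n - i))" by simp
  moreover have "(\<Prod>i\<in>{0..<k}. real n / 2) \<le> (\<Prod>i\<in>{0..<k}. real (n - i))"
    by (rule prod_mono) (use n in \<open>auto simp: of_nat_diff\<close>)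
  ultimately show ?thesis by simp
qed

lemma graph_automorphisms_pos:
  assumes "finite V" shows "0 < card (graph_automorphisms V E)"
proof -
  have "restrict id V \<in> graph_automorphisms V E"
    by (auto simp: graph_automorphisms_def bij_betw_def inj_on_def)
  moreover have "finite (graph_automorphisms V E)"
    by (rule finite_subset [of _ "V \<rightarrow>\<^sub>E V"]) (auto simp: graph_automorphisms_def intro: finite_PiE assms)
  ultimately show ?thesis by (auto simp: card_gt_0_iff)
qed

context random_connection
begin

definition copy_prob :: "nat set \<Rightarrow> nat set set \<Rightarrow> real" where
  "copy_prob V E = (\<integral>x. edge_weight p H E x \<partial>(\<Pi>\<^sub>M v\<in>V. \<mu>))"

lemma edge_weight_copy_points:
  assumes G: "simple_graph V E" and \<beta>: "\<beta> \<in> embeddings V n"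
  shows "edge_weight p H (copy_edges E \<beta>) (points \<omega>) = edge_weight p H E (\<lambda>v\<in>V. points \<omega> (\<beta> v))"
proof -
  have E: "E \<subseteq> all_edges V" using G by (simp add: simple_graph_def)
  show ?thesis
    unfolding edge_weight_copy [OF G \<beta> H_sym] edge_weight_restrict [OF E] ..
qed

lemma edge_prob_copy:
  assumes G: "simple_graph V E" and V: "V \<noteq> {}" and \<beta>: "\<beta> \<in> embeddings V n"
  shows "edge_prob (copy_edges E \<beta>) = copy_prob V E"
proof -
  have E: "E \<subseteq> all_edges V" using G by (simp add: simple_graph_def)
  show ?thesis
    unfolding edge_prob_eq [OF copy_edges_subset [OF G \<beta>]] edge_weight_copy_points [OF G \<beta>] copy_prob_def
    by (rule expectation_embedding [OF V \<beta> edge_weight_measurable [OF H_meas E]])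
qed

lemma copy_prob_bounds:
  assumes G: "simple_graph V E"
  shows "0 \<le> copy_prob V E" "copy_prob V E \<le> p ^ card E"
proof -
  interpret P: prob_space "\<Pi>\<^sub>M v\<in>V. \<mu>"
    by (rule prob_space_PiM) (rule mu)
  have E: "E \<subseteq> all_edges V" using G by (simp add: simple_graph_def)
  have sets: "sets (\<Pi>\<^sub>M v\<in>V. \<mu>) = sets (\<Pi>\<^sub>M v\<in>V. borel)"
    by (rule sets_PiM_cong) (auto simp: mu)
  have meas: "edge_weight p H E \<in> borel_measurable (\<Pi>\<^sub>M v\<in>V. \<mu>)"
    unfolding measurable_cong_sets [OF sets refl] by (rule edge_weight_measurable [OF H_meas E])
  have int: "integrable (\<Pi>\<^sub>M v\<in>V. \<mu>) (edge_weight p H E)"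
    by (rule P.integrable_bounded [OF meas, of "p ^ card E"]) (simp add: abs_of_nonneg weight_bounds)
  show "0 \<le> copy_prob V E"
    unfolding copy_prob_def by (rule Bochner_Integration.integral_nonneg) (rule weight_bounds)
  have "copy_prob V E \<le> (\<integral>x. p ^ card E \<partial>(\<Pi>\<^sub>M v\<in>V. \<mu>))"
    unfolding copy_prob_def by (rule integral_mono [OF int P.integrable_const weight_bounds(2)])
  then show "copy_prob V E \<le> p ^ card E" by (simp add: P.prob_space)
qed

lemma expectation_copies:
  assumes G: "simple_graph V E" and V: "V \<noteq> {}"
  shows "expectation (copies V E) = real (card (embeddings V n)) * copy_prob V E"
proof -
  have "expectation (copies V E) = (\<Sum>\<beta>\<in>embeddings V n. expectation (\<lambda>\<omega>. of_bool (copy_edges E \<beta> \<subseteq> \<Gamma> \<omega>)))"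
    unfolding copies_def [abs_def]
    by (intro Bochner_Integration.integral_sum edges_indicator_integrable copy_edges_subset [OF G])
  also have "\<dots> = (\<Sum>\<beta>\<in>embeddings V n. copy_prob V E)"
    using expectation_edges_indicator [OF copy_edges_subset [OF G]] edge_prob_copy [OF G V]
    by (intro sum.cong) auto
  finally show ?thesis by simp
qed

text \<open>Sparse regime: the diagonal terms \<open>\<beta> = \<beta>'\<close> dominate the variance.\<close>

lemma variance_copies_diagonal:
  assumes G: "simple_graph V E" and V: "V \<noteq> {}" "card V = k"
    and small: "real (k ^ 2 * n ^ (k - 1)) * p ^ card E \<le> 1 / 2"
  shows "real (card (embeddings V n)) * copy_prob V E / 2 \<le> variance (copies V E)"
proof -
  have finV: "finite V" using G by (simp add: simple_graph_def)
  let ?I = "embeddings V n" and ?\<rho> = "copy_prob V E"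
  have finI: "finite ?I" by (rule finite_embeddings [OF finV])
  note \<rho> = copy_prob_bounds [OF G]
  have sub: "copy_edges E \<beta> \<union> copy_edges E \<gamma> \<subseteq> all_edges {1..n}" if "\<beta> \<in> ?I" "\<gamma> \<in> ?I" for \<beta> \<gamma>
    using copy_edges_subset [OF G that(1)] copy_edges_subset [OF G that(2)] by blast
  have "expectation (\<lambda>\<omega>. (copies V E \<omega>)\<^sup>2)
      = expectation (\<lambda>\<omega>. \<Sum>\<beta>\<in>?I. \<Sum>\<gamma>\<in>?I. of_bool (copy_edges E \<beta> \<union> copy_edges E \<gamma> \<subseteq> \<Gamma> \<omega>))"
  proof (rule Bochner_Integration.integral_cong [OF refl])
    fix \<omega>
    have "(copies V E \<omega>)\<^sup>2 = (\<Sum>\<beta>\<in>?I. \<Sum>\<gamma>\<in>?I. of_bool (copy_edges E \<beta> \<subseteq> \<Gamma> \<omega>) * of_bool (copy_edges E \<gamma> \<subseteq> \<Gamma> \<omega>))"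
      unfolding power2_eq_square copies_def by (rule sum_product)
    then show "(copies V E \<omega>)\<^sup>2 = (\<Sum>\<beta>\<in>?I. \<Sum>\<gamma>\<in>?I. of_bool (copy_edges E \<beta> \<union> copy_edges E \<gamma> \<subseteq> \<Gamma> \<omega>))"
      by (simp only: of_bool_conj [symmetric] Un_subset_iff)
  qed
  also have "\<dots> = (\<Sum>\<beta>\<in>?I. \<Sum>\<gamma>\<in>?I. edge_prob (copy_edges E \<beta> \<union> copy_edges E \<gamma>))"
  proof -
    have "expectation (\<lambda>\<omega>. \<Sum>\<beta>\<in>?I. \<Sum>\<gamma>\<in>?I. of_bool (copy_edges E \<beta> \<union> copy_edges E \<gamma> \<subseteq> \<Gamma> \<omega>) :: real)
        = (\<Sum>\<beta>\<in>?I. expectation (\<lambda>\<omega>. \<Sum>\<gamma>\<in>?I. of_bool (copy_edges E \<beta> \<union> copy_edges E \<gamma> \<subseteq> \<Gamma> \<omega>)))"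
      by (intro Bochner_Integration.integral_sum Bochner_Integration.integrable_sum edges_indicator_integrable sub)
    also have "\<dots> = (\<Sum>\<beta>\<in>?I. \<Sum>\<gamma>\<in>?I. expectation (\<lambda>\<omega>. of_bool (copy_edges E \<beta> \<union> copy_edges E \<gamma> \<subseteq> \<Gamma> \<omega>)))"
      by (intro sum.cong refl Bochner_Integration.integral_sum edges_indicator_integrable sub)
    also have "\<dots> = (\<Sum>\<beta>\<in>?I. \<Sum>\<gamma>\<in>?I. edge_prob (copy_edges E \<beta> \<union> copy_edges E \<gamma>))"
      by (intro sum.cong refl expectation_edges_indicator sub)
    finally show ?thesis .
  qed
  finally have second: "expectation (\<lambda>\<omega>. (copies V E \<omega>)\<^sup>2) = (\<Sum>\<beta>\<in>?I. \<Sum>\<gamma>\<in>?I. edge_prob (copy_edges E \<beta> \<union> copy_edges E \<gamma>))" .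
  have "variance (copies V E) = expectation (\<lambda>\<omega>. (copies V E \<omega>)\<^sup>2) - (expectation (copies V E))\<^sup>2"
    using copies_power_integrable [OF G, of 1] copies_power_integrable [OF G, of 2] by (intro variance_eq) simp_all
  also have "(expectation (copies V E))\<^sup>2 = (\<Sum>\<beta>\<in>?I. \<Sum>\<gamma>\<in>?I. ?\<rho>\<^sup>2)"
    by (simp add: expectation_copies [OF G V(1)] power2_eq_square)
  also have "expectation (\<lambda>\<omega>. (copies V E \<omega>)\<^sup>2) - (\<Sum>\<beta>\<in>?I. \<Sum>\<gamma>\<in>?I. ?\<rho>\<^sup>2)
      = (\<Sum>\<beta>\<in>?I. \<Sum>\<gamma>\<in>?I. edge_prob (copy_edges E \<beta> \<union> copy_edges E \<gamma>) - ?\<rho>\<^sup>2)"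
    unfolding second by (simp only: sum_subtractf)
  finally have var: "variance (copies V E) = (\<Sum>\<beta>\<in>?I. \<Sum>\<gamma>\<in>?I. edge_prob (copy_edges E \<beta> \<union> copy_edges E \<gamma>) - ?\<rho>\<^sup>2)" .
  have inner: "?\<rho> / 2 \<le> (\<Sum>\<gamma>\<in>?I. edge_prob (copy_edges E \<beta> \<union> copy_edges E \<gamma>) - ?\<rho>\<^sup>2)" if \<beta>: "\<beta> \<in> ?I" for \<beta>
  proof -
    \<comment> \<open>Copies \<gamma> disjoint from \<beta> have covariance 0, overlapping ones at
      least - \<rho>^2, and \<gamma> = \<beta> contributes \<rho> - \<rho>^2. So the inner sum is at
      least \<rho> - card Ov \<rho>^2.\<close>
    define Ov where "Ov = {\<gamma> \<in> ?I. \<beta> ` V \<inter> \<gamma> ` V \<noteq> {}}"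
    have finOv: "finite Ov" unfolding Ov_def using finI by simp
    have "(if \<gamma> = \<beta> then ?\<rho> else 0) - (if \<gamma> \<in> Ov then ?\<rho>\<^sup>2 else 0)
        \<le> edge_prob (copy_edges E \<beta> \<union> copy_edges E \<gamma>) - ?\<rho>\<^sup>2" if \<gamma>: "\<gamma> \<in> ?I" for \<gamma>
    proof -
      have nn: "0 \<le> edge_prob (copy_edges E \<beta> \<union> copy_edges E \<gamma>)" by (simp add: edge_prob_def)
      consider "\<gamma> = \<beta>" | "\<gamma> \<noteq> \<beta>" "\<gamma> \<in> Ov" | "\<gamma> \<noteq> \<beta>" "\<gamma> \<notin> Ov" by blast
      then show ?thesis
      proof cases
        case 1
        then have "\<gamma> \<in> Ov" using \<beta> V(1) by (simp add: Ov_def)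
        then show ?thesis using 1 edge_prob_copy [OF G V(1) \<beta>] by simp
      next
        case 2
        then show ?thesis using nn by simp
      next
        case 3
        then have "\<beta> ` V \<inter> \<gamma> ` V = {}" using \<gamma> by (simp add: Ov_def)
        then have "\<Union> (copy_edges E \<beta>) \<inter> \<Union> (copy_edges E \<gamma>) = {}"
          using Union_copy_edges [OF G, of \<beta>] Union_copy_edges [OF G, of \<gamma>] by blast
        then have "edge_prob (copy_edges E \<beta> \<union> copy_edges E \<gamma>) = ?\<rho> * ?\<rho>"
          using edge_prob_disjoint [OF copy_edges_subset [OF G \<beta>] copy_edges_subset [OF G \<gamma>]]
            edge_prob_copy [OF G V(1) \<beta>] edge_prob_copy [OF G V(1) \<gamma>] by simp
        then show ?thesis using 3 by (simp add: power2_eq_square)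
      qed
    qed
    then have "(\<Sum>\<gamma>\<in>?I. (if \<gamma> = \<beta> then ?\<rho> else 0) - (if \<gamma> \<in> Ov then ?\<rho>\<^sup>2 else 0))
        \<le> (\<Sum>\<gamma>\<in>?I. edge_prob (copy_edges E \<beta> \<union> copy_edges E \<gamma>) - ?\<rho>\<^sup>2)"
      by (rule sum_mono)
    moreover have "(\<Sum>\<gamma>\<in>?I. (if \<gamma> = \<beta> then ?\<rho> else 0) - (if \<gamma> \<in> Ov then ?\<rho>\<^sup>2 else 0)) = ?\<rho> - real (card Ov) * ?\<rho>\<^sup>2"
    proof -
      have "(\<Sum>\<gamma>\<in>?I. if \<gamma> = \<beta> then ?\<rho> else 0) = ?\<rho>" using \<beta> finI by simp
      moreover have "(\<Sum>\<gamma>\<in>?I. if \<gamma> \<in> Ov then ?\<rho>\<^sup>2 else 0) = (\<Sum>\<gamma>\<in>?I \<inter> Ov. ?\<rho>\<^sup>2)"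
        by (rule sum.inter_restrict [symmetric, OF finI])
      moreover have "?I \<inter> Ov = Ov" by (auto simp: Ov_def)
      ultimately show ?thesis by (simp add: sum_subtractf)
    qed
    \<comment> \<open>An overlapping \<gamma> maps some u to some \<beta> v, which leaves at most
      n^(k - 1) choices for each of the k^2 pairs (u, v); the rest is \<rho> \<le> p^e and the
      hypothesis \<open>small\<close>.\<close>
    moreover have "real (card Ov) * ?\<rho> \<le> 1 / 2"
    proof -
      have "Ov \<subseteq> (\<Union>u\<in>V. \<Union>v\<in>V. {\<gamma> \<in> V \<rightarrow>\<^sub>E {1..n}. \<gamma> u = \<beta> v})"
      proof
        fix \<gamma> assume "\<gamma> \<in> Ov"
        then have \<gamma>: "\<gamma> \<in> V \<rightarrow>\<^sub>E {1..n}" "\<beta> ` V \<inter> \<gamma> ` V \<noteq> {}" by (auto simp: Ov_def embeddings_def)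
        then obtain w where "w \<in> \<beta> ` V" "w \<in> \<gamma> ` V" by blast
        then obtain u v where "u \<in> V" "v \<in> V" "\<gamma> u = \<beta> v" by auto
        then show "\<gamma> \<in> (\<Union>u\<in>V. \<Union>v\<in>V. {\<gamma> \<in> V \<rightarrow>\<^sub>E {1..n}. \<gamma> u = \<beta> v})" using \<gamma> by blast
      qed
      moreover have "finite {\<gamma> \<in> V \<rightarrow>\<^sub>E {1..n}. \<gamma> u = c}" for u c
        by (rule finite_subset [of _ "V \<rightarrow>\<^sub>E {1..n}"]) (auto intro: finite_PiE finV)
      then have "finite (\<Union>u\<in>V. \<Union>v\<in>V. {\<gamma> \<in> V \<rightarrow>\<^sub>E {1..n}. \<gamma> u = \<beta> v})"
        by (intro finite_UN_I finV)
      ultimately have "card Ov \<le> card (\<Union>u\<in>V. \<Union>v\<in>V. {\<gamma> \<in> V \<rightarrow>\<^sub>E {1..n}. \<gamma> u = \<beta> v})"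
        by (intro card_mono)
      also have "\<dots> \<le> (\<Sum>u\<in>V. card (\<Union>v\<in>V. {\<gamma> \<in> V \<rightarrow>\<^sub>E {1..n}. \<gamma> u = \<beta> v}))"
        by (rule card_UN_le [OF finV])
      also have "\<dots> \<le> (\<Sum>u\<in>V. \<Sum>v\<in>V. card {\<gamma> \<in> V \<rightarrow>\<^sub>E {1..n}. \<gamma> u = \<beta> v})"
        by (intro sum_mono card_UN_le [OF finV])
      also have "\<dots> \<le> (\<Sum>u\<in>V. \<Sum>v\<in>V. n ^ (k - 1))"
        by (intro sum_mono card_PiE_fixed finV V)
      also have "\<dots> = k ^ 2 * n ^ (k - 1)" by (simp add: V power2_eq_square)
      finally have "real (card Ov) * ?\<rho> \<le> real (k ^ 2 * n ^ (k - 1)) * p ^ card E"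
        using \<rho> by (intro mult_mono) (simp_all only: of_nat_le_iff of_nat_0_le_iff)
      then show ?thesis using small by linarith
    qed
    then have "real (card Ov) * ?\<rho> * ?\<rho> \<le> 1 / 2 * ?\<rho>" by (rule mult_right_mono) (rule \<rho>)
    ultimately show ?thesis by (simp add: power2_eq_square)
  qed
  have "(\<Sum>\<beta>\<in>?I. ?\<rho> / 2) \<le> variance (copies V E)"
    unfolding var by (rule sum_mono) (rule inner)
  then show ?thesis by simp
qed

section \<open>Correlation of the count with sums over single points\<close>

lemma points_expectation:
  fixes g :: "'v \<Rightarrow> real"
  assumes g: "g \<in> borel_measurable borel" and i: "i \<in> {1..n}"
  shows "expectation (\<lambda>\<omega>. g (points \<omega> i)) = (\<integral>x. g x \<partial>\<mu>)"
proof -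
  have "expectation (\<lambda>\<omega>. g (points \<omega> i)) = expectation (\<lambda>\<omega>. g (X i \<omega>))"
    using i by (simp add: points_def)
  also have "\<dots> = (\<integral>x. g x \<partial>distr M borel (X i))"
    by (rule integral_distr [symmetric, OF X_meas [OF i] g])
  finally show ?thesis unfolding X_distr [OF i] .
qed

lemma coordinate_measurable:
  fixes g :: "'v \<Rightarrow> real"
  assumes "g \<in> borel_measurable borel" "i \<in> J"
  shows "(\<lambda>x. g (x i)) \<in> borel_measurable (\<Pi>\<^sub>M i\<in>J. borel)"
  by (rule measurable_compose [OF measurable_component_singleton [OF assms(2)] assms(1)])

text \<open>The mixed terms vanish by independence and mean zero.\<close>

lemma expectation_points_sum:
  fixes g :: "'v \<Rightarrow> real"
  assumes g: "g \<in> borel_measurable borel" "\<And>x. \<bar>g x\<bar> \<le> D" and mean: "(\<integral>x. g x \<partial>\<mu>) = 0"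
  shows "expectation (\<lambda>\<omega>. (\<Sum>i\<in>{1..n}. g (points \<omega> i))\<^sup>2) = real n * (\<integral>x. (g x)\<^sup>2 \<partial>\<mu>)"
proof -
  have meas: "(\<lambda>\<omega>. g (points \<omega> i)) \<in> borel_measurable M" if "i \<in> {1..n}" for i
  proof -
    have "(\<lambda>\<omega>. g (X i \<omega>)) \<in> borel_measurable M"
      by (rule measurable_compose [OF X_meas [OF that] g(1)])
    then show ?thesis using that by (simp add: points_def)
  qed
  have int: "integrable M (\<lambda>\<omega>. g (points \<omega> i) * g (points \<omega> j))" if "i \<in> {1..n}" "j \<in> {1..n}" for i j
  proof (rule integrable_bounded)
    show "(\<lambda>\<omega>. g (points \<omega> i) * g (points \<omega> j)) \<in> borel_measurable M"
      by (intro borel_measurable_times meas that)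
    show "\<bar>g (points \<omega> i) * g (points \<omega> j)\<bar> \<le> D * D" for \<omega>
      unfolding abs_mult by (rule mult_mono' [OF g(2) g(2)]) auto
  qed
  have val: "expectation (\<lambda>\<omega>. g (points \<omega> i) * g (points \<omega> j)) = (if j = i then (\<integral>x. (g x)\<^sup>2 \<partial>\<mu>) else 0)"
    if ij: "i \<in> {1..n}" "j \<in> {1..n}" for i j
  proof (cases "i = j")
    case True
    have "(\<lambda>x. (g x)\<^sup>2) \<in> borel_measurable borel" using g(1) by simp
    from points_expectation [OF this ij(1)] show ?thesis using True by (simp add: power2_eq_square)
  next
    case False
    have "expectation (\<lambda>\<omega>. g (restrict (points \<omega>) {i} i) * g (restrict (points \<omega>) {j} j))
       = expectation (\<lambda>\<omega>. g (restrict (points \<omega>) {i} i)) * expectation (\<lambda>\<omega>. g (restrict (points \<omega>) {j} j))"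
      by (rule expectation_disjoint [where f = "\<lambda>x. g (x i)" and g = "\<lambda>x. g (x j)", OF _ _ _
            coordinate_measurable [OF g(1)] g(2) coordinate_measurable [OF g(1)] g(2)])
        (use False ij in auto)
    then show ?thesis
      using False points_expectation [OF g(1) ij(1)] mean by simp
  qed
  have "expectation (\<lambda>\<omega>. (\<Sum>i\<in>{1..n}. g (points \<omega> i))\<^sup>2)
      = expectation (\<lambda>\<omega>. \<Sum>i\<in>{1..n}. \<Sum>j\<in>{1..n}. g (points \<omega> i) * g (points \<omega> j))"
    unfolding power2_eq_square sum_product ..
  also have "\<dots> = (\<Sum>i\<in>{1..n}. expectation (\<lambda>\<omega>. \<Sum>j\<in>{1..n}. g (points \<omega> i) * g (points \<omega> j)))"
    by (intro Bochner_Integration.integral_sum Bochner_Integration.integrable_sum int)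
  also have "\<dots> = (\<Sum>i\<in>{1..n}. \<Sum>j\<in>{1..n}. expectation (\<lambda>\<omega>. g (points \<omega> i) * g (points \<omega> j)))"
    by (intro sum.cong refl Bochner_Integration.integral_sum int)
  also have "\<dots> = (\<Sum>i\<in>{1..n}. \<Sum>j\<in>{1..n}. if j = i then (\<integral>x. (g x)\<^sup>2 \<partial>\<mu>) else 0)"
    by (intro sum.cong refl val)
  also have "\<dots> = (\<Sum>i\<in>{1..n}. (\<integral>x. (g x)\<^sup>2 \<partial>\<mu>))"
    by (intro sum.cong refl) (simp add: sum.delta)
  finally show ?thesis by simp
qed

text \<open>A point outside the copy is independent of its edge weight and contributes 0, because g
  has mean zero. A point \<beta> l on the copy contributes an integral that does not depend on
  \<beta>, the points being i.i.d.\<close>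

lemma expectation_copies_times_sum:
  fixes g :: "'v \<Rightarrow> real"
  assumes G: "simple_graph V E" and V: "V \<noteq> {}"
    and g: "g \<in> borel_measurable borel" "\<And>x. \<bar>g x\<bar> \<le> D" and mean: "(\<integral>x. g x \<partial>\<mu>) = 0"
  shows "expectation (\<lambda>\<omega>. copies V E \<omega> * (\<Sum>i\<in>{1..n}. g (points \<omega> i)))
    = real (card (embeddings V n)) * (\<Sum>l\<in>V. \<integral>x. edge_weight p H E x * g (x l) \<partial>(\<Pi>\<^sub>M v\<in>V. \<mu>))"
proof -
  have finV: "finite V" and EV: "E \<subseteq> all_edges V" using G by (simp_all add: simple_graph_def)
  have p1: "p ^ card A \<le> 1" for A :: "nat set set" using p01 by (intro power_le_one) auto
  have meas: "(\<lambda>\<omega>. g (points \<omega> i)) \<in> borel_measurable M" if "i \<in> {1..n}" for i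
  proof -
    have "(\<lambda>\<omega>. g (X i \<omega>)) \<in> borel_measurable M"
      by (rule measurable_compose [OF X_meas [OF that] g(1)])
    then show ?thesis using that by (simp add: points_def)
  qed
  have int: "integrable M (\<lambda>\<omega>. of_bool (A \<subseteq> \<Gamma> \<omega>) * g (points \<omega> i))" if "A \<subseteq> all_edges {1..n}" "i \<in> {1..n}" for A i
  proof (rule integrable_bounded)
    show "(\<lambda>\<omega>. of_bool (A \<subseteq> \<Gamma> \<omega>) * g (points \<omega> i)) \<in> borel_measurable M"
      by (intro borel_measurable_times edges_indicator_measurable meas that)
    show "\<bar>of_bool (A \<subseteq> \<Gamma> \<omega>) * g (points \<omega> i)\<bar> \<le> D" for \<omega>
      using g(2) [of "points \<omega> i"] by (cases "A \<subseteq> \<Gamma> \<omega>") auto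
  qed
  have one: "expectation (\<lambda>\<omega>. of_bool (A \<subseteq> \<Gamma> \<omega>) * g (points \<omega> i)) = expectation (\<lambda>\<omega>. g (points \<omega> i) * edge_weight p H A (points \<omega>))"
    if A: "A \<subseteq> all_edges {1..n}" and i: "i \<in> {1..n}" for A i
  proof -
    have "expectation (\<lambda>\<omega>. of_bool (A \<subseteq> \<Gamma> \<omega>) * g (points \<omega> i))
        = expectation (\<lambda>\<omega>. g (points \<omega> i) * indicator {\<omega> \<in> space M. A \<subseteq> \<Gamma> \<omega>} \<omega>)"
      by (rule Bochner_Integration.integral_cong) (auto simp: indicator_def)
    also have "\<dots> = expectation (\<lambda>\<omega>. g (points \<omega> i) * edge_weight p H A (points \<omega>))"
      by (rule expectation_edges_times [where g = "\<lambda>x. g (x i)", OF A coordinate_measurable [OF g(1) i] g(2)])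
    finally show ?thesis .
  qed
  have inner: "expectation (\<lambda>\<omega>. of_bool (copy_edges E \<beta> \<subseteq> \<Gamma> \<omega>) * (\<Sum>i\<in>{1..n}. g (points \<omega> i)))
      = (\<Sum>l\<in>V. \<integral>x. edge_weight p H E x * g (x l) \<partial>(\<Pi>\<^sub>M v\<in>V. \<mu>))" if \<beta>: "\<beta> \<in> embeddings V n" for \<beta>
  proof -
    let ?A = "copy_edges E \<beta>"
    have A: "?A \<subseteq> all_edges {1..n}" by (rule copy_edges_subset [OF G \<beta>])
    have \<beta>V: "\<beta> ` V \<subseteq> {1..n}" and inj: "inj_on \<beta> V" using \<beta> by (auto simp: embeddings_def)
    have AJ: "?A \<subseteq> all_edges (\<beta> ` V)"
      using A Union_copy_edges [OF G, of \<beta>] by (fastforce simp: all_edges_def)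
    have zero: "expectation (\<lambda>\<omega>. g (points \<omega> i) * edge_weight p H ?A (points \<omega>)) = 0"
      if i: "i \<in> {1..n}" "i \<notin> \<beta> ` V" for i
    proof -
      have w1: "\<bar>edge_weight p H ?A x\<bar> \<le> 1" for x
        using weight_bounds [of ?A x] p1 [of ?A] by simp
      have "expectation (\<lambda>\<omega>. g (restrict (points \<omega>) {i} i) * edge_weight p H ?A (restrict (points \<omega>) (\<beta> ` V)))
        = expectation (\<lambda>\<omega>. g (restrict (points \<omega>) {i} i)) * expectation (\<lambda>\<omega>. edge_weight p H ?A (restrict (points \<omega>) (\<beta> ` V)))"
        by (rule expectation_disjoint [where f = "\<lambda>x. g (x i)", OF _ _ _
            coordinate_measurable [OF g(1)] g(2) edge_weight_measurable [OF H_meas AJ] w1])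
          (use i \<beta>V in auto)
      then show ?thesis
        using points_expectation [OF g(1) i(1)] mean by (simp add: edge_weight_restrict [OF AJ])
    qed
    have at_vertex: "expectation (\<lambda>\<omega>. g (points \<omega> (\<beta> l)) * edge_weight p H ?A (points \<omega>))
        = (\<integral>x. edge_weight p H E x * g (x l) \<partial>(\<Pi>\<^sub>M v\<in>V. \<mu>))" if l: "l \<in> V" for l
    proof -
      have "expectation (\<lambda>\<omega>. g (points \<omega> (\<beta> l)) * edge_weight p H ?A (points \<omega>))
          = expectation (\<lambda>\<omega>. edge_weight p H E (\<lambda>v\<in>V. points \<omega> (\<beta> v)) * g ((\<lambda>v\<in>V. points \<omega> (\<beta> v)) l))"
        using l by (simp add: edge_weight_copy_points [OF G \<beta>] mult.commute)
      also have "\<dots> = (\<integral>x. edge_weight p H E x * g (x l) \<partial>(\<Pi>\<^sub>M v\<in>V. \<mu>))"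
        by (rule expectation_embedding [where f = "\<lambda>x. edge_weight p H E x * g (x l)", OF V \<beta>])
          (intro borel_measurable_times edge_weight_measurable H_meas EV coordinate_measurable g l)
      finally show ?thesis .
    qed
    have "expectation (\<lambda>\<omega>. of_bool (?A \<subseteq> \<Gamma> \<omega>) * (\<Sum>i\<in>{1..n}. g (points \<omega> i)))
        = (\<Sum>i\<in>{1..n}. expectation (\<lambda>\<omega>. of_bool (?A \<subseteq> \<Gamma> \<omega>) * g (points \<omega> i)))"
      unfolding sum_distrib_left by (intro Bochner_Integration.integral_sum int A)
    also have "\<dots> = (\<Sum>i\<in>{1..n}. expectation (\<lambda>\<omega>. g (points \<omega> i) * edge_weight p H ?A (points \<omega>)))"
      by (intro sum.cong refl one A)
    also have "\<dots> = (\<Sum>i\<in>\<beta> ` V. expectation (\<lambda>\<omega>. g (points \<omega> i) * edge_weight p H ?A (points \<omega>)))"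
      by (rule sum.mono_neutral_right) (use \<beta>V zero in auto)
    also have "\<dots> = (\<Sum>l\<in>V. expectation (\<lambda>\<omega>. g (points \<omega> (\<beta> l)) * edge_weight p H ?A (points \<omega>)))"
      by (simp add: sum.reindex [OF inj])
    also have "\<dots> = (\<Sum>l\<in>V. \<integral>x. edge_weight p H E x * g (x l) \<partial>(\<Pi>\<^sub>M v\<in>V. \<mu>))"
      by (intro sum.cong refl at_vertex)
    finally show ?thesis .
  qed
  have int2: "integrable M (\<lambda>\<omega>. of_bool (copy_edges E \<beta> \<subseteq> \<Gamma> \<omega>) * (\<Sum>i\<in>{1..n}. g (points \<omega> i)))"
    if "\<beta> \<in> embeddings V n" for \<beta>
    unfolding sum_distrib_left by (intro Bochner_Integration.integrable_sum int copy_edges_subset [OF G that])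
  have "expectation (\<lambda>\<omega>. copies V E \<omega> * (\<Sum>i\<in>{1..n}. g (points \<omega> i)))
      = (\<Sum>\<beta>\<in>embeddings V n. expectation (\<lambda>\<omega>. of_bool (copy_edges E \<beta> \<subseteq> \<Gamma> \<omega>) * (\<Sum>i\<in>{1..n}. g (points \<omega> i))))"
    unfolding copies_def sum_distrib_right [of _ "embeddings V n"]
    by (intro Bochner_Integration.integral_sum int2)
  also have "\<dots> = (\<Sum>\<beta>\<in>embeddings V n. \<Sum>l\<in>V. \<integral>x. edge_weight p H E x * g (x l) \<partial>(\<Pi>\<^sub>M v\<in>V. \<mu>))"
    by (intro sum.cong refl inner)
  finally show ?thesis by simp
qed

end

lemma (in finite_measure) integrable_bounded_mult:
  fixes u v :: "'a \<Rightarrow> real"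
  assumes "u \<in> borel_measurable M" "\<And>\<omega>. \<bar>u \<omega>\<bar> \<le> C" "v \<in> borel_measurable M" "\<And>\<omega>. \<bar>v \<omega>\<bar> \<le> D"
  shows "integrable M (\<lambda>\<omega>. u \<omega> * v \<omega>)"
proof (rule integrable_bounded [of _ "C * D"])
  show "(\<lambda>\<omega>. u \<omega> * v \<omega>) \<in> borel_measurable M" using assms by simp
  show "\<bar>u \<omega> * v \<omega>\<bar> \<le> C * D" for \<omega>
    unfolding abs_mult by (rule mult_mono' [OF assms(2,4)]) auto
qed

context random_connection
begin

lemma subgraph_marginal_eq:
  "subgraph_marginal \<mu> H p V E l x = (\<integral>y. edge_weight p H E (y(l := x)) \<partial>(\<Pi>\<^sub>M i\<in>V - {l}. \<mu>)) / real (card (graph_automorphisms V E))"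
proof -
  have "(\<lambda>y. edge_weight p H E (y(l := x))) = (\<lambda>y. p ^ card E * (\<Prod>e\<in>E. H ((y(l := x)) (Min e)) ((y(l := x)) (Max e))))"
    by (simp only: edge_weight_def prod.distrib prod_constant)
  then show ?thesis by (simp add: subgraph_marginal_def)
qed

lemma edge_weight_upd_measurable:
  assumes E: "E \<subseteq> all_edges V" and l: "l \<in> V"
  shows "(\<lambda>(x, y). edge_weight p H E (y(l := x))) \<in> borel_measurable (\<mu> \<Otimes>\<^sub>M (\<Pi>\<^sub>M i\<in>V - {l}. \<mu>))"
proof -
  have ins: "insert l (V - {l}) = V" using l by auto
  have sets: "sets (\<Pi>\<^sub>M v\<in>V. \<mu>) = sets (\<Pi>\<^sub>M v\<in>V. borel)"
    by (rule sets_PiM_cong) (auto simp: mu)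
  have meas: "edge_weight p H E \<in> borel_measurable (\<Pi>\<^sub>M v\<in>V. \<mu>)"
    unfolding measurable_cong_sets [OF sets refl] by (rule edge_weight_measurable [OF H_meas E])
  have "(\<lambda>z. (snd z)(l := fst z)) \<in> measurable (\<mu> \<Otimes>\<^sub>M (\<Pi>\<^sub>M i\<in>V - {l}. \<mu>)) (\<Pi>\<^sub>M i\<in>V. \<mu>)"
    by (rule measurable_fun_upd [where J = "V - {l}"]) (use l in auto)
  from measurable_compose [OF this meas] show ?thesis by (simp add: case_prod_unfold)
qed

lemma subgraph_marginal_measurable:
  assumes E: "E \<subseteq> all_edges V" and l: "l \<in> V"
  shows "subgraph_marginal \<mu> H p V E l \<in> borel_measurable borel"
proof -
  interpret P: prob_space "\<Pi>\<^sub>M i\<in>V - {l}. \<mu>"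
    by (rule prob_space_PiM) (rule mu)
  have "(\<lambda>x. \<integral>y. edge_weight p H E (y(l := x)) \<partial>(\<Pi>\<^sub>M i\<in>V - {l}. \<mu>)) \<in> borel_measurable \<mu>"
    by (rule P.borel_measurable_lebesgue_integral [OF edge_weight_upd_measurable [OF E l]])
  then have "(\<lambda>x. \<integral>y. edge_weight p H E (y(l := x)) \<partial>(\<Pi>\<^sub>M i\<in>V - {l}. \<mu>)) \<in> borel_measurable borel"
    unfolding measurable_cong_sets [OF mu(2) refl] .
  then show ?thesis unfolding subgraph_marginal_eq [abs_def] by simp
qed

lemma edge_weight_upd_integrable:
  assumes E: "E \<subseteq> all_edges V" and l: "l \<in> V" and x: "x \<in> space \<mu>"
  shows "integrable (\<Pi>\<^sub>M i\<in>V - {l}. \<mu>) (\<lambda>y. edge_weight p H E (y(l := x)))"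
proof -
  interpret P: prob_space "\<Pi>\<^sub>M i\<in>V - {l}. \<mu>"
    by (rule prob_space_PiM) (rule mu)
  have "(\<lambda>y. edge_weight p H E (y(l := x))) \<in> borel_measurable (\<Pi>\<^sub>M i\<in>V - {l}. \<mu>)"
    using measurable_compose [OF measurable_Pair1' [OF x] edge_weight_upd_measurable [OF E l]] by simp
  then show ?thesis
    by (rule P.integrable_bounded [of _ "p ^ card E"]) (simp add: abs_of_nonneg weight_bounds)
qed

lemma subgraph_marginal_bounds:
  assumes E: "E \<subseteq> all_edges V" and l: "l \<in> V" and V: "finite V"
  shows "0 \<le> subgraph_marginal \<mu> H p V E l x" "subgraph_marginal \<mu> H p V E l x \<le> 1"
proof -
  interpret P: prob_space "\<Pi>\<^sub>M i\<in>V - {l}. \<mu>"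
    by (rule prob_space_PiM) (rule mu)
  have x: "x \<in> space \<mu>" using sets_eq_imp_space_eq [OF mu(2)] by simp
  let ?J = "\<integral>y. edge_weight p H E (y(l := x)) \<partial>(\<Pi>\<^sub>M i\<in>V - {l}. \<mu>)"
  have J0: "0 \<le> ?J" by (rule Bochner_Integration.integral_nonneg) (rule weight_bounds)
  have "?J \<le> (\<integral>y. 1 \<partial>(\<Pi>\<^sub>M i\<in>V - {l}. \<mu>))"
  proof (rule integral_mono [OF edge_weight_upd_integrable [OF E l x] P.integrable_const])
    fix y :: "nat \<Rightarrow> 'v"
    have "p ^ card E \<le> 1" using p01 by (intro power_le_one) auto
    then show "edge_weight p H E (y(l := x)) \<le> 1" using weight_bounds(2) order_trans by blast
  qed
  then have J1: "?J \<le> 1" by (simp add: P.prob_space)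
  have a: "1 \<le> real (card (graph_automorphisms V E))"
    using graph_automorphisms_pos [OF V, of E] by simp
  show "0 \<le> subgraph_marginal \<mu> H p V E l x"
    unfolding subgraph_marginal_eq using J0 by simp
  have "?J / real (card (graph_automorphisms V E)) \<le> ?J / 1"
    using J0 a by (intro divide_left_mono) auto
  then show "subgraph_marginal \<mu> H p V E l x \<le> 1"
    unfolding subgraph_marginal_eq using J1 by simp
qed

text \<open>Fubini with coordinate l outermost: integrating out the other vertices leaves the
  marginal, and the factor a(G) undoes its normalization.\<close>

lemma integral_edge_weight_times:
  fixes g :: "'v \<Rightarrow> real"
  assumes E: "E \<subseteq> all_edges V" and V: "finite V" and l: "l \<in> V"
    and g: "g \<in> borel_measurable borel" "\<And>x. \<bar>g x\<bar> \<le> D"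
  shows "(\<integral>x. edge_weight p H E x * g (x l) \<partial>(\<Pi>\<^sub>M v\<in>V. \<mu>))
    = real (card (graph_automorphisms V E)) * (\<integral>x. subgraph_marginal \<mu> H p V E l x * g x \<partial>\<mu>)"
proof -
  interpret mu: prob_space \<mu> by (rule mu)
  interpret P: prob_space "\<Pi>\<^sub>M i\<in>V - {l}. \<mu>"
    by (rule prob_space_PiM) (rule mu)
  interpret Q: prob_space "\<Pi>\<^sub>M i\<in>V. \<mu>"
    by (rule prob_space_PiM) (rule mu)
  interpret S: product_sigma_finite "\<lambda>_. \<mu>"
    by unfold_locales
  interpret PS: pair_prob_space \<mu> "\<Pi>\<^sub>M i\<in>V - {l}. \<mu>" ..
  let ?a = "real (card (graph_automorphisms V E))"
  have a: "0 < ?a" using graph_automorphisms_pos [OF V, of E] by simp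
  have ins: "insert l (V - {l}) = V" using l by auto
  have g\<mu>: "g \<in> borel_measurable \<mu>"
    unfolding measurable_cong_sets [OF mu(2) refl] by (rule g(1))
  have bnd: "\<bar>edge_weight p H E x * g u\<bar> \<le> D" for x u
  proof -
    have "p ^ card E \<le> 1" using p01 by (intro power_le_one) auto
    then have "\<bar>edge_weight p H E x\<bar> \<le> 1" using weight_bounds [of E x] by simp
    then have "\<bar>edge_weight p H E x\<bar> * \<bar>g u\<bar> \<le> 1 * D" by (intro mult_mono g(2)) auto
    then show ?thesis by (simp add: abs_mult)
  qed
  have sets: "sets (\<Pi>\<^sub>M v\<in>V. \<mu>) = sets (\<Pi>\<^sub>M v\<in>V. borel)"
    by (rule sets_PiM_cong) (auto simp: mu)
  have meas: "(\<lambda>x. edge_weight p H E x * g (x l)) \<in> borel_measurable (\<Pi>\<^sub>M v\<in>V. \<mu>)"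
    unfolding measurable_cong_sets [OF sets refl]
    by (intro borel_measurable_times edge_weight_measurable H_meas E coordinate_measurable g l)
  have int: "integrable (\<Pi>\<^sub>M v\<in>V. \<mu>) (\<lambda>x. edge_weight p H E x * g (x l))"
    by (rule Q.integrable_bounded [OF meas bnd])
  have meas2: "(\<lambda>(x, y). edge_weight p H E (y(l := x)) * g x) \<in> borel_measurable (\<mu> \<Otimes>\<^sub>M (\<Pi>\<^sub>M i\<in>V - {l}. \<mu>))"
  proof -
    have "(\<lambda>z. g (fst z)) \<in> borel_measurable (\<mu> \<Otimes>\<^sub>M (\<Pi>\<^sub>M i\<in>V - {l}. \<mu>))"
      by (rule measurable_compose [OF measurable_fst g\<mu>])
    with edge_weight_upd_measurable [OF E l] show ?thesis
      by (simp add: case_prod_unfold)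
  qed
  have int2: "integrable (\<mu> \<Otimes>\<^sub>M (\<Pi>\<^sub>M i\<in>V - {l}. \<mu>)) (\<lambda>(x, y). edge_weight p H E (y(l := x)) * g x)"
    by (rule PS.integrable_bounded [OF meas2, of D]) (simp add: case_prod_unfold bnd)
  have "(\<integral>x. edge_weight p H E x * g (x l) \<partial>(\<Pi>\<^sub>M v\<in>V. \<mu>))
      = (\<integral>y. (\<integral>x. edge_weight p H E (y(l := x)) * g x \<partial>\<mu>) \<partial>(\<Pi>\<^sub>M i\<in>V - {l}. \<mu>))"
    using S.product_integral_insert [of "V - {l}" l "\<lambda>x. edge_weight p H E x * g (x l)"] V int
    unfolding ins by simp
  also have "\<dots> = (\<integral>x. (\<integral>y. edge_weight p H E (y(l := x)) * g x \<partial>(\<Pi>\<^sub>M i\<in>V - {l}. \<mu>)) \<partial>\<mu>)"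
    by (rule PS.Fubini_integral [OF int2])
  also have "\<dots> = (\<integral>x. ?a * (subgraph_marginal \<mu> H p V E l x * g x) \<partial>\<mu>)"
    by (rule Bochner_Integration.integral_cong [OF refl]) (use a in \<open>simp add: subgraph_marginal_eq\<close>)
  finally show ?thesis by simp
qed

text \<open>Dense regime: by the Cauchy--Schwarz inequality, the variance is at least that of the
  projection onto sums of functions of single points.\<close>

lemma variance_copies_projection:
  assumes G: "simple_graph V E" and V: "V \<noteq> {}" and n: "1 \<le> n"
  defines "s \<equiv> \<lambda>x. \<Sum>l\<in>V. subgraph_marginal \<mu> H p V E l x"
  defines "\<sigma> \<equiv> (\<integral>x. (s x - (\<integral>x. s x \<partial>\<mu>))\<^sup>2 \<partial>\<mu>)"
  assumes \<sigma>: "0 < \<sigma>"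
  shows "(real (card (embeddings V n)) * real (card (graph_automorphisms V E)))\<^sup>2 * \<sigma> / real n \<le> variance (copies V E)"
proof -
  interpret mu: prob_space \<mu> by (rule mu)
  have finV: "finite V" and E: "E \<subseteq> all_edges V" using G by (simp_all add: simple_graph_def)
  let ?I = "real (card (embeddings V n))" and ?a = "real (card (graph_automorphisms V E))"
  let ?k = "real (card V)"
  have s_meas: "s \<in> borel_measurable borel"
    unfolding s_def by (intro borel_measurable_sum subgraph_marginal_measurable E)
  have s0: "0 \<le> s x" for x
    unfolding s_def by (intro sum_nonneg subgraph_marginal_bounds E finV)
  have sk: "s x \<le> ?k" for x
  proof -
    have "s x \<le> (\<Sum>l\<in>V. 1)"
      unfolding s_def by (intro sum_mono subgraph_marginal_bounds E finV)
    then show ?thesis by simp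
  qed
  have to_mu: "h \<in> borel_measurable \<mu>" if "h \<in> borel_measurable borel" for h :: "'v \<Rightarrow> real"
    unfolding measurable_cong_sets [OF mu(2) refl] by (rule that)
  have s_int: "integrable \<mu> s"
    by (rule mu.integrable_bounded [OF to_mu [OF s_meas], of ?k]) (simp add: abs_of_nonneg s0 sk)
  define m where "m = (\<integral>x. s x \<partial>\<mu>)"
  define g where "g x = s x - m" for x
  have g_meas: "g \<in> borel_measurable borel" unfolding g_def [abs_def] using s_meas by simp
  define D where "D = ?k + \<bar>m\<bar>"
  have g_bnd: "\<bar>g x\<bar> \<le> D" for x using s0 [of x] sk [of x] by (simp add: g_def D_def)
  have g_int: "integrable \<mu> g" by (rule mu.integrable_bounded [OF to_mu [OF g_meas] g_bnd])
  have g_mean: "(\<integral>x. g x \<partial>\<mu>) = 0"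
    unfolding g_def using s_int by (simp add: m_def mu.prob_space)
  have g_sq: "(\<integral>x. (g x)\<^sup>2 \<partial>\<mu>) = \<sigma>"
    unfolding \<sigma>_def g_def m_def ..
  define W where "W \<omega> = (\<Sum>i\<in>{1..n}. g (points \<omega> i))" for \<omega>
  have pt_meas: "(\<lambda>\<omega>. g (points \<omega> i)) \<in> borel_measurable M" if "i \<in> {1..n}" for i
  proof -
    have "(\<lambda>\<omega>. g (X i \<omega>)) \<in> borel_measurable M"
      by (rule measurable_compose [OF X_meas [OF that] g_meas])
    then show ?thesis using that by (simp add: points_def)
  qed
  have W_meas: "W \<in> borel_measurable M"
    unfolding W_def [abs_def] by (intro borel_measurable_sum pt_meas)
  have W_bnd: "\<bar>W \<omega>\<bar> \<le> real n * D" for \<omega>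
  proof -
    have "\<bar>W \<omega>\<bar> \<le> (\<Sum>i\<in>{1..n}. \<bar>g (points \<omega> i)\<bar>)" unfolding W_def by (rule sum_abs)
    also have "\<dots> \<le> (\<Sum>i\<in>{1..n}. D)" by (intro sum_mono g_bnd)
    finally show ?thesis by simp
  qed
  have W_int: "integrable M W" by (rule integrable_bounded [OF W_meas W_bnd])
  have W_sq: "expectation (\<lambda>\<omega>. (W \<omega>)\<^sup>2) = real n * \<sigma>"
    unfolding W_def expectation_points_sum [OF g_meas g_bnd g_mean] g_sq ..
  have W_mean: "expectation W = 0"
  proof -
    have "expectation W = (\<Sum>i\<in>{1..n}. expectation (\<lambda>\<omega>. g (points \<omega> i)))"
      unfolding W_def [abs_def]
      by (intro Bochner_Integration.integral_sum integrable_bounded [OF pt_meas g_bnd])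
    also have "\<dots> = 0"
      using points_expectation [OF g_meas] g_mean by (intro sum.neutral) auto
    finally show ?thesis .
  qed
  \<comment> \<open>The sum is the integral of s g = g^2 + m g, and g has mean zero.\<close>
  have sg: "(\<Sum>l\<in>V. \<integral>x. subgraph_marginal \<mu> H p V E l x * g x \<partial>\<mu>) = \<sigma>"
  proof -
    have prod_bnd: "\<bar>u * g x\<bar> \<le> D" if "0 \<le> u" "u \<le> 1" for u x
    proof -
      have "\<bar>u\<bar> * \<bar>g x\<bar> \<le> 1 * D" using that by (intro mult_mono g_bnd) auto
      then show ?thesis by (simp add: abs_mult)
    qed
    have int_l: "integrable \<mu> (\<lambda>x. subgraph_marginal \<mu> H p V E l x * g x)" if "l \<in> V" for l
      by (rule mu.integrable_bounded [OF _ prod_bnd [OF subgraph_marginal_bounds [OF E that finV]]])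
        (intro borel_measurable_times to_mu subgraph_marginal_measurable E that g_meas)
    have "(\<Sum>l\<in>V. \<integral>x. subgraph_marginal \<mu> H p V E l x * g x \<partial>\<mu>) = (\<integral>x. (\<Sum>l\<in>V. subgraph_marginal \<mu> H p V E l x * g x) \<partial>\<mu>)"
      by (intro Bochner_Integration.integral_sum [symmetric] int_l)
    also have "\<dots> = (\<integral>x. (g x)\<^sup>2 + m * g x \<partial>\<mu>)"
    proof (rule Bochner_Integration.integral_cong [OF refl])
      fix x
      have "(\<Sum>l\<in>V. subgraph_marginal \<mu> H p V E l x * g x) = s x * g x"
        unfolding s_def by (rule sum_distrib_right [symmetric])
      then show "(\<Sum>l\<in>V. subgraph_marginal \<mu> H p V E l x * g x) = (g x)\<^sup>2 + m * g x"
        by (simp add: g_def power2_eq_square algebra_simps)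
    qed
    also have "\<dots> = (\<integral>x. (g x)\<^sup>2 \<partial>\<mu>) + (\<integral>x. m * g x \<partial>\<mu>)"
    proof (rule Bochner_Integration.integral_add)
      have "\<bar>(g x)\<^sup>2\<bar> \<le> D\<^sup>2" for x using g_bnd [of x] by (simp add: abs_le_square_iff [symmetric] D_def)
      then show "integrable \<mu> (\<lambda>x. (g x)\<^sup>2)"
        by (rule mu.integrable_bounded [rotated]) (use to_mu [OF g_meas] in simp)
    qed (use g_int in simp)
    also have "\<dots> = \<sigma>" using g_mean g_sq by simp
    finally show ?thesis .
  qed
  have TW: "expectation (\<lambda>\<omega>. copies V E \<omega> * W \<omega>) = ?I * ?a * \<sigma>"
  proof -
    have "expectation (\<lambda>\<omega>. copies V E \<omega> * W \<omega>) = ?I * (\<Sum>l\<in>V. \<integral>x. edge_weight p H E x * g (x l) \<partial>(\<Pi>\<^sub>M v\<in>V. \<mu>))"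
      unfolding W_def by (rule expectation_copies_times_sum [OF G V g_meas g_bnd g_mean])
    also have "(\<Sum>l\<in>V. \<integral>x. edge_weight p H E x * g (x l) \<partial>(\<Pi>\<^sub>M v\<in>V. \<mu>))
        = (\<Sum>l\<in>V. ?a * (\<integral>x. subgraph_marginal \<mu> H p V E l x * g x \<partial>\<mu>))"
      by (intro sum.cong refl integral_edge_weight_times [OF E finV _ g_meas g_bnd])
    also have "\<dots> = ?a * \<sigma>" unfolding sum_distrib_left [symmetric] sg ..
    finally show ?thesis by (simp only: mult.assoc)
  qed
  define T where "T \<omega> = copies V E \<omega> - expectation (copies V E)" for \<omega>
  have T_meas: "T \<in> borel_measurable M" unfolding T_def [abs_def] using copies_measurable [OF G] by simp
  define B where "B = ?I + \<bar>expectation (copies V E)\<bar>"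
  have T_bnd: "\<bar>T \<omega>\<bar> \<le> B" for \<omega>
    using copies_bounds [of V E \<omega>] by (simp add: T_def B_def)
  have copies_bnd: "\<bar>copies V E \<omega>\<bar> \<le> ?I" for \<omega>
    using copies_bounds [of V E \<omega>] by simp
  have i1: "integrable M (\<lambda>\<omega>. T \<omega> * T \<omega>)"
    by (rule integrable_bounded_mult [OF T_meas T_bnd T_meas T_bnd])
  have i2: "integrable M (\<lambda>\<omega>. T \<omega> * W \<omega>)"
    by (rule integrable_bounded_mult [OF T_meas T_bnd W_meas W_bnd])
  have i3: "integrable M (\<lambda>\<omega>. W \<omega> * W \<omega>)"
    by (rule integrable_bounded_mult [OF W_meas W_bnd W_meas W_bnd])
  have i4: "integrable M (\<lambda>\<omega>. copies V E \<omega> * W \<omega>)"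
    by (rule integrable_bounded_mult [OF copies_measurable [OF G] copies_bnd W_meas W_bnd])
  have TW': "expectation (\<lambda>\<omega>. T \<omega> * W \<omega>) = ?I * ?a * \<sigma>"
  proof -
    have "expectation (\<lambda>\<omega>. T \<omega> * W \<omega>) = expectation (\<lambda>\<omega>. copies V E \<omega> * W \<omega> - expectation (copies V E) * W \<omega>)"
      unfolding T_def by (simp add: left_diff_distrib)
    also have "\<dots> = expectation (\<lambda>\<omega>. copies V E \<omega> * W \<omega>) - expectation (copies V E) * expectation W"
      using i4 W_int by simp
    finally show ?thesis using TW W_mean by simp
  qed
  \<comment> \<open>The minimizer E (T W) / E W^2 of E (T - t W)^2; nonnegativity of this square is
    the Cauchy--Schwarz step.\<close>
  define t where "t = ?I * ?a / real n"
  have "0 \<le> expectation (\<lambda>\<omega>. (T \<omega> - t * W \<omega>)\<^sup>2)"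
    by (rule Bochner_Integration.integral_nonneg) simp
  also have "\<dots> = expectation (\<lambda>\<omega>. T \<omega> * T \<omega> - 2 * t * (T \<omega> * W \<omega>) + t\<^sup>2 * (W \<omega> * W \<omega>))"
    by (rule Bochner_Integration.integral_cong) (auto simp: power2_eq_square algebra_simps)
  also have "\<dots> = expectation (\<lambda>\<omega>. T \<omega> * T \<omega>) - 2 * t * expectation (\<lambda>\<omega>. T \<omega> * W \<omega>) + t\<^sup>2 * expectation (\<lambda>\<omega>. W \<omega> * W \<omega>)"
    using i1 i2 i3 by simp
  also have "\<dots> = variance (copies V E) - 2 * t * (?I * ?a * \<sigma>) + t\<^sup>2 * (real n * \<sigma>)"
    using TW' W_sq by (simp add: T_def power2_eq_square)
  also have "t\<^sup>2 * (real n * \<sigma>) = t * (?I * ?a * \<sigma>)"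
    using n by (simp add: t_def power2_eq_square)
  finally have "t * (?I * ?a * \<sigma>) \<le> variance (copies V E)" by (simp add: mult_ac)
  moreover have "t * (?I * ?a * \<sigma>) = (?I * ?a)\<^sup>2 * \<sigma> / real n"
    by (simp add: t_def power2_eq_square)
  ultimately show ?thesis by simp
qed

end

section \<open>Moderate deviations of subgraph counts\<close>

text \<open>Elementary bounds: j^j \<le> e^j j!, k j + 1 \<le> (2 (k + 1))^j and j^j \<le> 4^j j^(j
  - 2). The last one lowers the exponent of j from k j to k (j - 2), the form required by
  \<open>trunc_mgf_bound\<close>, at the price of a constant to the power j.\<close>

lemma factorial_growth:
  fixes k j :: nat
  assumes j: "3 \<le> j"
  shows "real j ^ j * ((real (k * j) + 1) * real (k * j) ^ (k * j)) / fact j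
    \<le> (exp 1 * (2 * (real k + 1)) * (real k ^ k * 4 ^ k)) ^ j * real j ^ (k * (j - 2))"
proof -
  have A: "real j ^ j / fact j \<le> exp 1 ^ j"
  proof -
    have "real j ^ j / fact j \<le> trunc_exp j (real j)"
      unfolding trunc_exp_def by (rule member_le_sum [where f = "\<lambda>i. real j ^ i / fact i"]) auto
    also have "\<dots> \<le> exp (real j)" by (rule trunc_exp_le_exp) simp
    also have "\<dots> = exp 1 ^ j" by (simp flip: exp_of_nat_mult)
    finally show ?thesis .
  qed
  have j2: "real j \<le> 2 ^ j" using of_nat_less_two_power [of j, where 'a = real] by simp
  have B: "real (k * j) + 1 \<le> (2 * (real k + 1)) ^ j"
  proof -
    have "real (k * j) + 1 \<le> real k * 2 ^ j + 2 ^ j"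
    proof -
      have "real k * real j \<le> real k * 2 ^ j" by (rule mult_left_mono [OF j2]) simp
      moreover have "(1::real) \<le> 2 ^ j" by simp
      ultimately show ?thesis unfolding of_nat_mult by linarith
    qed
    also have "\<dots> = (real k + 1) ^ 1 * 2 ^ j" by (simp add: distrib_right)
    also have "\<dots> \<le> (real k + 1) ^ j * 2 ^ j"
      using j by (intro mult_right_mono power_increasing) auto
    finally show ?thesis unfolding power_mult_distrib by (simp only: mult.commute)
  qed
  have C: "real (k * j) ^ (k * j) \<le> (real k ^ k * 4 ^ k) ^ j * real j ^ (k * (j - 2))"
  proof -
    have jj: "2 + (j - 2) = j" using j by simp
    have "real j ^ j = real j ^ 2 * real j ^ (j - 2)" unfolding power_add [symmetric] jj ..
    also have "\<dots> \<le> (2 ^ j) ^ 2 * real j ^ (j - 2)"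
      using j2 by (intro mult_right_mono power_mono) auto
    also have "(2 ^ j) ^ 2 = (4 :: real) ^ j"
    proof -
      have "(2 ^ j) ^ 2 = ((2 :: real) ^ 2) ^ j" unfolding power_mult [symmetric] by (simp only: mult.commute)
      then show ?thesis by simp
    qed
    finally have jj: "(real j ^ j) ^ k \<le> (4 ^ j * real j ^ (j - 2)) ^ k"
      by (intro power_mono) auto
    have "real (k * j) ^ (k * j) = real k ^ (k * j) * (real j ^ j) ^ k"
      by (simp add: power_mult_distrib power_mult [symmetric] mult.commute [of j k])
    also have "\<dots> \<le> real k ^ (k * j) * (4 ^ j * real j ^ (j - 2)) ^ k"
      using jj by (intro mult_left_mono) auto
    also have "\<dots> = (real k ^ k * 4 ^ k) ^ j * real j ^ (k * (j - 2))"
      by (simp add: power_mult_distrib power_mult [symmetric] mult.commute [of j k] mult.commute [of "j - 2" k])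
    finally show ?thesis .
  qed
  have "real j ^ j * ((real (k * j) + 1) * real (k * j) ^ (k * j)) / fact j
      = (real j ^ j / fact j) * ((real (k * j) + 1) * real (k * j) ^ (k * j))" by simp
  also have "\<dots> \<le> exp 1 ^ j * ((2 * (real k + 1)) ^ j * ((real k ^ k * 4 ^ k) ^ j * real j ^ (k * (j - 2))))"
    by (intro mult_mono A B C) auto
  also have "\<dots> = (exp 1 * (2 * (real k + 1)) * (real k ^ k * 4 ^ k)) ^ j * real j ^ (k * (j - 2))"
    by (simp only: power_mult_distrib mult.assoc)
  finally show ?thesis .
qed

lemma subgraph_marginal_scale:
  "subgraph_marginal \<mu> H p V E l x = p ^ card E * subgraph_marginal \<mu> H 1 V E l x"
  by (simp add: subgraph_marginal_def)

context random_connection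
begin

text \<open>The edge parameter q is kept free: for q = 1 the value does not depend on n and serves
  as a constant in the asymptotics.\<close>

definition marginal_variance :: "nat set \<Rightarrow> nat set set \<Rightarrow> real \<Rightarrow> real" where
  "marginal_variance V E q =
     (\<integral>x. ((\<Sum>l\<in>V. subgraph_marginal \<mu> H q V E l x) - (\<integral>x. (\<Sum>l\<in>V. subgraph_marginal \<mu> H q V E l x) \<partial>\<mu>))\<^sup>2 \<partial>\<mu>)"

lemma marginal_variance_scale: "marginal_variance V E p = (p ^ card E)\<^sup>2 * marginal_variance V E 1"
proof -
  have "(\<Sum>l\<in>V. subgraph_marginal \<mu> H p V E l x) = p ^ card E * (\<Sum>l\<in>V. subgraph_marginal \<mu> H 1 V E l x)" for x
    by (simp only: subgraph_marginal_scale [of \<mu> H p] sum_distrib_left)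
  then show ?thesis
    unfolding marginal_variance_def
    by (simp add: right_diff_distrib [symmetric] power_mult_distrib del: right_diff_distrib)
qed

lemma copy_prob_scale: "copy_prob V E = p ^ card E * (\<integral>x. edge_weight 1 H E x \<partial>(\<Pi>\<^sub>M v\<in>V. \<mu>))"
  by (simp add: copy_prob_def edge_weight_def prod.distrib)

lemma marginal_variance_points:
  assumes G: "simple_graph V E" and n: "1 \<le> n"
  shows "variance (\<lambda>\<omega>. \<Sum>l\<in>V. subgraph_marginal \<mu> H p V E l (X 1 \<omega>)) = marginal_variance V E p"
proof -
  have E: "E \<subseteq> all_edges V" using G by (simp add: simple_graph_def)
  let ?s = "\<lambda>x. \<Sum>l\<in>V. subgraph_marginal \<mu> H p V E l x"
  have i: "1 \<in> {1..n}" using n by simp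
  have meas: "?s \<in> borel_measurable borel"
    by (intro borel_measurable_sum subgraph_marginal_measurable E)
  have P: "points \<omega> 1 = X 1 \<omega>" for \<omega> using n by (simp add: points_def)
  have m: "expectation (\<lambda>\<omega>. ?s (X 1 \<omega>)) = (\<integral>x. ?s x \<partial>\<mu>)"
    using points_expectation [OF meas i] unfolding P .
  have "(\<lambda>x. (?s x - (\<integral>x. ?s x \<partial>\<mu>))\<^sup>2) \<in> borel_measurable borel" using meas by simp
  from points_expectation [OF this i] show ?thesis
    unfolding P m marginal_variance_def .
qed

text \<open>Each marginal is nonnegative and integrates to the copy probability divided by a(G). If
  that were 0, the sum of the marginals, being at most card V, would have second moment at most card
  V times its mean 0, against the positive variance.\<close>

lemma copy_prob_pos:
  assumes G: "simple_graph V E" and pos: "0 < marginal_variance V E p"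
  shows "0 < copy_prob V E"
proof (rule ccontr)
  assume "\<not> 0 < copy_prob V E"
  then have zero: "copy_prob V E = 0" using copy_prob_bounds(1) [OF G] by simp
  interpret mu: prob_space \<mu> by (rule mu)
  have finV: "finite V" and E: "E \<subseteq> all_edges V" using G by (simp_all add: simple_graph_def)
  let ?s = "\<lambda>x. \<Sum>l\<in>V. subgraph_marginal \<mu> H p V E l x"
  have bnd: "0 \<le> ?s x" "?s x \<le> real (card V)" for x
  proof -
    show "0 \<le> ?s x" by (intro sum_nonneg subgraph_marginal_bounds E finV)
    have "?s x \<le> (\<Sum>l\<in>V. 1)" by (intro sum_mono subgraph_marginal_bounds E finV)
    then show "?s x \<le> real (card V)" by simp
  qed
  have to_mu: "h \<in> borel_measurable \<mu>" if "h \<in> borel_measurable borel" for h :: "'v \<Rightarrow> real"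
    unfolding measurable_cong_sets [OF mu(2) refl] by (rule that)
  have marg_int: "integrable \<mu> (subgraph_marginal \<mu> H p V E l)" if "l \<in> V" for l
    by (rule mu.integrable_bounded [OF to_mu [OF subgraph_marginal_measurable [OF E that]], of 1])
      (simp add: abs_of_nonneg subgraph_marginal_bounds [OF E that finV])
  have s_meas: "?s \<in> borel_measurable \<mu>"
    by (intro to_mu borel_measurable_sum subgraph_marginal_measurable E)
  have s_int: "integrable \<mu> ?s"
    by (intro Bochner_Integration.integrable_sum marg_int)
  have s_abs: "\<bar>?s x\<bar> \<le> real (card V)" for x using bnd [of x] by simp
  have mean0: "(\<integral>x. ?s x \<partial>\<mu>) = 0"
  proof -
    have "(\<integral>x. subgraph_marginal \<mu> H p V E l x \<partial>\<mu>) = 0" if l: "l \<in> V" for l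
    proof -
      have one: "(\<lambda>_::'v. 1::real) \<in> borel_measurable borel" by simp
      have "real (card (graph_automorphisms V E)) * (\<integral>x. subgraph_marginal \<mu> H p V E l x * 1 \<partial>\<mu>) = copy_prob V E"
        unfolding copy_prob_def
        using integral_edge_weight_times [OF E finV l one, of 1] by simp
      then show ?thesis using zero graph_automorphisms_pos [OF finV, of E] by simp
    qed
    then show ?thesis
      by (simp add: Bochner_Integration.integral_sum marg_int)
  qed
  have "marginal_variance V E p = (\<integral>x. ?s x * ?s x \<partial>\<mu>)"
    unfolding marginal_variance_def mean0 by (simp add: power2_eq_square)
  also have "\<dots> \<le> (\<integral>x. real (card V) * ?s x \<partial>\<mu>)"
  proof (rule integral_mono)
    show "integrable \<mu> (\<lambda>x. ?s x * ?s x)"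
      by (rule mu.integrable_bounded_mult [OF s_meas s_abs s_meas s_abs])
    show "integrable \<mu> (\<lambda>x. real (card V) * ?s x)"
      by (rule integrable_mult_right [OF s_int])
    show "?s x * ?s x \<le> real (card V) * ?s x" for x
      by (rule mult_right_mono [OF bnd(2) bnd(1)])
  qed
  also have "\<dots> = real (card V) * (\<integral>x. ?s x \<partial>\<mu>)" by (rule integral_mult_right_zero)
  finally show False using pos mean0 by simp
qed

lemma variance_subgraph_count:
  assumes "finite E"
  shows "variance (\<lambda>\<omega>. subgraph_count V E n (\<Gamma> \<omega>)) = variance (copies V E) / (real (card (graph_automorphisms V E)))\<^sup>2"
  unfolding subgraph_count_eq [OF assms]
  by (simp add: diff_divide_distrib [symmetric] power_divide)

text \<open>There are at least (n / 2)^k embeddings, whose square accounts for 4^k. The bound is on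
  the variance times n because \<Phi> = n in the dense regime.\<close>

lemma variance_dense:
  assumes G: "simple_graph V E" and V: "V \<noteq> {}" and n: "1 \<le> n" "2 * card V \<le> n" and pos: "0 < marginal_variance V E 1"
  shows "marginal_variance V E 1 / 4 ^ card V * (real n ^ card V * p ^ card E)\<^sup>2
    \<le> variance (\<lambda>\<omega>. subgraph_count V E n (\<Gamma> \<omega>)) * real n"
proof -
  have finV: "finite V" using G by (simp add: simple_graph_def)
  have finE: "finite E" using G finite_all_edges [OF finV] finite_subset by (auto simp: simple_graph_def)
  let ?a = "real (card (graph_automorphisms V E))" and ?I = "real (card (embeddings V n))" and ?S = "marginal_variance V E 1"
  have a: "0 < ?a" using graph_automorphisms_pos [OF finV, of E] by simp
  have posp: "0 < marginal_variance V E p" unfolding marginal_variance_scale using pos p01 by simp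
  have "(?I * ?a)\<^sup>2 * marginal_variance V E p / real n \<le> variance (copies V E)"
    using variance_copies_projection [OF G V n(1)] posp unfolding marginal_variance_def by blast
  then have "(?I\<^sup>2 * marginal_variance V E p) * ?a\<^sup>2 \<le> (variance (copies V E)) * real n"
    using n by (simp add: power_mult_distrib field_simps)
  then have I: "?I\<^sup>2 * marginal_variance V E p \<le> variance (\<lambda>\<omega>. subgraph_count V E n (\<Gamma> \<omega>)) * real n"
    unfolding variance_subgraph_count [OF finE] using a by (simp add: pos_le_divide_eq)
  have "?S / 4 ^ card V * (real n ^ card V * p ^ card E)\<^sup>2 = ((real n / 2) ^ card V)\<^sup>2 * marginal_variance V E p"
  proof -
    have "(4::real) ^ card V = (2 ^ card V)\<^sup>2" by (simp add: power_even_eq [symmetric] power_mult)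
    then show ?thesis unfolding marginal_variance_scale by (simp add: power_divide power_mult_distrib)
  qed
  also have "\<dots> \<le> ?I\<^sup>2 * marginal_variance V E p"
    using posp card_embeddings_ge [OF finV refl n(2)] by (intro mult_right_mono power_mono) auto
  finally show ?thesis using I by linarith
qed

text \<open>Multiplied by Q, which is \<Phi> in the sparse regime, this takes the same form c Q^2
  \<le> Var \<Phi> as the dense bound. The square of a(G) converts from labelled copies to the
  subgraph count.\<close>

lemma variance_sparse:
  assumes G: "simple_graph V E" and V: "V \<noteq> {}" and n: "2 * card V \<le> n"
    and small: "real (card V ^ 2 * n ^ (card V - 1)) * p ^ card E \<le> 1 / 2"
  shows "(\<integral>x. edge_weight 1 H E x \<partial>(\<Pi>\<^sub>M v\<in>V. \<mu>)) / (2 * 2 ^ card V * (real (card (graph_automorphisms V E)))\<^sup>2) * (real n ^ card V * p ^ card E)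
    \<le> variance (\<lambda>\<omega>. subgraph_count V E n (\<Gamma> \<omega>))"
proof -
  have finV: "finite V" using G by (simp add: simple_graph_def)
  have finE: "finite E" using G finite_all_edges [OF finV] finite_subset by (auto simp: simple_graph_def)
  let ?a = "real (card (graph_automorphisms V E))" and ?I = "real (card (embeddings V n))"
  let ?r = "\<integral>x. edge_weight 1 H E x \<partial>(\<Pi>\<^sub>M v\<in>V. \<mu>)"
  have a: "0 < ?a" using graph_automorphisms_pos [OF finV, of E] by simp
  have "?r / (2 * 2 ^ card V * ?a\<^sup>2) * (real n ^ card V * p ^ card E) = (real n / 2) ^ card V * copy_prob V E / 2 / ?a\<^sup>2"
    unfolding copy_prob_scale by (simp add: power_divide mult_ac)
  also have "\<dots> \<le> ?I * copy_prob V E / 2 / ?a\<^sup>2"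
    using copy_prob_bounds(1) [OF G] card_embeddings_ge [OF finV refl n]
    by (intro divide_right_mono mult_right_mono) auto
  also have "\<dots> \<le> variance (copies V E) / ?a\<^sup>2"
    using variance_copies_diagonal [OF G V refl small] by (intro divide_right_mono) auto
  finally show ?thesis unfolding variance_subgraph_count [OF finE] .
qed

lemma normalized_subgraph_count:
  assumes finE: "finite E" and finV: "finite V"
  shows "normalized M (\<lambda>\<omega>. subgraph_count V E n (\<Gamma> \<omega>)) \<omega> =
    (1 / sqrt (variance (copies V E))) * (copies V E \<omega> - expectation (copies V E))"
proof -
  let ?a = "real (card (graph_automorphisms V E))"
  have a: "0 < ?a" using graph_automorphisms_pos [OF finV, of E] by simp
  have "sqrt (variance (copies V E) / ?a\<^sup>2) = sqrt (variance (copies V E)) / ?a"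
    using a by (simp add: real_sqrt_divide)
  then show ?thesis
    unfolding normalized_def variance_subgraph_count [OF finE] unfolding subgraph_count_eq [OF finE]
    using a by (simp add: diff_divide_distrib [symmetric])
qed

text \<open>Centring changes only the first cumulant, and scaling by 1 / sqrt v multiplies the j-th
  one by v^(- j / 2).\<close>

lemma normalized_cumulants:
  assumes G: "simple_graph V E" and pos: "0 < variance (\<lambda>\<omega>. subgraph_count V E n (\<Gamma> \<omega>))"
  defines "Z \<equiv> normalized M (\<lambda>\<omega>. subgraph_count V E n (\<Gamma> \<omega>))"
  shows "integrable M (\<lambda>\<omega>. Z \<omega> ^ j)" "cumulants (moments M Z) 1 = 0" "cumulants (moments M Z) 2 = 1"
    "2 \<le> j \<Longrightarrow> cumulants (moments M Z) j = cumulants (moments M (copies V E)) j / sqrt (variance (copies V E)) ^ j"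
proof -
  have finV: "finite V" using G by (simp add: simple_graph_def)
  have finE: "finite E" using G finite_all_edges [OF finV] finite_subset by (auto simp: simple_graph_def)
  let ?T = "copies V E"
  define v where "v = variance ?T"
  define c where "c = expectation ?T"
  have v: "0 < v"
    using pos unfolding variance_subgraph_count [OF finE] v_def by (simp add: zero_less_divide_iff)
  have Z: "Z = (\<lambda>\<omega>. (1 / sqrt v) * (?T \<omega> - c))"
    unfolding Z_def v_def c_def by (rule ext) (rule normalized_subgraph_count [OF finE finV])
  note intT = copies_power_integrable [OF G]
  have mom: "moments M Z = (\<lambda>j. (1 / sqrt v) ^ j * moments M (\<lambda>\<omega>. ?T \<omega> - c) j)"
    unfolding Z by (rule moments_scale)
  have shift: "cumulants (moments M Z) (Suc m) = (1 / sqrt v) ^ Suc m * (cumulants (moments M ?T) (Suc m) - (if m = 0 then c else 0))" for m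
    unfolding mom cumulants_scale cumulants_moments_shift [OF intT] ..
  have T1: "moments M ?T 1 = c" by (simp add: moments_def c_def)
  show "integrable M (\<lambda>\<omega>. Z \<omega> ^ j)"
  proof -
    let ?B = "(1 / sqrt v) * (real (card (embeddings V n)) + \<bar>c\<bar>)"
    have "\<bar>Z \<omega>\<bar> \<le> ?B" for \<omega>
      unfolding Z abs_mult using v copies_bounds [of V E \<omega>] by (intro mult_mono) auto
    then have "\<bar>Z \<omega> ^ j\<bar> \<le> ?B ^ j" for \<omega>
      unfolding power_abs by (intro power_mono) auto
    then show ?thesis
      by (rule integrable_bounded [rotated]) (use copies_measurable [OF G] in \<open>simp add: Z\<close>)
  qed
  show "cumulants (moments M Z) 1 = 0"
    using shift [of 0] T1 by (simp add: cumulants_1)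
  show higher: "cumulants (moments M Z) j = cumulants (moments M ?T) j / sqrt (variance ?T) ^ j" if "2 \<le> j" for j
  proof -
    have "j = Suc (j - 1)" "j - 1 \<noteq> 0" using that by simp_all
    then obtain m where m: "j = Suc m" "m \<noteq> 0" by blast
    show ?thesis unfolding m shift using m by (simp add: v_def power_divide)
  qed
  show "cumulants (moments M Z) 2 = 1"
  proof -
    have "cumulants (moments M ?T) 2 = v"
    proof -
      have "v = expectation (\<lambda>\<omega>. (?T \<omega>)\<^sup>2) - (expectation ?T)\<^sup>2"
        unfolding v_def using intT [of 1] intT [of 2] by (intro variance_eq) simp_all
      then show ?thesis by (simp add: cumulants_2 moments_def)
    qed
    then show ?thesis using higher [of 2] v unfolding v_def [symmetric] by simp
  qed
qed

text \<open>With s^2 = \<Phi> the variance hypothesis reads Q / \<sigma> \<le> s / sqrt c, so Q^j /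
  (\<sigma>^j \<Phi>^(j - 1)) is at most c^(- j / 2) s^(2 - j): the power j - 2 appears because
  \<Phi>^(j - 1) = s^j s^(j - 2).\<close>

lemma normalized_cumulant_bound:
  assumes G: "simple_graph V E" "strongly_balanced V E" "2 \<le> card V" and n: "1 \<le> n" and c: "0 < c"
  defines "Q \<equiv> real n ^ card V * p ^ card E"
  defines "\<Phi> \<equiv> min (real n) Q"
  assumes var: "c * Q\<^sup>2 \<le> variance (\<lambda>\<omega>. subgraph_count V E n (\<Gamma> \<omega>)) * \<Phi>"
  assumes j: "3 \<le> j"
  shows "\<bar>cumulants (moments M (normalized M (\<lambda>\<omega>. subgraph_count V E n (\<Gamma> \<omega>)))) j\<bar> / fact j
    \<le> (max 1 (exp 1 * (2 * (real (card V) + 1)) * (real (card V) ^ card V * 4 ^ card V) / sqrt c) ^ 3 / sqrt \<Phi>) ^ (j - 2)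
       * real j ^ (card V * (j - 2))"
proof -
  have finV: "finite V" using G by (simp add: simple_graph_def)
  have finE: "finite E" using G finite_all_edges [OF finV] finite_subset by (auto simp: simple_graph_def)
  define k where "k = card V"
  let ?a = "real (card (graph_automorphisms V E))"
  define v where "v = variance (copies V E)"
  define C0 where "C0 = exp 1 * (2 * (real k + 1)) * (real k ^ k * 4 ^ k)"
  define C where "C = max 1 (C0 / sqrt c)"
  define s where "s = sqrt \<Phi>"
  define \<sigma> where "\<sigma> = sqrt v"
  have Q: "0 < Q" using p01 n by (simp add: Q_def)
  have \<Phi>: "0 < \<Phi>" using Q n by (simp add: \<Phi>_def)
  have s: "0 < s" "s\<^sup>2 = \<Phi>" using \<Phi> by (simp_all add: s_def)
  have a: "1 \<le> ?a" using graph_automorphisms_pos [OF finV, of E] by simp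
  have C0: "0 \<le> C0" by (simp add: C0_def)
  have vN: "0 < variance (\<lambda>\<omega>. subgraph_count V E n (\<Gamma> \<omega>))"
  proof -
    have "0 < c * Q\<^sup>2" using c Q by simp
    then have "0 < variance (\<lambda>\<omega>. subgraph_count V E n (\<Gamma> \<omega>)) * \<Phi>" using var by linarith
    then show ?thesis using \<Phi> by (simp add: zero_less_mult_iff)
  qed
  have v: "0 < v"
    using vN unfolding variance_subgraph_count [OF finE] v_def by (simp add: zero_less_divide_iff)
  then have \<sigma>: "0 < \<sigma>" "\<sigma>\<^sup>2 = v" by (simp_all add: \<sigma>_def)
  \<comment> \<open>The hypothesis concerns the unlabelled count; as a(G) \<ge> 1, it passes to the
    larger variance of the labelled count.\<close>
  have "v / ?a\<^sup>2 \<le> v / 1"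
    using v a by (intro divide_left_mono) auto
  then have "c * Q\<^sup>2 \<le> v * \<Phi>"
    using var \<Phi> mult_right_mono [of "v / ?a\<^sup>2" v \<Phi>] unfolding variance_subgraph_count [OF finE] v_def [symmetric] by simp
  then have "(sqrt c * Q)\<^sup>2 \<le> (\<sigma> * s)\<^sup>2"
    using c s \<sigma> by (simp add: power_mult_distrib)
  then have "sqrt c * Q \<le> \<sigma> * s"
    by (rule power2_le_imp_le) (use \<sigma> s in simp)
  then have ratio: "Q / \<sigma> \<le> s / sqrt c"
    using c \<sigma> by (simp add: field_simps)
  have jm: "j = Suc (Suc (j - 2))" using j by simp
  define i where "i = j - 2"
  have ji: "j = i + 2" using j by (simp add: i_def)
  let ?\<kappa> = "cumulants (moments M (copies V E)) j"
  have "\<bar>?\<kappa>\<bar> * \<Phi> ^ (j - 1) \<le> Q ^ j * (real j ^ j * ((real (k * j) + 1) * real (k * j) ^ (k * j)))"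
    using cumulant_copies_bound [OF G n, of j] j unfolding Q_def \<Phi>_def k_def by (simp add: mult_ac)
  then have "\<bar>?\<kappa>\<bar> * \<Phi> ^ (j - 1) / fact j \<le> Q ^ j * (real j ^ j * ((real (k * j) + 1) * real (k * j) ^ (k * j)) / fact j)"
    by (simp add: divide_right_mono)
  also have "\<dots> \<le> Q ^ j * (C0 ^ j * real j ^ (k * i))"
    using factorial_growth [OF j, of k] Q unfolding C0_def i_def by (intro mult_left_mono) auto
  finally have b1: "\<bar>?\<kappa>\<bar> * \<Phi> ^ (j - 1) / fact j \<le> Q ^ j * (C0 ^ j * real j ^ (k * i))" .
  have "\<bar>?\<kappa> / \<sigma> ^ j\<bar> / fact j = (\<bar>?\<kappa>\<bar> * \<Phi> ^ (j - 1) / fact j) / (\<sigma> ^ j * \<Phi> ^ (j - 1))"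
    using \<sigma> \<Phi> by (simp add: abs_divide field_simps)
  also have "\<dots> \<le> (Q ^ j * (C0 ^ j * real j ^ (k * i))) / (\<sigma> ^ j * \<Phi> ^ (j - 1))"
    using b1 \<sigma> \<Phi> by (intro divide_right_mono) auto
  also have "\<dots> = (Q / \<sigma>) ^ j * (C0 ^ j * real j ^ (k * i) / \<Phi> ^ (j - 1))"
    by (simp add: power_divide)
  also have "\<dots> \<le> (s / sqrt c) ^ j * (C0 ^ j * real j ^ (k * i) / \<Phi> ^ (j - 1))"
    using ratio Q \<sigma> C0 \<Phi> by (intro mult_right_mono power_mono) auto
  also have "\<dots> = (C0 / sqrt c) ^ j * (real j ^ (k * i) * (s ^ j / \<Phi> ^ (j - 1)))"
    by (simp add: power_divide)
  also have "s ^ j / \<Phi> ^ (j - 1) = 1 / s ^ i"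
  proof -
    have idx: "2 * (j - 1) = j + i" using ji by simp
    have "\<Phi> ^ (j - 1) = s ^ (2 * (j - 1))" unfolding s(2) [symmetric] power_mult ..
    then have "\<Phi> ^ (j - 1) = s ^ j * s ^ i" unfolding idx power_add .
    then show ?thesis using s by simp
  qed
  \<comment> \<open>A constant to the power j must become one to the power j - 2: for C \<ge> 1 and
    j \<ge> 3 one has C^j \<le> C^(3 (j - 2)). This is the origin of the maximum with 1 and of the
    cube.\<close>
  also have "(C0 / sqrt c) ^ j * (real j ^ (k * i) * (1 / s ^ i)) \<le> C ^ (3 * i) * (real j ^ (k * i) * (1 / s ^ i))"
  proof (rule mult_right_mono)
    have "(C0 / sqrt c) ^ j \<le> C ^ j" using C0 c by (intro power_mono) (auto simp: C_def)
    also have "\<dots> \<le> C ^ (3 * i)" using j by (intro power_increasing) (auto simp: C_def i_def)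
    finally show "(C0 / sqrt c) ^ j \<le> C ^ (3 * i)" .
  qed (use s in simp)
  also have "\<dots> = (C ^ 3 / s) ^ i * real j ^ (k * i)"
    by (simp add: power_divide power_mult)
  finally have "\<bar>?\<kappa> / \<sigma> ^ j\<bar> / fact j \<le> (C ^ 3 / s) ^ i * real j ^ (k * i)" .
  moreover have "cumulants (moments M (normalized M (\<lambda>\<omega>. subgraph_count V E n (\<Gamma> \<omega>)))) j = ?\<kappa> / \<sigma> ^ j"
    unfolding \<sigma>_def v_def by (rule normalized_cumulants(4) [OF G(1) vN]) (use j in simp)
  ultimately show ?thesis
    unfolding C_def C0_def s_def i_def k_def by simp
qed

end

section \<open>Rewriting the growth conditions on a and p\<close>

lemma powr_scale_power:
  assumes x: "0 < x"
  shows "(x powr (1 / (2 + 4 * real k))) ^ (2 * k + 1) = sqrt x"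
proof -
  have "(x powr (1 / (2 + 4 * real k))) ^ (2 * k + 1) = x powr (1 / (2 + 4 * real k) * real (2 * k + 1))"
  proof -
    have "0 < x powr (1 / (2 + 4 * real k))" using x by simp
    then show ?thesis by (simp only: powr_realpow [symmetric] powr_powr)
  qed
  also have "1 / (2 + 4 * real k) * real (2 * k + 1) = 1 / 2"
  proof -
    have "2 + 4 * real k = 2 * real (2 * k + 1)" by simp
    then show ?thesis by (simp only:) simp
  qed
  finally show ?thesis using x by (simp add: powr_half_sqrt)
qed

text \<open>Raising to the power 2 k + 1, half of the denominator 2 + 4 k, brings the growth
  condition into the form \<open>small\<close> of \<open>gaussian_trunc_mgf_of_cumulants\<close>
  with \<theta> a constant times 1 / sqrt x.\<close>

lemma much_less_powr_scale:
  assumes "a \<lless> (\<lambda>n. x n powr (1 / (2 + 4 * real k)))" and x: "eventually (\<lambda>n. 0 < x n) sequentially"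
  shows "(\<lambda>n. a n ^ (2 * k + 1) / sqrt (x n)) \<longlonglongrightarrow> 0"
proof -
  have "(\<lambda>n. a n / x n powr (1 / (2 + 4 * real k))) \<longlonglongrightarrow> 0"
    using assms(1) by (simp add: much_less_def)
  then have "(\<lambda>n. (a n / x n powr (1 / (2 + 4 * real k))) ^ (2 * k + 1)) \<longlonglongrightarrow> 0 ^ (2 * k + 1)"
    by (rule tendsto_power)
  then have "(\<lambda>n. (a n / x n powr (1 / (2 + 4 * real k))) ^ (2 * k + 1)) \<longlonglongrightarrow> 0" by simp
  moreover have "eventually (\<lambda>n. (a n / x n powr (1 / (2 + 4 * real k))) ^ (2 * k + 1) = a n ^ (2 * k + 1) / sqrt (x n)) sequentially"
    using x by eventually_elim (simp only: power_divide powr_scale_power)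
  ultimately show ?thesis by (rule Lim_transform_eventually)
qed

text \<open>The threshold is the value of p at which n^k p^e = n.\<close>

lemma threshold_power:
  assumes n: "1 \<le> n" and e: "0 < e" and k: "1 \<le> k"
  shows "(real n powr (- ((real k - 1) / real e))) ^ e * real n ^ (k - 1) = 1"
proof -
  have n0: "0 < real n" using n by simp
  have "(real n powr (- ((real k - 1) / real e))) ^ e = real n powr (- ((real k - 1) / real e) * real e)"
    using n0 by (simp add: powr_powr powr_realpow [symmetric])
  also have "- ((real k - 1) / real e) * real e = - real (k - 1)" using e k by (simp add: of_nat_diff)
  finally have "(real n powr (- ((real k - 1) / real e))) ^ e = real n powr (- real (k - 1))" .
  then show ?thesis using n0 by (simp add: powr_minus powr_realpow)
qed

theorem corollary7p10:
  fixes M :: "nat \<Rightarrow> 'a measure"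
    and \<mu> :: "'v::euclidean_space measure"
    and H :: "'v \<Rightarrow> 'v \<Rightarrow> real"
    and p a :: "nat \<Rightarrow> real"
    and X :: "nat \<Rightarrow> nat \<Rightarrow> 'a \<Rightarrow> 'v"
    and \<Gamma> :: "nat \<Rightarrow> 'a \<Rightarrow> nat set set"
    and k :: nat
    and E :: "nat set set"
  defines "N \<equiv> \<lambda>n \<omega>. subgraph_count {1..k} E n (\<Gamma> n \<omega>)"
  assumes mu: "prob_space \<mu>" "sets \<mu> = sets borel" "\<And>x. measure \<mu> {x} = 0"
    and H: "(\<lambda>(x, y). H x y) \<in> borel_measurable (borel \<Otimes>\<^sub>M borel)"
           "\<And>x y. H x y \<in> {0..1}" "\<And>x y. H x y = H y x"
    and p: "\<And>n. n \<ge> 1 \<Longrightarrow> p n \<in> {0<..<1}"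
    and model: "\<And>n. n \<ge> 1 \<Longrightarrow> binomial_random_connection_model (M n) n \<mu> H (p n) (X n) (\<Gamma> n)"
    and G: "k \<ge> 2" "simple_graph {1..k} E" "connected_graph {1..k} E" "strongly_balanced {1..k} E"
    and var: "\<And>n. n \<ge> 1 \<Longrightarrow>
      prob_space.variance (M n)
        (\<lambda>\<omega>. \<Sum>l=1..k. subgraph_marginal \<mu> H (p n) {1..k} E l (X n 1 \<omega>)) > 0"
    and a: "filterlim a at_top sequentially"
    and dense: "(\<lambda>n. real n powr (- ((real k - 1) / real (card E)))) \<lless> p \<Longrightarrow>
      a \<lless> (\<lambda>n. real n powr (1 / (2 + 4 * real k)))"
    and sparse: "p \<lless> (\<lambda>n. real n powr (- ((real k - 1) / real (card E)))) \<Longrightarrow>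
      a \<lless> (\<lambda>n. (real n ^ k * p n ^ card E) powr (1 / (2 + 4 * real k)))"
    and cases: "(\<lambda>n. real n powr (- ((real k - 1) / real (card E)))) \<lless> p \<or>
      p \<lless> (\<lambda>n. real n powr (- ((real k - 1) / real (card E))))"
  shows "moderate_deviation_principle M (\<lambda>n \<omega>. normalized (M n) (N n) \<omega> / a n)
           (\<lambda>n. (a n)\<^sup>2) (\<lambda>x. ereal (x\<^sup>2 / 2))"
proof -
  define V where "V = {1..k}"
  define Q where "Q n = real n ^ k * p n ^ card E" for n
  define \<Phi> where "\<Phi> n = min (real n) (Q n)" for n
  define thr where "thr n = real n powr (- ((real k - 1) / real (card E)))" for n
  have V: "V \<noteq> {}" "finite V" "card V = k" and GV: "simple_graph V E" "strongly_balanced V E" "2 \<le> card V"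
    using G by (auto simp: V_def)
  have rc: "random_connection (M n) n \<mu> H (p n) (X n) (\<Gamma> n)" if "1 \<le> n" for n
  proof -
    have "prob_space (M n)" using model [OF that] by (simp add: binomial_random_connection_model_def)
    then show ?thesis
      using mu H p [OF that] model [OF that]
      by (auto simp: random_connection_def random_connection_axioms_def)
  qed
  have ps: "prob_space (M n)" if "1 \<le> n" for n
    using rc [OF that] by (simp add: random_connection_def)
  have p01: "0 < p n" "p n < 1" if "1 \<le> n" for n using p [OF that] by auto
  have n1: "eventually (\<lambda>n. 1 \<le> n) sequentially" by (rule eventually_ge_at_top)
  have n2k: "eventually (\<lambda>n. 2 * card V \<le> n) sequentially" by (rule eventually_ge_at_top)
  have finE: "finite E"
    using GV finite_all_edges [OF V(2)] finite_subset by (auto simp: simple_graph_def)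
  \<comment> \<open>A connected graph with at least two vertices has an edge, so the division by
    \<open>card E\<close> in the threshold is a genuine one.\<close>
  have e: "0 < card E"
  proof -
    have "(1, 2) \<in> {(x, y). {x, y} \<in> E}\<^sup>*"
      using G by (auto simp: connected_graph_def)
    then have "E \<noteq> {}" by (cases rule: converse_rtranclE) auto
    then show ?thesis using finE by (simp add: card_gt_0_iff)
  qed
  have Qpos: "0 < Q n" if "1 \<le> n" for n using p01 [OF that] that by (simp add: Q_def)
  \<comment> \<open>Q / n is the e-th power of p over the threshold, so the position of p relative
    to the threshold decides which of n and Q is \<Phi>.\<close>
  have Qthr: "Q n = real n * (p n / thr n) ^ card E" if n: "1 \<le> n" for n
  proof -
    have t: "thr n ^ card E * real n ^ (k - 1) = 1"
      unfolding thr_def by (rule threshold_power [OF n e]) (use G in simp)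
    then have "real n ^ (k - 1) = 1 / thr n ^ card E"
      by (metis mult.commute mult_zero_left nonzero_eq_divide_eq zero_neq_one)
    moreover have "real n ^ k = real n * real n ^ (k - 1)" using G by (cases k) auto
    ultimately show ?thesis by (simp add: Q_def power_divide)
  qed
  \<comment> \<open>The constants come from the model with n = 1: its variance hypothesis makes the
    marginal variance with edge parameter 1 and the integral \<rho> positive, and neither of them
    depends on n.\<close>
  interpret one: random_connection "M 1" 1 \<mu> H "p 1" "X 1" "\<Gamma> 1" by (rule rc) simp
  define S where "S = one.marginal_variance V E 1"
  define \<rho> where "\<rho> = (\<integral>x. edge_weight 1 H E x \<partial>(\<Pi>\<^sub>M v\<in>V. \<mu>))"
  have Sp: "0 < one.marginal_variance V E (p 1)"
    using var [of 1] one.marginal_variance_points [OF GV(1)] by (simp add: V_def)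
  then have S: "0 < S"
    unfolding one.marginal_variance_scale S_def by (simp add: zero_less_mult_iff)
  have \<rho>: "0 < \<rho>"
    using one.copy_prob_pos [OF GV(1) Sp] p01 [of 1] unfolding one.copy_prob_scale \<rho>_def
    by (simp add: zero_less_mult_iff)
  \<comment> \<open>The two regimes enter the rest of the proof only through these facts: the
    variance is at least c Q^2 / \<Phi>, and a^(2 k + 1) is negligible against sqrt \<Phi>.\<close>
  have key: "\<exists>c>0. eventually (\<lambda>n. c * (Q n)\<^sup>2 \<le> prob_space.variance (M n) (N n) * \<Phi> n) sequentially \<and>
      (\<lambda>n. a n ^ (2 * k + 1) / sqrt (\<Phi> n)) \<longlonglongrightarrow> 0"
    using cases
  proof
    assume d: "(\<lambda>n. real n powr (- ((real k - 1) / real (card E)))) \<lless> p"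
    have "(\<lambda>n. thr n / p n) \<longlonglongrightarrow> 0" using d by (simp add: much_less_def thr_def)
    then have "eventually (\<lambda>n. thr n / p n < 1) sequentially" by (rule order_tendstoD) simp
    then have \<Phi>n: "eventually (\<lambda>n. \<Phi> n = real n) sequentially"
      using n1
    proof eventually_elim
      case (elim n)
      have "0 < thr n" using elim by (simp add: thr_def)
      then have "1 \<le> p n / thr n" using elim p01 [of n] by (simp add: field_simps)
      then have "1 \<le> (p n / thr n) ^ card E" by (rule one_le_power)
      then have "real n * 1 \<le> Q n" unfolding Qthr [OF elim(2)] by (intro mult_left_mono) auto
      then show ?case by (simp add: \<Phi>_def)
    qed
    have "eventually (\<lambda>n. S / 4 ^ k * (Q n)\<^sup>2 \<le> prob_space.variance (M n) (N n) * \<Phi> n) sequentially"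
      using \<Phi>n n1 n2k
    proof eventually_elim
      case (elim n)
      interpret random_connection "M n" n \<mu> H "p n" "X n" "\<Gamma> n" by (rule rc) fact
      have "marginal_variance V E 1 = S"
        unfolding S_def marginal_variance_def one.marginal_variance_def ..
      then show ?case
        using variance_dense [OF GV(1) V(1) elim(2,3)] S elim(1)
        unfolding N_def Q_def V_def [symmetric] V(3) by simp
    qed
    moreover have "(\<lambda>n. a n ^ (2 * k + 1) / sqrt (\<Phi> n)) \<longlonglongrightarrow> 0"
    proof (rule Lim_transform_eventually)
      show "(\<lambda>n. a n ^ (2 * k + 1) / sqrt (real n)) \<longlonglongrightarrow> 0"
        by (rule much_less_powr_scale [OF dense [OF d]]) (use n1 in \<open>eventually_elim, simp\<close>)
      show "eventually (\<lambda>n. a n ^ (2 * k + 1) / sqrt (real n) = a n ^ (2 * k + 1) / sqrt (\<Phi> n)) sequentially"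
        using \<Phi>n by eventually_elim simp
    qed
    ultimately show ?thesis using S by (intro exI [of _ "S / 4 ^ k"]) auto
  next
    assume s: "p \<lless> (\<lambda>n. real n powr (- ((real k - 1) / real (card E))))"
    have "(\<lambda>n. p n / thr n) \<longlonglongrightarrow> 0" using s by (simp add: much_less_def thr_def)
    then have "(\<lambda>n. (p n / thr n) ^ card E) \<longlonglongrightarrow> 0 ^ card E" by (rule tendsto_power)
    then have lim: "(\<lambda>n. (p n / thr n) ^ card E) \<longlonglongrightarrow> 0" using e by (simp add: zero_power)
    \<comment> \<open>Once (p / thr)^e < b, the condition k^2 n^(k - 1) p^e \<le> 1 / 2 of
      \<open>variance_sparse\<close> holds; b \<le> 1 also yields \<Phi> = Q.\<close>
    define b where "b = 1 / (2 * (real k)\<^sup>2)"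
    have b: "0 < b" "b \<le> 1"
    proof -
      have k2: "1 \<le> (real k)\<^sup>2" using G by (simp add: one_le_power)
      then have pos: "0 < 2 * (real k)\<^sup>2" by linarith
      show "0 < b" unfolding b_def using pos by (rule divide_pos_pos [OF zero_less_one])
      show "b \<le> 1" unfolding b_def divide_le_eq_1_pos [OF pos] using k2 by linarith
    qed
    have small: "eventually (\<lambda>n. (p n / thr n) ^ card E < b) sequentially"
      by (rule order_tendstoD(2) [OF lim b(1)])
    have \<Phi>Q: "eventually (\<lambda>n. \<Phi> n = Q n) sequentially"
      using small n1
    proof eventually_elim
      case (elim n)
      have "Q n \<le> real n * 1" unfolding Qthr [OF elim(2)] using elim b by (intro mult_left_mono) auto
      then show ?case by (simp add: \<Phi>_def)
    qed
    let ?c = "\<rho> / (2 * 2 ^ k * (real (card (graph_automorphisms V E)))\<^sup>2)"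
    have "eventually (\<lambda>n. ?c * (Q n)\<^sup>2 \<le> prob_space.variance (M n) (N n) * \<Phi> n) sequentially"
      using \<Phi>Q small n1 n2k
    proof eventually_elim
      case (elim n)
      interpret random_connection "M n" n \<mu> H "p n" "X n" "\<Gamma> n" by (rule rc) fact
      have "real n * (real n ^ (k - 1) * p n ^ card E) = real n * (p n / thr n) ^ card E"
        using Qthr [OF elim(3)] G by (cases k) (auto simp: Q_def)
      then have "real n ^ (k - 1) * p n ^ card E = (p n / thr n) ^ card E" using elim by simp
      then have "real n ^ (k - 1) * p n ^ card E \<le> b" using elim by simp
      then have "(real k)\<^sup>2 * (real n ^ (k - 1) * p n ^ card E) \<le> (real k)\<^sup>2 * b" by (intro mult_left_mono) auto
      also have "\<dots> = 1 / 2" using G by (simp add: b_def)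
      finally have "real (card V ^ 2 * n ^ (card V - 1)) * p n ^ card E \<le> 1 / 2" by (simp add: V(3) mult.assoc)
      from variance_sparse [OF GV(1) V(1) elim(4) this]
      have "?c * Q n \<le> variance (N n)" unfolding N_def Q_def V_def [symmetric] V(3) \<rho>_def .
      then have "?c * Q n * Q n \<le> variance (N n) * Q n"
        using Qpos [OF elim(3)] by (intro mult_right_mono) auto
      then show ?case unfolding elim(1) by (simp add: power2_eq_square mult.assoc)
    qed
    moreover have "(\<lambda>n. a n ^ (2 * k + 1) / sqrt (\<Phi> n)) \<longlonglongrightarrow> 0"
    proof (rule Lim_transform_eventually)
      have "eventually (\<lambda>n. 0 < Q n) sequentially" using n1 by eventually_elim (rule Qpos)
      then show "(\<lambda>n. a n ^ (2 * k + 1) / sqrt (Q n)) \<longlonglongrightarrow> 0"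
        unfolding Q_def by (rule much_less_powr_scale [OF sparse [OF s]])
      show "eventually (\<lambda>n. a n ^ (2 * k + 1) / sqrt (Q n) = a n ^ (2 * k + 1) / sqrt (\<Phi> n)) sequentially"
        using \<Phi>Q by eventually_elim simp
    qed
    moreover have "0 < ?c"
      using \<rho> graph_automorphisms_pos [OF V(2), of E] by simp
    ultimately show ?thesis by blast
  qed
  then obtain c where c: "0 < c"
    and cvar: "eventually (\<lambda>n. c * (Q n)\<^sup>2 \<le> prob_space.variance (M n) (N n) * \<Phi> n) sequentially"
    and lim: "(\<lambda>n. a n ^ (2 * k + 1) / sqrt (\<Phi> n)) \<longlonglongrightarrow> 0" by blast
  \<comment> \<open>The constant of \<open>normalized_cumulant_bound\<close>, so that \<theta> = K /
    sqrt \<Phi> below.\<close>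
  define K where "K = max 1 (exp 1 * (2 * (real k + 1)) * (real k ^ k * 4 ^ k) / sqrt c) ^ 3"
  have vpos: "0 < prob_space.variance (M n) (N n)"
    if "1 \<le> n" "c * (Q n)\<^sup>2 \<le> prob_space.variance (M n) (N n) * \<Phi> n" for n
  proof -
    have "0 < c * (Q n)\<^sup>2" "0 < \<Phi> n" using c Qpos [OF that(1)] that(1) by (simp_all add: \<Phi>_def)
    then have "0 < prob_space.variance (M n) (N n) * \<Phi> n" using that(2) by linarith
    then show ?thesis using \<open>0 < \<Phi> n\<close> by (simp add: zero_less_mult_iff)
  qed
  have ps_ev: "eventually (\<lambda>n. prob_space (M n)) sequentially"
    using n1 by eventually_elim (rule ps)
  have props: "eventually (\<lambda>n. (\<forall>j. integrable (M n) (\<lambda>\<omega>. normalized (M n) (N n) \<omega> ^ j)) \<and>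
      cumulants (moments (M n) (normalized (M n) (N n))) 1 = 0 \<and>
      cumulants (moments (M n) (normalized (M n) (N n))) 2 = 1 \<and>
      (\<forall>j\<ge>3. \<bar>cumulants (moments (M n) (normalized (M n) (N n))) j\<bar> / fact j
         \<le> (K / sqrt (\<Phi> n)) ^ (j - 2) * real j ^ (k * (j - 2)))) sequentially"
    using n1 cvar
  proof eventually_elim
    case (elim n)
    interpret random_connection "M n" n \<mu> H "p n" "X n" "\<Gamma> n" by (rule rc) fact
    have vp: "0 < variance (\<lambda>\<omega>. subgraph_count V E n (\<Gamma> n \<omega>))"
      using vpos [OF elim] unfolding N_def V_def [symmetric] .
    have Neq: "N n = (\<lambda>\<omega>. subgraph_count V E n (\<Gamma> n \<omega>))" unfolding N_def V_def ..
    have "\<bar>cumulants (moments (M n) (normalized (M n) (N n))) j\<bar> / fact j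
         \<le> (K / sqrt (\<Phi> n)) ^ (j - 2) * real j ^ (k * (j - 2))" if "3 \<le> j" for j
      using normalized_cumulant_bound [OF GV elim(1) c _ that] elim(2)
      unfolding Neq K_def \<Phi>_def Q_def V(3) by blast
    then show ?case
      using normalized_cumulants(1-3) [OF GV(1) vp] unfolding Neq by blast
  qed
  have "gaussian_trunc_mgf M (\<lambda>n. normalized (M n) (N n)) a t" for t
  proof (rule gaussian_trunc_mgf_of_cumulants [OF ps_ev, where \<theta> = "\<lambda>n. K / sqrt (\<Phi> n)" and k = k])
    show "eventually (\<lambda>n. \<forall>j. integrable (M n) (\<lambda>\<omega>. normalized (M n) (N n) \<omega> ^ j)) sequentially"
      using props by eventually_elim blast
    show "eventually (\<lambda>n. cumulants (moments (M n) (normalized (M n) (N n))) 1 = 0) sequentially"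
      using props by eventually_elim blast
    show "eventually (\<lambda>n. cumulants (moments (M n) (normalized (M n) (N n))) 2 = 1) sequentially"
      using props by eventually_elim blast
    show "eventually (\<lambda>n. \<forall>j\<ge>3. \<bar>cumulants (moments (M n) (normalized (M n) (N n))) j\<bar> / fact j
         \<le> (K / sqrt (\<Phi> n)) ^ (j - 2) * real j ^ (k * (j - 2))) sequentially"
      using props by eventually_elim blast
    show "eventually (\<lambda>n. 0 \<le> K / sqrt (\<Phi> n)) sequentially"
      using n1 by eventually_elim (use Qpos in \<open>simp add: K_def \<Phi>_def less_imp_le\<close>)
    show "(\<lambda>n. K / sqrt (\<Phi> n) * a n ^ (2 * k + 1)) \<longlonglongrightarrow> 0"
      using tendsto_mult_right_zero [OF lim, of K] by simp
  qed (rule a)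
  moreover have "eventually (\<lambda>n. \<forall>j. integrable (M n) (\<lambda>\<omega>. normalized (M n) (N n) \<omega> ^ j)) sequentially"
    using props by eventually_elim blast
  ultimately show ?thesis
    using moderate_deviation_principle_of_trunc_mgf [OF ps_ev _ a, of "\<lambda>n. normalized (M n) (N n)"] by blast
qed

end
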